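(* Let $m\ge2$ and let $d_2,\dots,d_m\in\mathbb N$ be such that $d_j\ge2$ for each $j=2,\dots,m$. Let $h_1$ be a polynomial of degree $d_1$ (for some $d_1\in\mathbb N$, $d_1\ge2$) with $\mathrm{int}(K(h_1))\ne\emptyset$ and such that $\langle h_1\rangle\in\mathcal G$. Let $b_2,b_3,\dots,b_m\in\mathrm{int}(K(h_1))$. Then all of the following statements hold. 1. Suppose that $\langle h_1\rangle$ is semi-hyperbolic (resp. hyperbolic). Then there exists a number $c>0$ such that for each $(a_2,a_3,\dots,a_m)\in\mathbb C^{m-1}$ with $0<|a_j|<c$ $(j=2,\dots,m)$, setting $h_j(z)=a_j(z-b_j)^{d_j}+b_j$ $(j=2,\dots,m)$, the polynomial semigroup $G=\langle h_1,\dots,h_m\rangle$ satisfies that $G\in\mathcal G$, $\hat K(G)=K(h_1)$ and $G$ is semi-hyperbolic (resp. hyperbolic). 2. Suppose that $\langle h_1\rangle$ is semi-hyperbolic (resp. hyperbolic). Suppose also that either (i) there exists a $j\ge2$ with $d_j\ge3$, or (ii) $\deg(h_1)=3$ and $b_2=\cdots=b_m$. Then there exist $a_2,a_3,\dots,a_m>0$ such that, setting $h_j(z)=a_j(z-b_j)^{d_j}+b_j$ $(j=2,\dots,m)$, the polynomial semigroup $G=\langle h_1,h_2,\dots,h_m\rangle$ satisfies that $G\in\mathcal G_{dis}$, $\hat K(G)=K(h_1)$ and $G$ is semi-hyperbolic (resp. hyperbolic).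
   Context: $\hat{\mathbb C}$ is the Riemann sphere. A polynomial semigroup is a semigroup under composition generated by a family of non-constant polynomials; $\langle h_1,\dots,h_m\rangle$ is the semigroup generated by $h_1,\dots,h_m$. $F(G)$ is the set of points of $\hat{\mathbb C}$ having a neighborhood on which $G$ is normal, $J(G)=\hat{\mathbb C}\setminus F(G)$. $P(G)=\overline{\bigcup_{g\in G}\{\text{critical values of }g\}}$, $P^{*}(G)=P(G)\setminus\{\infty\}$. $\mathcal G$: polynomial semigroups with all elements of degree $\ge2$ and $P^{*}(G)$ bounded in $\mathbb C$; $\mathcal G_{dis}$: those $G\in\mathcal G$ with $J(G)$ disconnected. $\hat K(G)=\{z\in\mathbb C:\bigcup_{g\in G}\{g(z)\}\text{ is bounded in }\mathbb C\}$ and $K(h)=\hat K(\langle h\rangle)$. $G$ is hyperbolic if $P(G)\subset F(G)$. $G$ is semi-hyperbolic if there exist $\delta>0$ and $N\in\mathbb N$ such that for each $y\in J(G)$ and $g\in G$, $\deg(g:V\to B(y,\delta))\le N$ for each connected component $V$ of $g^{-1}(B(y,\delta))$, where $B(y,\delta)$ is the spherical ball and $\deg$ is the degree of a finite branched covering. *)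

theory Defs
  imports "HOL-Analysis.Analysis" "HOL-Computational_Algebra.Polynomial"
begin

datatype rsphere = Fin complex | Infty

fun stereo :: "rsphere \<Rightarrow> complex \<times> real" where
  "stereo (Fin z) = (of_real (2 / (1 + (cmod z)\<^sup>2)) * z, ((cmod z)\<^sup>2 - 1) / ((cmod z)\<^sup>2 + 1))"
| "stereo Infty = (0, 1)"

lemma norm_stereo: "norm (stereo x) = 1"
proof (cases x)
  case (Fin z)
  define t where "t = (cmod z)\<^sup>2"
  have t: "t \<ge> 0" by (simp add: t_def)
  have "(norm (stereo x))\<^sup>2 = (2 / (1 + t))\<^sup>2 * t + ((t - 1) / (t + 1))\<^sup>2"
  proof -
    have "norm (complex_of_real (2 / (1 + t)) * z) = 2 / (1 + t) * cmod z"
      using t unfolding norm_mult norm_of_real by simp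
    then have "(norm (complex_of_real (2 / (1 + t)) * z))\<^sup>2 = (2 / (1 + t))\<^sup>2 * t"
      by (simp only: power_mult_distrib t_def)
    then show ?thesis
      unfolding Fin stereo.simps norm_Pair t_def[symmetric]
      using t by (simp only: real_norm_def power2_abs) simp
  qed
  also have "\<dots> = (4 * t + (t - 1)\<^sup>2) / (1 + t)\<^sup>2"
    by (simp add: power_divide add_divide_distrib add.commute)
  also have "4 * t + (t - 1)\<^sup>2 = (1 + t)\<^sup>2"
    by (simp add: power2_eq_square algebra_simps)
  finally have "(norm (stereo x))\<^sup>2 = 1" using t by simp
  then show ?thesis by (simp add: power2_eq_1_iff) (metis norm_ge_zero not_one_le_zero le_minus_one_simps(3))
qed (simp add: norm_Pair)

lemma inj_stereo: "inj stereo"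
proof (rule injI)
  have fin: "1 - snd (stereo (Fin z)) = 2 / (1 + (cmod z)\<^sup>2)" for z
  proof -
    have "1 + (cmod z)\<^sup>2 \<noteq> 0" by (smt (verit) zero_le_power2)
    then show ?thesis by (simp add: field_simps)
  qed
  have pos: "2 / (1 + (cmod z)\<^sup>2) \<noteq> 0" for z
    by (smt (verit) zero_le_power2 divide_eq_0_iff)
  fix x y assume eq: "stereo x = stereo y"
  show "x = y"
  proof (cases x; cases y)
    fix z w assume xy: "x = Fin z" "y = Fin w"
    have "2 / (1 + (cmod z)\<^sup>2) = 2 / (1 + (cmod w)\<^sup>2)"
      using eq fin[of z] fin[of w] xy by metis
    moreover have "of_real (2 / (1 + (cmod z)\<^sup>2)) * z = of_real (2 / (1 + (cmod w)\<^sup>2)) * w"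
      using eq unfolding xy stereo.simps by blast
    ultimately have "of_real (2 / (1 + (cmod z)\<^sup>2)) * z = of_real (2 / (1 + (cmod z)\<^sup>2)) * w"
      by metis
    with pos[of z] show ?thesis
      unfolding xy mult_cancel_left of_real_eq_0_iff by blast
  next
    fix z assume "x = Fin z" "y = Infty"
    then show ?thesis using eq fin[of z] pos[of z] by (metis diff_self snd_conv stereo.simps(2))
  next
    fix z assume "x = Infty" "y = Fin z"
    then show ?thesis using eq fin[of z] pos[of z] by (metis diff_self snd_conv stereo.simps(2))
  qed simp
qed

lemma arccos_inner_triangle:
  fixes a b c :: "'a::real_inner"
  assumes "norm a = 1" "norm b = 1" "norm c = 1"
  shows "arccos (a \<bullet> c) \<le> arccos (a \<bullet> b) + arccos (b \<bullet> c)"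
proof -
  have bd: "\<bar>u \<bullet> v\<bar> \<le> 1" if "norm u = 1" "norm v = 1" for u v :: 'a
    using Cauchy_Schwarz_ineq2[of u v] that by simp
  have sq: "u \<bullet> u = 1" if "norm u = 1" for u :: 'a
    using that by (simp add: dot_square_norm)
  define \<alpha> \<beta> where "\<alpha> = arccos (a \<bullet> b)" and "\<beta> = arccos (b \<bullet> c)"
  have ab: "cos \<alpha> = a \<bullet> b" "cos \<beta> = b \<bullet> c" "0 \<le> \<alpha>" "\<alpha> \<le> pi" "0 \<le> \<beta>" "\<beta> \<le> pi"
    using bd[OF assms(1,2)] bd[OF assms(2,3)]
    by (auto simp: \<alpha>_def \<beta>_def abs_le_iff cos_arccos_abs intro!: arccos_lbound arccos_ubound)
  show ?thesis
  proof (cases "\<alpha> + \<beta> \<le> pi")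
    case True
    have na: "norm (a - (a \<bullet> b) *\<^sub>R b) = sin \<alpha>"
    proof (rule power2_eq_imp_eq)
      have "(norm (a - (a \<bullet> b) *\<^sub>R b))\<^sup>2 = 1 - (cos \<alpha>)\<^sup>2"
        using sq[OF assms(1)] sq[OF assms(2)] unfolding ab power2_norm_eq_inner
        by (simp add: inner_diff inner_commute power2_eq_square)
      then show "(norm (a - (a \<bullet> b) *\<^sub>R b))\<^sup>2 = (sin \<alpha>)\<^sup>2" by (simp add: sin_squared_eq)
    qed (use ab in \<open>auto intro: sin_ge_zero\<close>)
    have nc: "norm (c - (b \<bullet> c) *\<^sub>R b) = sin \<beta>"
    proof (rule power2_eq_imp_eq)
      have "(norm (c - (b \<bullet> c) *\<^sub>R b))\<^sup>2 = 1 - (cos \<beta>)\<^sup>2"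
        using sq[OF assms(3)] sq[OF assms(2)] unfolding ab power2_norm_eq_inner
        by (simp add: inner_diff inner_commute power2_eq_square)
      then show "(norm (c - (b \<bullet> c) *\<^sub>R b))\<^sup>2 = (sin \<beta>)\<^sup>2" by (simp add: sin_squared_eq)
    qed (use ab in \<open>auto intro: sin_ge_zero\<close>)
    have "(a - (a \<bullet> b) *\<^sub>R b) \<bullet> (c - (b \<bullet> c) *\<^sub>R b) = a \<bullet> c - (a \<bullet> b) * (b \<bullet> c)"
      using sq[OF assms(2)] by (simp add: inner_diff inner_commute algebra_simps)
    then have "a \<bullet> c \<ge> cos (\<alpha> + \<beta>)"
      using Cauchy_Schwarz_ineq2[of "a - (a \<bullet> b) *\<^sub>R b" "c - (b \<bullet> c) *\<^sub>R b"]
      unfolding na nc by (simp add: cos_add ab)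
    then have "arccos (a \<bullet> c) \<le> arccos (cos (\<alpha> + \<beta>))"
      using bd[OF assms(1,3)] by (intro arccos_le_arccos) auto
    also have "\<dots> = \<alpha> + \<beta>" using True ab by (intro arccos_cos) auto
    finally show ?thesis by (simp add: \<alpha>_def \<beta>_def)
  next
    case False
    then show ?thesis using arccos_ubound[of "a \<bullet> c"] bd[OF assms(1,3)]
      by (auto simp: \<alpha>_def \<beta>_def abs_le_iff)
  qed
qed

text \<open>The balls, the topology and the uniform structure of \<open>rsphere\<close> all refer to the angle metric
  on the unit sphere.\<close>

instantiation rsphere :: metric_space
begin

definition dist_rsphere :: "rsphere \<Rightarrow> rsphere \<Rightarrow> real" where
  "dist x y = arccos (stereo x \<bullet> stereo y)"

definition uniformity_rsphere :: "(rsphere \<times> rsphere) filter" where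
  "(uniformity :: (rsphere \<times> rsphere) filter) = (INF e\<in>{0<..}. principal {(x, y). dist x y < e})"

definition open_rsphere :: "rsphere set \<Rightarrow> bool" where
  "open (U :: rsphere set) \<longleftrightarrow> (\<forall>x\<in>U. eventually (\<lambda>(x', y). x' = x \<longrightarrow> y \<in> U) uniformity)"

instance
proof
  fix x y z :: rsphere
  have "stereo x \<bullet> stereo y = 1 \<longleftrightarrow> stereo x = stereo y"
  proof -
    have "(norm (stereo x - stereo y))\<^sup>2 = 2 - 2 * (stereo x \<bullet> stereo y)"
      using norm_stereo[of x] norm_stereo[of y] dot_square_norm[of "stereo x"] dot_square_norm[of "stereo y"]
      by (simp add: power2_norm_eq_inner inner_diff inner_commute)
    then show ?thesis
      by (smt (verit) norm_eq_zero right_minus_eq zero_eq_power2)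
  qed
  moreover have "arccos (stereo x \<bullet> stereo y) = 0 \<longleftrightarrow> stereo x \<bullet> stereo y = 1"
    using Cauchy_Schwarz_ineq2[of "stereo x" "stereo y"] norm_stereo
    by (metis arccos_1 cos_arccos_abs cos_zero mult_1)
  ultimately show "dist x y = 0 \<longleftrightarrow> x = y"
    using inj_stereo by (auto simp: dist_rsphere_def inj_eq)
  show "dist x y \<le> dist x z + dist y z"
    using arccos_inner_triangle[of "stereo x" "stereo z" "stereo y"]
    by (simp add: dist_rsphere_def norm_stereo inner_commute)
qed (simp_all add: uniformity_rsphere_def open_rsphere_def)

end

fun sphere_map :: "complex poly \<Rightarrow> rsphere \<Rightarrow> rsphere" where
  "sphere_map p (Fin z) = Fin (poly p z)"
| "sphere_map p Infty = (if degree p = 0 then Fin (coeff p 0) else Infty)"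

text \<open>Valency of a non-constant polynomial at a point of the sphere. In the chart \<open>1/z\<close> a
  polynomial of degree \<open>n\<close> vanishes to order \<open>n\<close> at infinity.\<close>

fun local_degree :: "complex poly \<Rightarrow> rsphere \<Rightarrow> nat" where
  "local_degree p (Fin z) = order z (p - [:poly p z:])"
| "local_degree p Infty = degree p"

text \<open>Infinity is a fixed point of local degree \<open>degree p\<close>, hence critical iff this is at least 2.\<close>

definition critical_points :: "complex poly \<Rightarrow> rsphere set" where
  "critical_points p = Fin ` {z. poly (pderiv p) z = 0} \<union> (if degree p \<ge> 2 then {Infty} else {})"

definition critical_values :: "complex poly \<Rightarrow> rsphere set" where
  "critical_values p = sphere_map p ` critical_points p"

text \<open>\<open>p\<close> restricts to a finite branched covering \<open>V \<rightarrow> W\<close> of degree \<open>n\<close>: every point of \<open>W\<close> has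
  exactly \<open>n\<close> preimages in \<open>V\<close>, counted with multiplicity.\<close>

definition has_covering_degree ::
    "complex poly \<Rightarrow> rsphere set \<Rightarrow> rsphere set \<Rightarrow> nat \<Rightarrow> bool" where
  "has_covering_degree p V W n \<longleftrightarrow>
     sphere_map p ` V \<subseteq> W \<and>
     (\<forall>w\<in>W. finite {x\<in>V. sphere_map p x = w} \<and>
            (\<Sum>x | x \<in> V \<and> sphere_map p x = w. local_degree p x) = n)"

inductive_set semigroup_generated :: "complex poly set \<Rightarrow> complex poly set" ("\<langle>_\<rangle>")
  for H :: "complex poly set" where
  generator: "h \<in> H \<Longrightarrow> h \<in> \<langle>H\<rangle>"
| compose: "\<lbrakk>f \<in> \<langle>H\<rangle>; g \<in> \<langle>H\<rangle>\<rbrakk> \<Longrightarrow> f \<circ>\<^sub>p g \<in> \<langle>H\<rangle>"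

definition polynomial_semigroup :: "complex poly set \<Rightarrow> bool" where
  "polynomial_semigroup G \<longleftrightarrow> (\<exists>H. H \<noteq> {} \<and> (\<forall>h\<in>H. degree h \<ge> 1) \<and> G = \<langle>H\<rangle>)"

definition normal_family_on :: "rsphere set \<Rightarrow> (rsphere \<Rightarrow> rsphere) set \<Rightarrow> bool" where
  "normal_family_on U \<F> \<longleftrightarrow>
     (\<forall>f::nat \<Rightarrow> rsphere \<Rightarrow> rsphere. range f \<subseteq> \<F> \<longrightarrow>
        (\<exists>r g. strict_mono r \<and>
           (\<forall>C. compact C \<and> C \<subseteq> U \<longrightarrow> uniform_limit C (\<lambda>n. f (r n)) g sequentially)))"

definition Fatou :: "complex poly set \<Rightarrow> rsphere set" where
  "Fatou G = {x. \<exists>U. open U \<and> x \<in> U \<and> normal_family_on U (sphere_map ` G)}"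

definition Julia :: "complex poly set \<Rightarrow> rsphere set" where
  "Julia G = - Fatou G"

definition postcritical :: "complex poly set \<Rightarrow> rsphere set" where
  "postcritical G = closure (\<Union>g\<in>G. critical_values g)"

definition planar_postcritical :: "complex poly set \<Rightarrow> complex set" where
  "planar_postcritical G = {z. Fin z \<in> postcritical G}"

definition calG :: "complex poly set set" ("\<G>") where
  "\<G> = {G. polynomial_semigroup G \<and> (\<forall>g\<in>G. degree g \<ge> 2) \<and> bounded (planar_postcritical G)}"

definition calG_dis :: "complex poly set set" ("\<G>\<^sub>d\<^sub>i\<^sub>s") where
  "\<G>\<^sub>d\<^sub>i\<^sub>s = {G \<in> \<G>. \<not> connected (Julia G)}"

definition K_hat :: "complex poly set \<Rightarrow> complex set" where
  "K_hat G = {z. bounded (\<Union>g\<in>G. {poly g z})}"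

definition filled_Julia :: "complex poly \<Rightarrow> complex set" where
  "filled_Julia h = K_hat \<langle>{h}\<rangle>"

definition hyperbolic :: "complex poly set \<Rightarrow> bool" where
  "hyperbolic G \<longleftrightarrow> postcritical G \<subseteq> Fatou G"

definition semi_hyperbolic :: "complex poly set \<Rightarrow> bool" where
  "semi_hyperbolic G \<longleftrightarrow>
     (\<exists>\<delta>>0. \<exists>N. \<forall>y\<in>Julia G. \<forall>g\<in>G. \<forall>V\<in>components (sphere_map g -` ball y \<delta>).
        \<exists>n\<le>N. has_covering_degree g V (ball y \<delta>) n)"

definition centered_power :: "complex \<Rightarrow> complex \<Rightarrow> nat \<Rightarrow> complex poly" where
  "centered_power a b d = smult a ([:- b, 1:] ^ d) + [:b:]"

definition extended_semigroup ::
    "complex poly \<Rightarrow> nat \<Rightarrow> (nat \<Rightarrow> nat) \<Rightarrow> (nat \<Rightarrow> complex) \<Rightarrow> (nat \<Rightarrow> complex) \<Rightarrow> complex poly set" where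
  "extended_semigroup h1 m d b a = \<langle>{h1} \<union> {centered_power (a j) (b j) (d j) | j. j \<in> {2..m}}\<rangle>"

end

theory Submission
  imports Defs "HOL-Complex_Analysis.Complex_Analysis"
    "HOL-Computational_Algebra.Computational_Algebra"
begin

text \<open>Let \<open>K\<close> be the filled Julia set of \<open>h\<close>. For small coefficients the additional generators map \<open>K\<close>
  into a compact set \<open>B\<close> in the interior of \<open>K\<close> that contains their finite critical values, so \<open>K\<close>
  contains all finite critical values of the semigroup and its interior is normal. If preimages of
  small discs centred on the boundary of \<open>K\<close> under iterates of \<open>h\<close> have bounded degree, the maximum
  principle makes their components uniformly small once the disc is shrunk. Since boundary points
  pull back to boundary points, orbits of \<open>B\<close> under \<open>h\<close> then stay away from the boundary, which gives
  hyperbolicity. For semi-hyperbolicity, write an element as an iterate of \<open>h\<close> followed (on the right)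
  by a factor whose critical values lie in \<open>B\<close>: near the boundary the iterate has bounded degree and its
  components are too small to meet \<open>B\<close>, hence the other factor is univalent over them; away from
  \<open>K\<close> the element has no critical values at all. For the disconnected case the coefficients are chosen so
  that every generator maps some fixed annulus either into the interior of \<open>K\<close> or into the basin of
  infinity.\<close>

section \<open>Roots of polynomials with multiplicity\<close>

text \<open>The iterates of \<open>h\<close> have unbounded degree, so an estimate near the boundary
  of K may depend on a component only through the number of preimages in it. Three facts suffice:
  this number is constant over a disc, the polynomial is the product of the linear factors of the
  roots in the component and a cofactor without zeros there, and all components lie in one fixed
  disc. Both alternatives for disconnectedness are cases of 1/p + 1/e < 1, where p is any degree
  among the generators whose coefficients tend to zero and e bounds the degrees of all other
  generators from below. With small coefficients u^(-6(p-1)) the Julia sets of the former lie at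
  radius u^6. The other generators send radius u^(6/e) out to size u^6, while the former still pull
  radius u^(6(p-1)/p) back to bounded size. The inequality says that there is room between the two
  exponents. The exponent 6 makes 6/e an integer and the room at least one in both cases: (e, 6/e) =
  (2, 3) with p >= 3, and (e, 6/e) = (3, 2) with p >= 2.\<close>

definition root_count :: "complex poly \<Rightarrow> complex set \<Rightarrow> complex \<Rightarrow> nat" where
  "root_count p V w = size (filter_mset (\<lambda>x. x \<in> V) (proots (p - [:w:])))"

lemma degree_minus_const [simp]:
  fixes p :: "complex poly"
  shows "degree (p - [:w:]) = degree p"
proof (cases "degree p = 0")
  case True
  then show ?thesis by (metis degree_diff_le degree_pCons_0 le_zero_eq order_refl)
next
  case False
  then show ?thesis
    using degree_add_eq_left[of "- [:w:]" p] by (simp only: diff_conv_add_uminus) simp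
qed

lemma minus_const_nonzero: "degree p \<ge> 1 \<Longrightarrow> p - [:w:] \<noteq> (0 :: complex poly)"
  by (metis degree_minus_const degree_0 not_one_le_zero)

lemma finite_level_set: "degree p \<ge> 1 \<Longrightarrow> finite {x. poly p x = (w::complex)}"
  using poly_roots_finite[OF minus_const_nonzero, of p w] by simp

lemma root_count_eq_sum:
  assumes "degree p \<ge> 1"
  shows "root_count p V w = (\<Sum>x | x \<in> V \<and> poly p x = w. order x (p - [:w:]))"
proof -
  have nz: "p - [:w:] \<noteq> 0" using minus_const_nonzero[OF assms] .
  have s: "set_mset (filter_mset (\<lambda>x. x \<in> V) (proots (p - [:w:]))) = {x. x \<in> V \<and> poly p x = w}"
    using nz by auto
  show ?thesis
    unfolding root_count_def size_multiset_overloaded_eq s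
    by (intro sum.cong refl) (use nz in auto)
qed

lemma root_count_mono: "V \<subseteq> V' \<Longrightarrow> root_count p V w \<le> root_count p V' w"
  unfolding root_count_def
  by (intro size_mset_mono filter_mset_mono_strong) auto

lemma root_count_UNIV: "root_count p UNIV w = degree p"
  by (simp add: root_count_def size_proots_complex)

lemma root_count_Un: "V \<inter> V' = {} \<Longrightarrow> root_count p (V \<union> V') w = root_count p V w + root_count p V' w"
proof -
  assume d: "V \<inter> V' = {}"
  have "filter_mset (\<lambda>x. x \<in> V \<union> V') M = filter_mset (\<lambda>x. x \<in> V) M + filter_mset (\<lambda>x. x \<in> V') M" for M :: "complex multiset"
    by (induction M) (use d in auto)
  then show ?thesis by (simp add: root_count_def)
qed

lemma root_count_superset:
  assumes "{x. poly p x = w} \<subseteq> V" "degree p \<ge> 1"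
  shows "root_count p V w = degree p"
proof -
  have "{x. x \<in> V \<and> poly p x = w} = {x. x \<in> UNIV \<and> poly p x = w}" using assms by auto
  then show ?thesis
    using root_count_UNIV[of p w] root_count_eq_sum[OF assms(2)] by metis
qed

lemma root_count_pos_iff:
  assumes "degree p \<ge> 1"
  shows "root_count p V w > 0 \<longleftrightarrow> (\<exists>x\<in>V. poly p x = w)"
proof -
  have "root_count p V w = 0 \<longleftrightarrow> (\<forall>x\<in>V. poly p x \<noteq> w)"
    unfolding root_count_def size_eq_0_iff_empty filter_mset_eq_mempty_iff
    using minus_const_nonzero[OF assms, of w] by auto
  then show ?thesis by auto
qed

section \<open>Continuity of roots and constancy of preimage counts\<close>

lemma convergent_subseq_finite_family:
  fixes f :: "nat \<Rightarrow> nat \<Rightarrow> 'a::heine_borel"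
  assumes "\<And>i. i < n \<Longrightarrow> bounded (range (\<lambda>k. f k i))"
  shows "\<exists>r l. strict_mono r \<and> (\<forall>i<n. (\<lambda>k. f (r k) i) \<longlonglongrightarrow> l i)"
  using assms
proof (induction n)
  case 0
  then show ?case by (intro exI[of _ id]) (auto simp: strict_mono_def)
next
  case (Suc n)
  then obtain r l where r: "strict_mono r" and l: "\<And>i. i < n \<Longrightarrow> (\<lambda>k. f (r k) i) \<longlonglongrightarrow> l i"
    by fastforce
  have "bounded (range (\<lambda>k. f (r k) n))"
    by (rule bounded_subset[OF Suc.prems[of n]]) auto
  then obtain a s where s: "strict_mono s" "((\<lambda>k. f (r k) n) \<circ> s) \<longlonglongrightarrow> a"
    using bounded_imp_convergent_subsequence by blast
  have "(\<lambda>k. f ((r \<circ> s) k) i) \<longlonglongrightarrow> (l(n := a)) i" if "i < Suc n" for i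
  proof (cases "i = n")
    case True
    then show ?thesis using s by (simp add: o_def)
  next
    case False
    then have "((\<lambda>k. f (r k) i) \<circ> s) \<longlonglongrightarrow> l i"
      using that s(1) l by (intro LIMSEQ_subseq_LIMSEQ) auto
    then show ?thesis using False by (simp add: o_def)
  qed
  then show ?case
    using strict_mono_o[OF r s(1)] by blast
qed

lemma cmod_poly_large:
  fixes p :: "complex poly"
  assumes "degree p \<ge> 1"
  shows "\<exists>R. \<forall>z. cmod z \<ge> R \<longrightarrow> cmod (poly p z) > B"
proof -
  have "filterlim (poly p) at_infinity at_infinity"
    using assms by (intro filterlim_poly_at_infinity) auto
  then have "filterlim (\<lambda>z. norm (poly p z)) at_top at_infinity"
    using filterlim_at_infinity_imp_norm_at_top by blast
  then have "eventually (\<lambda>z. norm (poly p z) > B) at_infinity"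
    unfolding filterlim_at_top_dense by blast
  then show ?thesis unfolding eventually_at_infinity by auto
qed

lemma bounded_poly_vimage:
  assumes "degree p \<ge> 1" "bounded (W :: complex set)"
  shows "bounded (poly p -` W)"
proof -
  obtain B where B: "\<And>w. w \<in> W \<Longrightarrow> cmod w \<le> B" using assms(2) by (auto simp: bounded_iff)
  obtain R where R: "\<And>z. cmod z \<ge> R \<Longrightarrow> cmod (poly p z) > B" using cmod_poly_large[OF assms(1)] by blast
  show ?thesis unfolding bounded_iff
    by (intro exI[of _ R]) (use B R in \<open>force simp: not_le[symmetric]\<close>)
qed

lemma proots_enum:
  fixes p :: "complex poly"
  obtains xs where "mset xs = proots (p - [:w:])" "length xs = degree p"
    "p - [:w:] = smult (lead_coeff (p - [:w:])) (\<Prod>x\<leftarrow>xs. [:- x, 1:])"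
proof -
  obtain xs where xs: "mset xs = proots (p - [:w:])" using ex_mset by blast
  have "p - [:w:] = smult (lead_coeff (p - [:w:])) (\<Prod>x\<in>#proots (p - [:w:]). [:-x, 1:])"
    by (rule complex_poly_decompose_multiset[symmetric])
  also have "(\<Prod>x\<in>#proots (p - [:w:]). [:-x, 1:]) = (\<Prod>x\<leftarrow>xs. [:- x, 1:])"
    unfolding xs[symmetric] by (metis mset_map prod_mset_prod_list)
  finally have 2: "p - [:w:] = smult (lead_coeff (p - [:w:])) (\<Prod>x\<leftarrow>xs. [:- x, 1:])" .
  have 1: "length xs = degree p"
    using size_proots_complex[of "p - [:w:]"] unfolding xs[symmetric] by simp
  show thesis using that[OF xs 1 2] .
qed

lemma proots_prod_linear: "proots (\<Prod>x\<leftarrow>xs. [:- x, 1:]) = mset xs" for xs :: "complex list"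
proof (induction xs)
  case (Cons a xs)
  have "(\<Prod>x\<leftarrow>xs. [:- x, 1:]) \<noteq> (0::complex poly)"
    by (auto simp: prod_list_zero_iff)
  then show ?case using Cons by (simp add: proots_mult del: mult_pCons_left)
qed simp

text \<open>Compares root counts of two polynomials through matched enumerations of their roots; it
  is here that counting by a filtered multiset pays.\<close>

lemma size_filter_mset_le_nth:
  assumes "length xs = length ys" "\<And>i. i < length xs \<Longrightarrow> P (xs ! i) \<Longrightarrow> P (ys ! i)"
  shows "size (filter_mset P (mset xs)) \<le> size (filter_mset P (mset ys))"
proof -
  have "card {i. i < length xs \<and> P (xs ! i)} \<le> card {i. i < length ys \<and> P (ys ! i)}"
    by (rule card_mono) (use assms in auto)
  then show ?thesis
    by (metis length_filter_conv_card mset_filter size_mset)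
qed

text \<open>Continuity of roots, by compactness. Along a violating sequence w k tending to w0 the
  enumerated roots stay bounded and converge simultaneously on a subsequence. Passing to the limit
  in the factorization identifies the limits as the roots of p - w0 with multiplicity, and a limit
  in the open set U is approached from within U.\<close>

lemma root_count_lower_semicontinuous:
  assumes p: "degree p \<ge> 1" and U: "open U"
  shows "\<exists>e>0. \<forall>w\<in>ball w0 e. root_count p U w0 \<le> root_count p U w"
proof (rule ccontr)
  assume "\<not> ?thesis"
  then have "\<forall>k. \<exists>w. w \<in> ball w0 (inverse (Suc k)) \<and> root_count p U w < root_count p U w0"
    by (metis inverse_positive_iff_positive not_le of_nat_0_less_iff zero_less_Suc)
  then obtain w where w: "\<And>k. w k \<in> ball w0 (inverse (Suc k))"
    and wc: "\<And>k. root_count p U (w k) < root_count p U w0" by metis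
  have wlim: "w \<longlonglongrightarrow> w0"
  proof (rule metric_LIMSEQ_I)
    fix r :: real assume "r > 0"
    then obtain n where n: "inverse (real (Suc n)) < r" using reals_Archimedean by auto
    show "\<exists>no. \<forall>k\<ge>no. dist (w k) w0 < r"
    proof (intro exI[of _ n] allI impI)
      fix k assume "n \<le> k"
      then have "inverse (real (Suc k)) \<le> inverse (real (Suc n))" by (simp add: field_simps)
      moreover have "dist w0 (w k) < inverse (real (Suc k))" using w[of k] by simp
      ultimately show "dist (w k) w0 < r" using n by (subst dist_commute) linarith
    qed
  qed
  define n where "n = degree p"
  define c where "c = lead_coeff p"
  \<comment> \<open>As the degree is positive, the subtracted constant does not reach the leading
    coefficient, so all the factorizations share the factor c.\<close>
  have lc: "lead_coeff (p - [:v:]) = c" for v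
    using p unfolding c_def degree_minus_const by (cases "degree p") auto
  have "\<forall>k. \<exists>xs. mset xs = proots (p - [:w k:]) \<and> length xs = n \<and>
     p - [:w k:] = smult c (\<Prod>x\<leftarrow>xs. [:- x, 1:])"
    using proots_enum n_def lc by metis
  then obtain xs where xs: "\<And>k. mset (xs k) = proots (p - [:w k:])" "\<And>k. length (xs k) = n"
     "\<And>k. p - [:w k:] = smult c (\<Prod>x\<leftarrow>xs k. [:- x, 1:])" by metis
  have bw: "bounded (ball w0 1)" by simp
  have "bounded (range (\<lambda>k. xs k ! i))" if "i < n" for i
  proof (rule bounded_subset[OF bounded_poly_vimage[OF p bw]], safe)
    fix k
    have "xs k ! i \<in># proots (p - [:w k:])" using that xs(1,2) by (metis nth_mem set_mset_mset)
    then have "poly p (xs k ! i) = w k" using minus_const_nonzero[OF p] by simp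
    moreover have "inverse (real (Suc k)) \<le> 1" by (simp add: field_simps)
    ultimately show "xs k ! i \<in> poly p -` ball w0 1" using w[of k] by auto
  qed
  then obtain r l where r: "strict_mono r" and l: "\<And>i. i < n \<Longrightarrow> (\<lambda>k. xs (r k) ! i) \<longlonglongrightarrow> l i"
    using convergent_subseq_finite_family[of n "\<lambda>k i. xs k ! i"] by blast
  define ls where "ls = map l [0..<n]"
  have prodeq: "poly (\<Prod>x\<leftarrow>ys. [:- x, 1:]) z = (\<Prod>i<length ys. z - ys ! i)" for ys :: "complex list" and z
    by (simp add: poly_prod_list prod.list_conv_set_nth o_def atLeast0LessThan poly_prod)
  have polyeq: "poly (p - [:w0:]) z = poly (smult c (\<Prod>x\<leftarrow>ls. [:- x, 1:])) z" for z
  proof (rule LIMSEQ_unique)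
    show "(\<lambda>k. poly (p - [:w (r k):]) z) \<longlonglongrightarrow> poly (p - [:w0:]) z"
      using LIMSEQ_subseq_LIMSEQ[OF wlim r] by (auto intro!: tendsto_intros simp: o_def)
    have "(\<lambda>k. c * (\<Prod>i<n. z - xs (r k) ! i)) \<longlonglongrightarrow> c * (\<Prod>i<n. z - l i)"
      by (intro tendsto_intros l) auto
    then show "(\<lambda>k. poly (p - [:w (r k):]) z) \<longlonglongrightarrow> poly (smult c (\<Prod>x\<leftarrow>ls. [:- x, 1:])) z"
      unfolding xs(3) poly_smult prodeq xs(2) by (simp add: ls_def)
  qed
  have "poly (p - [:w0:]) = poly (smult c (\<Prod>x\<leftarrow>ls. [:- x, 1:]))"
    using polyeq by (rule ext)
  then have peq: "p - [:w0:] = smult c (\<Prod>x\<leftarrow>ls. [:- x, 1:])"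
    by (simp only: poly_eq_poly_eq_iff)
  have "c \<noteq> 0" using p by (auto simp: c_def)
  then have ls: "proots (p - [:w0:]) = mset ls" unfolding peq by (simp add: proots_prod_linear)
  have "\<forall>\<^sub>F k in sequentially. l i \<in> U \<longrightarrow> xs (r k) ! i \<in> U" if "i < n" for i
  proof (cases "l i \<in> U")
    case True
    then show ?thesis using topological_tendstoD[OF l[OF that] U True] by (auto elim: eventually_mono)
  qed simp
  then have "\<forall>\<^sub>F k in sequentially. \<forall>i\<in>{..<n}. l i \<in> U \<longrightarrow> xs (r k) ! i \<in> U"
    by (intro eventually_ball_finite) auto
  then obtain k where k: "\<And>i. i < n \<Longrightarrow> l i \<in> U \<Longrightarrow> xs (r k) ! i \<in> U"
    unfolding eventually_sequentially by auto
  have "size (filter_mset (\<lambda>x. x \<in> U) (mset ls)) \<le> size (filter_mset (\<lambda>x. x \<in> U) (mset (xs (r k))))"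
    by (rule size_filter_mset_le_nth) (use k xs(2) in \<open>auto simp: ls_def\<close>)
  then have "root_count p U w0 \<le> root_count p U (w (r k))"
    by (simp add: root_count_def ls xs(1))
  then show False using wc[of "r k"] by simp
qed

lemma open_poly_vimage: "open W \<Longrightarrow> open (poly p -` W)" for W :: "complex set"
  by (intro open_vimage continuous_intros) auto

text \<open>The count in V and the count in the union V' of the other components are both lower
  semicontinuous, and over W their sum is the degree. Neither can therefore jump up, so both are
  locally constant on the connected set W.\<close>

lemma root_count_component_constant:
  assumes p: "degree p \<ge> 1" and W: "open W" "connected W"
    and V: "V \<in> components (poly p -` W)" and w: "w \<in> W" "w' \<in> W"
  shows "root_count p V w = root_count p V w'"
proof -
  define X where "X = poly p -` W"
  have oX: "open X" unfolding X_def by (rule open_poly_vimage[OF W(1)])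
  have oV: "open V" using open_components[OF oX] V X_def by blast
  define V' where "V' = \<Union>(components X - {V})"
  have oV': "open V'" using open_components[OF oX] by (auto simp: V'_def)
  have disj: "V \<inter> V' = {}"
    using V components_nonoverlap[of _ X] unfolding V'_def X_def by blast
  have cover: "V \<union> V' = X"
    using Union_components[of X] V unfolding V'_def X_def by blast
  have total: "root_count p V u + root_count p V' u = degree p" if "u \<in> W" for u
    using root_count_Un[OF disj, of p u] root_count_superset[of p u "V \<union> V'"] that p
    unfolding cover X_def by auto
  have "(\<lambda>u. root_count p V u) constant_on W"
  proof (rule locally_constant_imp_constant)
    show "connected W" by fact
    fix a assume a: "a \<in> W"
    obtain e where e: "e > 0" "\<And>u. u \<in> ball a e \<Longrightarrow> root_count p V a \<le> root_count p V u"
      using root_count_lower_semicontinuous[OF p oV] by blast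
    obtain e' where e': "e' > 0" "\<And>u. u \<in> ball a e' \<Longrightarrow> root_count p V' a \<le> root_count p V' u"
      using root_count_lower_semicontinuous[OF p oV'] by blast
    have eq: "root_count p V u = root_count p V a" if "u \<in> W \<inter> ball a (min e e')" for u
      using e(2)[of u] e'(2)[of u] total[of u] total[OF a] that by auto
    show "\<exists>T. openin (top_of_set W) T \<and> a \<in> T \<and> (\<forall>x\<in>T. root_count p V x = root_count p V a)"
    proof (intro exI conjI ballI)
      show "openin (top_of_set W) (W \<inter> ball a (min e e'))" by (rule openin_open_Int) simp
      show "a \<in> W \<inter> ball a (min e e')" using a e(1) e'(1) by simp
    qed (rule eq)
  qed
  then show ?thesis using w unfolding constant_on_def by metis
qed

section \<open>Components over a disc without critical values\<close>

lemma root_count_le_degree: "root_count p V w \<le> degree p"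
  using root_count_mono[of V UNIV p w] root_count_UNIV[of p w] by simp

lemma root_count_UN:
  assumes "finite I" "\<And>i j. i \<in> I \<Longrightarrow> j \<in> I \<Longrightarrow> i \<noteq> j \<Longrightarrow> A i \<inter> A j = {}"
  shows "root_count p (\<Union>i\<in>I. A i) w = (\<Sum>i\<in>I. root_count p (A i) w)"
  using assms
proof (induction I rule: finite_induct)
  case empty
  then show ?case by (simp add: root_count_def)
next
  case (insert i I)
  have "A i \<inter> (\<Union>j\<in>I. A j) = {}" using insert.prems insert.hyps by fastforce
  then show ?case using insert by (simp add: root_count_Un)
qed

lemma card_level_set_le_root_count:
  fixes p :: "complex poly"
  assumes "degree p \<ge> 1"
  shows "card {x \<in> V. poly p x = w} \<le> root_count p V w"
proof -
  have nz: "p - [:w:] \<noteq> 0" using minus_const_nonzero[OF assms] .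
  have "order x (p - [:w:]) \<ge> 1" if "poly p x = w" for x
  proof -
    have "poly (p - [:w:]) x = 0" using that by simp
    then have "order x (p - [:w:]) \<noteq> 0" using nz order_root by blast
    then show "1 \<le> order x (p - [:w:])" by linarith
  qed
  then have "(\<Sum>x | x \<in> V \<and> poly p x = w. 1) \<le> root_count p V w"
    unfolding root_count_eq_sum[OF assms] by (intro sum_mono) auto
  then show ?thesis by simp
qed

lemma order_minus_const_simple:
  fixes p :: "complex poly"
  assumes "degree p \<ge> 1" "poly p x = w" "poly (pderiv p) x \<noteq> 0"
  shows "order x (p - [:w:]) = 1"
proof -
  have d: "pderiv (p - [:w:]) = pderiv p" by (simp add: pderiv_diff pderiv_pCons)
  have "order x (p - [:w:]) \<noteq> 0" 
    using minus_const_nonzero[OF assms(1), of w] assms(2) order_root[of "p - [:w:]" x] by simp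
  then have "order x (p - [:w:]) = Suc (order x (pderiv p))"
    using order_pderiv[of "p - [:w:]" x] minus_const_nonzero[OF assms(1), of w] assms(2) unfolding d by simp
  then show ?thesis using assms(3) by (simp add: order_0I)
qed

lemma card_level_set_noncritical:
  fixes p :: "complex poly"
  assumes "degree p \<ge> 1" "\<And>x. poly p x = w \<Longrightarrow> poly (pderiv p) x \<noteq> 0"
  shows "card {x. poly p x = w} = degree p"
proof -
  have "degree p = (\<Sum>x | x \<in> UNIV \<and> poly p x = w. order x (p - [:w:]))"
    using root_count_UNIV[of p w] root_count_eq_sum[OF assms(1)] by metis
  also have "\<dots> = (\<Sum>x | x \<in> UNIV \<and> poly p x = w. 1)"
    by (intro sum.cong refl) (use assms order_minus_const_simple in auto)
  finally show ?thesis by simp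
qed

lemma finite_set_separation:
  fixes Z :: "'a::metric_space set"
  assumes "finite Z"
  obtains r where "r > 0" "\<And>x y. x \<in> Z \<Longrightarrow> y \<in> Z \<Longrightarrow> x \<noteq> y \<Longrightarrow> ball x r \<inter> ball y r = {}"
proof -
  define S where "S = insert 1 ((\<lambda>(x,y). dist x y) ` {(x,y). x \<in> Z \<and> y \<in> Z \<and> x \<noteq> y})"
  have "{(x,y). x \<in> Z \<and> y \<in> Z \<and> x \<noteq> y} \<subseteq> Z \<times> Z" by auto
  then have fS: "finite S" using assms unfolding S_def
    by (meson finite.insertI finite_SigmaI finite_imageI finite_subset)
  have pos: "\<And>s. s \<in> S \<Longrightarrow> s > 0" by (auto simp: S_def)
  have "Min S > 0" using fS pos by (subst Min_gr_iff) (auto simp: S_def)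
  moreover have "ball x (Min S / 2) \<inter> ball y (Min S / 2) = {}" if "x \<in> Z" "y \<in> Z" "x \<noteq> y" for x y
  proof (rule disjoint_ballI)
    have "dist x y \<in> S" using that by (auto simp: S_def)
    then show "Min S / 2 + Min S / 2 \<le> dist x y" using fS by simp
  qed
  ultimately show thesis using that[of "Min S / 2"] by auto
qed

text \<open>Over w there are exactly \<open>degree p\<close> simple preimages. For w' close to w
  each of the disjoint discs about them contains at least one preimage, and the total is the degree;
  hence each contains exactly one and there are no others. Invariance of domain then makes the
  sheets homeomorphic to T.\<close>

lemma poly_covering_space:
  assumes p: "degree p \<ge> 1" and W: "open W"
    and nc: "\<And>x. poly p x \<in> W \<Longrightarrow> poly (pderiv p) x \<noteq> (0::complex)"
  shows "covering_space (poly p -` W) (poly p) W"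
proof
  show "continuous_on (poly p -` W) (poly p)" by (intro continuous_intros)
  show "poly p ` (poly p -` W) = W"
  proof safe
    fix w assume "w \<in> W"
    have "\<exists>x\<in>UNIV. poly p x = w"
      using root_count_pos_iff[OF p, of UNIV w] root_count_UNIV[of p w] p by simp
    then show "w \<in> poly p ` (poly p -` W)" using \<open>w \<in> W\<close> by auto
  qed
  fix w assume w: "w \<in> W"
  define Z where "Z = {x. poly p x = w}"
  have fZ: "finite Z" unfolding Z_def by (rule finite_level_set[OF p])
  have cZ: "card Z = degree p" unfolding Z_def
    by (rule card_level_set_noncritical[OF p]) (use nc w in auto)
  obtain r where r: "r > 0" and disj: "\<And>x y. x \<in> Z \<Longrightarrow> y \<in> Z \<Longrightarrow> x \<noteq> y \<Longrightarrow> ball x r \<inter> ball y r = {}"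
    using finite_set_separation[OF fZ] by blast
  have "\<forall>x\<in>Z. \<exists>e>0. \<forall>w'\<in>ball w e. 1 \<le> root_count p (ball x r) w'"
  proof
    fix x assume "x \<in> Z"
    then have "root_count p (ball x r) w > 0"
      unfolding root_count_pos_iff[OF p] using r by (auto simp: Z_def)
    moreover obtain e where "e > 0" "\<forall>w'\<in>ball w e. root_count p (ball x r) w \<le> root_count p (ball x r) w'"
      using root_count_lower_semicontinuous[OF p, of "ball x r" w] by auto
    ultimately show "\<exists>e>0. \<forall>w'\<in>ball w e. 1 \<le> root_count p (ball x r) w'"
      by (intro exI[of _ e]) force
  qed
  then obtain e where e: "\<And>x. x \<in> Z \<Longrightarrow> e x > 0"
    "\<And>x w'. x \<in> Z \<Longrightarrow> w' \<in> ball w (e x) \<Longrightarrow> 1 \<le> root_count p (ball x r) w'" by metis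
  define T where "T = W \<inter> (\<Inter>x\<in>Z. ball w (e x))"
  have oT: "open T" unfolding T_def using fZ W by (intro open_Int open_INT) auto
  have wT: "w \<in> T" using w e(1) by (auto simp: T_def)
  have rc: "root_count p (ball x r) w' = 1" "{y. poly p y = w'} \<subseteq> (\<Union>x\<in>Z. ball x r)"
    if "w' \<in> T" "x \<in> Z" for x w'
  proof -
    have ge: "1 \<le> root_count p (ball x r) w'" if "x \<in> Z" for x
      using e(2)[OF that, of w'] \<open>w' \<in> T\<close> that by (auto simp: T_def)
    have UN: "root_count p (\<Union>x\<in>Z. ball x r) w' = (\<Sum>x\<in>Z. root_count p (ball x r) w')"
      by (rule root_count_UN[OF fZ disj])
    have le: "(\<Sum>x\<in>Z. root_count p (ball x r) w') \<le> (\<Sum>x\<in>Z. 1)"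
      using root_count_le_degree[of p "\<Union>x\<in>Z. ball x r" w'] cZ UN by simp
    show "root_count p (ball x r) w' = 1"
    proof (rule ccontr)
      assume "\<not> ?thesis"
      then have "1 < root_count p (ball x r) w'" using ge[OF that(2)] by simp
      then have "(\<Sum>x\<in>Z. 1) < (\<Sum>x\<in>Z. root_count p (ball x r) w')"
        by (intro sum_strict_mono_ex1[OF fZ]) (use ge that in auto)
      then show False using le by simp
    qed
    have "(\<Sum>x\<in>Z. 1) \<le> (\<Sum>x\<in>Z. root_count p (ball x r) w')"
      by (intro sum_mono) (use ge in auto)
    then have full: "root_count p (\<Union>x\<in>Z. ball x r) w' \<ge> degree p" using UN cZ by simp
    have "root_count p (\<Union>x\<in>Z. ball x r) w' + root_count p (- (\<Union>x\<in>Z. ball x r)) w' \<le> degree p"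
      by (subst root_count_Un[symmetric]) (use root_count_le_degree in auto)
    then have "\<not> root_count p (- (\<Union>x\<in>Z. ball x r)) w' > 0" using full by simp
    then show "{y. poly p y = w'} \<subseteq> (\<Union>x\<in>Z. ball x r)"
      unfolding root_count_pos_iff[OF p] by blast
  qed
  define u where "u x = ball x r \<inter> poly p -` T" for x
  have ou: "open (u x)" for x unfolding u_def by (intro open_Int open_poly_vimage oT) auto
  have img: "poly p ` u x = T" if "x \<in> Z" for x
  proof safe
    fix w' assume "w' \<in> T"
    then have "root_count p (ball x r) w' > 0" using rc(1)[of w' x] that by simp
    then show "w' \<in> poly p ` u x" unfolding root_count_pos_iff[OF p] u_def using \<open>w' \<in> T\<close> by auto
  qed (auto simp: u_def)
  have inj: "inj_on (poly p) (u x)" if "x \<in> Z" for x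
  proof (rule inj_onI, rule ccontr)
    fix y z assume yz: "y \<in> u x" "z \<in> u x" "poly p y = poly p z" "y \<noteq> z"
    have "card {y, z} \<le> card {y' \<in> ball x r. poly p y' = poly p z}"
    proof (rule card_mono)
      show "finite {y' \<in> ball x r. poly p y' = poly p z}"
        by (rule finite_subset[OF _ finite_level_set[OF p]]) auto
    qed (use yz in \<open>auto simp: u_def\<close>)
    also have "\<dots> \<le> 1"
      using card_level_set_le_root_count[OF p, of "ball x r" "poly p z"] rc(1)[of "poly p z" x] that yz
      by (auto simp: u_def)
    finally show False using yz(4) by simp
  qed
  show "\<exists>T. w \<in> T \<and> openin (top_of_set W) T \<and>
      (\<exists>v. \<Union>v = poly p -` W \<inter> poly p -` T \<and> (\<forall>u\<in>v. openin (top_of_set (poly p -` W)) u) \<and>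
        pairwise disjnt v \<and> (\<forall>u\<in>v. \<exists>q. homeomorphism u T (poly p) q))"
  proof (intro exI[of _ T] exI[of _ "u ` Z"] conjI ballI)
    show "openin (top_of_set W) T" unfolding T_def
      using fZ by (intro openin_open_Int open_INT) auto
    show "\<Union>(u ` Z) = poly p -` W \<inter> poly p -` T"
    proof safe
      fix y assume y: "poly p y \<in> T" "poly p y \<in> W"
      obtain x0 where "x0 \<in> Z" using cZ p by (metis card.empty ex_in_conv not_one_le_zero)
      then obtain x where "x \<in> Z" "y \<in> ball x r" using rc(2)[OF y(1)] by blast
      then show "y \<in> \<Union>(u ` Z)" using y by (auto simp: u_def)
    qed (auto simp: u_def T_def)
    fix v assume "v \<in> u ` Z"
    then obtain x where x: "x \<in> Z" "v = u x" by auto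
    show "openin (top_of_set (poly p -` W)) v"
      using ou[of x] x openin_open_eq[of "poly p -` W"] open_poly_vimage[OF W] by (auto simp: u_def T_def)
    show "\<exists>q. homeomorphism v T (poly p) q"
    proof -
      have "continuous_on (u x) (poly p)" by (intro continuous_intros)
      then obtain q where "homeomorphism (u x) (poly p ` u x) (poly p) q"
        using invariance_of_domain_homeomorphism[OF ou _ _ inj[OF x(1)]] by auto
      then show ?thesis unfolding img[OF x(1)] x(2) by blast
    qed
  next
    show "pairwise disjnt (u ` Z)"
    proof (rule pairwiseI)
      fix v v' assume v: "v \<in> u ` Z" "v' \<in> u ` Z" "v \<noteq> v'"
      obtain x where x: "x \<in> Z" "v = u x" using v(1) by (rule imageE)
      obtain x' where x': "x' \<in> Z" "v' = u x'" using v(2) by (rule imageE)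
      have "x \<noteq> x'" using v(3) x(2) x'(2) by metis
      from disj[OF x(1) x'(1) this] show "disjnt v v'" unfolding x(2) x'(2) disjnt_def u_def by blast
    qed
  qed (rule wT)
qed

text \<open>W is simply connected, so the identity lifts to a section s of p through a point of V.
  The image of s is open by invariance of domain, and it is relatively closed as the fixed point set
  of s after p. It therefore contains the connected set V, on which s is a left inverse of
  p.\<close>

lemma inj_on_component_noncritical:
  assumes p: "degree p \<ge> 1" and W: "open W" "convex W"
    and nc: "\<And>x. poly p x \<in> W \<Longrightarrow> poly (pderiv p) x \<noteq> (0::complex)"
    and V: "V \<in> components (poly p -` W)"
  shows "inj_on (poly p) V"
proof -
  define X where "X = poly p -` W"
  have cov: "covering_space X (poly p) W" unfolding X_def by (rule poly_covering_space[OF p W(1) nc])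
  obtain a where a: "a \<in> V" using in_components_nonempty[OF V] by blast
  have VX: "V \<subseteq> X" using in_components_subset[OF V] by (simp add: X_def)
  have aW: "poly p a \<in> W" using a VX by (auto simp: X_def)
  obtain s where s: "continuous_on W s" "s \<in> W \<rightarrow> X" "s (poly p a) = a" "\<And>y. y \<in> W \<Longrightarrow> poly p (s y) = y"
  proof (rule covering_space_lift_strong[OF cov, of a "poly p a" W id])
    show "a \<in> X" using a VX by blast
    show "simply_connected W" by (rule convex_imp_simply_connected[OF W(2)])
    show "locally path_connected W" by (rule convex_imp_locally_path_connected[OF W(2)])
  qed (use aW in auto)
  have eq: "s ` W = {x \<in> X. s (poly p x) = x}"
  proof safe
    fix x assume "x \<in> X" "s (poly p x) = x"
    then show "x \<in> s ` W" unfolding X_def by (metis imageI vimageE)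
  qed (use s(2,4) in auto)
  have "open (s ` W)"
  proof (rule invariance_of_domain[OF s(1) W(1)])
    show "inj_on s W" using s(4) by (metis inj_onI)
  qed
  then have o: "openin (top_of_set V) (V \<inter> s ` W)" by (rule openin_open_Int)
  have c: "closedin (top_of_set V) {x \<in> V. s (poly p x) = x}"
  proof -
    have "continuous_on V (\<lambda>x. s (poly p x))"
      by (rule continuous_on_compose2[OF s(1)]) (use VX in \<open>auto intro!: continuous_intros simp: X_def\<close>)
    then have "continuous_on V (\<lambda>x. s (poly p x) - x)" by (intro continuous_intros)
    from continuous_closedin_preimage_constant[OF this, of 0] show ?thesis by simp
  qed
  have "V \<inter> s ` W = {x \<in> V. s (poly p x) = x}" using VX unfolding eq by auto
  with o c have "V \<inter> s ` W = {} \<or> V \<inter> s ` W = V"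
    using in_components_connected[OF V] unfolding connected_clopen by metis
  moreover have "a \<in> V \<inter> s ` W" using a aW s(3) by (metis IntI imageI)
  ultimately have "V \<subseteq> {x \<in> X. s (poly p x) = x}" unfolding eq by blast
  then show ?thesis unfolding inj_on_def by (metis (mono_tags, lifting) mem_Collect_eq subset_iff)
qed

section \<open>Size of components of preimages\<close>

text \<open>A frontier point of W inside the open preimage would lie in an open component that meets
  W, hence in W itself; so p sends the frontier of W to the boundary circle. In particular the roots
  of p = y outside W keep away from the closure of W, which keeps the cofactor in the maximum
  principle free of zeros.\<close>

lemma component_vimage_ball_facts:
  fixes y :: complex
  assumes p: "degree p \<ge> 1" and W: "W \<in> components (poly p -` ball y \<delta>)"
  shows "open W" "bounded W" "\<And>z. z \<in> frontier W \<Longrightarrow> dist y (poly p z) = \<delta>"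
    "\<And>z. z \<in> closure W \<Longrightarrow> z \<notin> W \<Longrightarrow> poly p z \<noteq> y"
proof -
  define X where "X = poly p -` ball y \<delta>"
  have oX: "open X" unfolding X_def by (rule open_poly_vimage) simp
  have WX: "W \<subseteq> X" using in_components_subset[OF W] by (simp add: X_def)
  show oW: "open W" using open_components[OF oX] W by (simp add: X_def)
  show "bounded W" using bounded_subset[OF bounded_poly_vimage[OF p, of "ball y \<delta>"]] WX by (auto simp: X_def)
  show fr: "dist y (poly p z) = \<delta>" if z: "z \<in> frontier W" for z
  proof -
    have zcl: "z \<in> closure W" and zW: "z \<notin> W" using z oW by (auto simp: frontier_def interior_open)
    have "poly p ` closure W \<subseteq> closure (poly p ` W)"
      by (intro image_closure_subset) (auto intro!: continuous_intros closure_subset)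
    also have "\<dots> \<subseteq> cball y \<delta>"
      by (rule closure_minimal) (use WX in \<open>auto simp: X_def\<close>)
    finally have le: "dist y (poly p z) \<le> \<delta>" using zcl by auto
    have "z \<notin> X"
    proof
      assume "z \<in> X"
      define V where "V = connected_component_set X z"
      have V: "V \<in> components X" using \<open>z \<in> X\<close> unfolding V_def by (rule componentsI)
      have "open V" using open_components[OF oX V] .
      moreover have "z \<in> V" using \<open>z \<in> X\<close> by (simp add: V_def)
      ultimately have "V \<inter> W \<noteq> {}" using zcl open_Int_closure_eq_empty[of V W] by blast
      then have "V = W" using components_nonoverlap[OF V, of W] W by (simp add: X_def)
      then show False using \<open>z \<in> V\<close> zW by simp
    qed
    then show ?thesis using le by (simp add: X_def)
  qed
  show "poly p z \<noteq> y" if z: "z \<in> closure W" "z \<notin> W" for z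
  proof
    assume eq: "poly p z = y"
    have "z \<in> frontier W" using z oW by (auto simp: frontier_def interior_open)
    then have "\<delta> = 0" using fr[of z] eq by simp
    then have "W = {}" using WX by (auto simp: X_def)
    then show False using z by simp
  qed
qed

lemma prod_mset_norm_le:
  fixes M :: "complex multiset"
  assumes "\<And>u. u \<in># M \<Longrightarrow> cmod (z - u) \<le> c" 
  shows "cmod (\<Prod>u\<in>#M. z - u) \<le> c ^ size M"
  using assms
proof (induction M)
  case (add u M)
  have "0 \<le> c" using add.prems[of u] norm_ge_zero[of "z - u"] by (metis order_trans union_single_eq_member)
  then show ?case using add by (auto simp: norm_mult intro!: mult_mono)
qed simp

lemma prod_mset_norm_ge:
  fixes M :: "complex multiset"
  assumes "\<And>u. u \<in># M \<Longrightarrow> c \<le> cmod (z - u)" "0 \<le> c"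
  shows "c ^ size M \<le> cmod (\<Prod>u\<in>#M. z - u)"
  using assms(1)
proof (induction M)
  case (add u M)
  then show ?case using assms(2) by (auto simp: norm_mult intro!: mult_mono)
qed simp

text \<open>Maximum principle for the reciprocal of the cofactor of the linear factors belonging to
  the roots in \<open>W\<close>.\<close>

lemma component_root_product_le:
  fixes y :: complex
  assumes p: "degree p \<ge> 1" and W: "W \<in> components (poly p -` ball y \<delta>)" and \<delta>: "\<delta> > 0"
    and WR: "W \<subseteq> cball 0 R" and z: "z \<in> W"
  shows "cmod (\<Prod>u\<in>#filter_mset (\<lambda>x. x \<in> W) (proots (p - [:y:])). z - u)
     \<le> (2 * R) ^ root_count p W y / \<delta> * cmod (poly p z - y)"
proof -
  note facts = component_vimage_ball_facts[OF p W]
  define M where "M = filter_mset (\<lambda>x. x \<in> W) (proots (p - [:y:]))"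
  define M' where "M' = filter_mset (\<lambda>x. x \<notin> W) (proots (p - [:y:]))"
  define c where "c = lead_coeff (p - [:y:])"
  have nz: "p - [:y:] \<noteq> 0" using minus_const_nonzero[OF p] .
  have c0: "c \<noteq> 0" using nz unfolding c_def by (simp only: leading_coeff_0_iff not_False_eq_True)
  define P where "P x = (\<Prod>u\<in>#M. x - u)" for x
  define Q where "Q x = c * (\<Prod>u\<in>#M'. x - u)" for x
  have MM: "proots (p - [:y:]) = M + M'" unfolding M_def M'_def by (rule multiset_partition)
  have fac: "poly p x - y = P x * Q x" for x
  proof -
    have "poly p x - y = poly (p - [:y:]) x" by simp
    also have "p - [:y:] = smult c (\<Prod>u\<in>#M + M'. [:-u, 1:])"
      unfolding c_def MM[symmetric] by (rule complex_poly_decompose_multiset[symmetric])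
    also have "poly \<dots> x = P x * Q x" by (simp add: poly_prod_mset P_def Q_def)
    finally show ?thesis .
  qed
  have Q0: "Q x \<noteq> 0" if "x \<in> closure W" for x
  proof -
    have "x \<notin># M'"
    proof
      assume "x \<in># M'"
      then have "x \<notin> W" "poly p x = y" using nz by (auto simp: M'_def)
      then show False using facts(4)[OF that] by simp
    qed
    then show ?thesis using c0 by (auto simp: Q_def)
  qed
  have "poly (smult c (\<Prod>u\<in>#M'. [:-u, 1:])) x = Q x" for x by (simp add: Q_def poly_prod_mset)
  then have Qpoly: "Q = poly (smult c (\<Prod>u\<in>#M'. [:-u, 1:]))" by auto
  have Qhol: "Q holomorphic_on A" for A unfolding Qpoly by (intro holomorphic_intros)
  \<comment> \<open>On the frontier |P| |Q| = \<delta>, so 1/|Q| = |P|/\<delta>, and |P| is at most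
    2 R to the number of roots, since roots and frontier lie in the disc of radius R.\<close>
  have bnd: "cmod (1 / Q x) \<le> (2 * R) ^ size M / \<delta>" if x: "x \<in> frontier W" for x
  proof -
    have xc: "x \<in> closure W" using x by (simp add: frontier_def)
    have "closure W \<subseteq> cball 0 R" by (rule closure_minimal[OF WR]) simp
    then have xR: "cmod x \<le> R" using xc by auto
    have "cmod (P x) \<le> (2 * R) ^ size M" unfolding P_def
    proof (rule prod_mset_norm_le)
      fix u assume "u \<in># M"
      then have "u \<in> W" by (simp add: M_def)
      then have "cmod u \<le> R" using WR by auto
      then show "cmod (x - u) \<le> 2 * R" using xR norm_triangle_ineq4[of x u] by linarith
    qed
    moreover have "cmod (P x) * cmod (Q x) = \<delta>"
      using facts(3)[OF x] by (simp add: norm_mult[symmetric] fac[symmetric] dist_norm norm_minus_commute)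
    then have "cmod (P x) = \<delta> * cmod (1 / Q x)"
      using Q0[OF xc] by (simp add: norm_divide field_simps)
    ultimately show ?thesis using \<delta> by (simp add: field_simps)
  qed
  have "cmod (1 / Q z) \<le> (2 * R) ^ size M / \<delta>"
  proof (rule maximum_modulus_frontier[where f = "\<lambda>x. 1 / Q x", OF _ _ facts(2) bnd z])
    show "(\<lambda>x. 1 / Q x) holomorphic_on interior W"
      using Q0 interior_subset closure_subset by (intro holomorphic_intros Qhol) blast
    show "continuous_on (closure W) (\<lambda>x. 1 / Q x)"
      using Q0 by (intro continuous_intros holomorphic_on_imp_continuous_on[OF Qhol]) blast
  qed
  moreover have "Q z \<noteq> 0" using Q0 z closure_subset by blast
  then have "cmod (P z) = cmod (1 / Q z) * cmod (poly p z - y)" unfolding fac by (simp add: norm_mult norm_divide)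
  ultimately have "cmod (P z) \<le> (2 * R) ^ size M / \<delta> * cmod (poly p z - y)"
    by (metis mult_right_mono norm_ge_zero)
  then show ?thesis by (simp add: P_def M_def root_count_def)
qed

text \<open>The distance from x maps the connected set V onto a set containing the interval from 0
  to dist x y, and it maps each disc into an interval of length 2 r. Comparing Lebesgue measures
  gives the bound.\<close>

lemma connected_subset_balls_dist_le:
  fixes V :: "'a::metric_space set"
  assumes V: "connected V" "V \<subseteq> (\<Union>z\<in>Z. ball z r)" and Z: "finite Z" and r: "r > 0"
    and xy: "x \<in> V" "y \<in> V"
  shows "dist x y \<le> 2 * r * card Z"
proof -
  have "connected (dist x ` V)" by (intro connected_continuous_image continuous_intros V)
  moreover have "0 \<in> dist x ` V" "dist x y \<in> dist x ` V" using xy by (auto simp: image_iff intro: bexI[of _ x])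
  ultimately have sub: "{0..dist x y} \<subseteq> dist x ` V" by (rule connected_contains_Icc)
  have "{0..dist x y} \<subseteq> (\<Union>z\<in>Z. {dist x z - r..dist x z + r})"
  proof
    fix t assume "t \<in> {0..dist x y}"
    then obtain v where v: "v \<in> V" "t = dist x v" using sub by auto
    then obtain z where z: "z \<in> Z" "dist z v < r" using V(2) by auto
    have "dist x v \<le> dist x z + dist z v" "dist x z \<le> dist x v + dist v z" by (rule dist_triangle)+
    then have "t \<in> {dist x z - r..dist x z + r}" using z(2) v(2) by (auto simp: dist_commute[of v z])
    then show "t \<in> (\<Union>z\<in>Z. {dist x z - r..dist x z + r})" using z(1) by blast
  qed
  then have "measure lborel {0..dist x y} \<le> measure lborel (\<Union>z\<in>Z. {dist x z - r..dist x z + r})"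
  proof (rule measure_mono_fmeasurable)
    have "(\<Union>z\<in>Z. {dist x z - r..dist x z + r}) \<in> fmeasurable lborel"
      by (intro fmeasurable.finite_UN Z fmeasurable_compact compact_Icc)
    then show "(\<Union>z\<in>Z. {dist x z - r..dist x z + r}) \<in> fmeasurable lborel" .
  qed auto
  also have "\<dots> \<le> (\<Sum>z\<in>Z. measure lborel {dist x z - r..dist x z + r})"
    by (rule measure_UNION_le[OF Z]) auto
  also have "\<dots> = 2 * r * card Z" using r by simp
  finally show ?thesis by simp
qed

text \<open>A point of V at distance at least r from every root in W would have a root product of
  size at least r^n, contradicting \<open>component_root_product_le\<close> at the prescribed
  closeness to y. So V is covered by at most N discs of radius r. Only N and R enter, not the degree
  of p.\<close>

lemma small_component_diameter:
  fixes y :: complex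
  assumes p: "degree p \<ge> 1" and W: "W \<in> components (poly p -` ball y \<delta>)" and \<delta>: "\<delta> > 0"
    and WR: "W \<subseteq> cball 0 R" and N: "root_count p W y \<le> N"
    and r: "0 < r" "r \<le> 2 * R"
    and V: "connected V" "V \<subseteq> W" "\<And>z. z \<in> V \<Longrightarrow> dist y (poly p z) < \<delta> * (r / (2 * R)) ^ N"
    and xx: "x \<in> V" "x' \<in> V"
  shows "dist x x' \<le> 2 * r * N"
proof -
  define M where "M = filter_mset (\<lambda>x. x \<in> W) (proots (p - [:y:]))"
  define n where "n = root_count p W y"
  have nM: "size M = n" by (simp add: M_def n_def root_count_def)
  have R: "R > 0" using r by linarith
  have sub: "V \<subseteq> (\<Union>u\<in>set_mset M. ball u r)"
  proof (rule subsetI, rule ccontr)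
    fix z assume z: "z \<in> V" and nz: "z \<notin> (\<Union>u\<in>set_mset M. ball u r)"
    have "r ^ n \<le> cmod (\<Prod>u\<in>#M. z - u)" unfolding nM[symmetric]
      by (rule prod_mset_norm_ge) (use nz r in \<open>auto simp: dist_norm norm_minus_commute not_less\<close>)
    also have "\<dots> \<le> (2 * R) ^ n / \<delta> * cmod (poly p z - y)"
      unfolding M_def n_def by (rule component_root_product_le[OF p W \<delta> WR]) (use V(2) z in auto)
    also have "\<dots> < (2 * R) ^ n / \<delta> * (\<delta> * (r / (2 * R)) ^ N)"
      using V(3)[OF z] \<delta> R by (intro mult_strict_left_mono) (auto simp: dist_norm norm_minus_commute)
    also have "\<dots> = (2 * R) ^ n * (r / (2 * R)) ^ N" using \<delta> by simp
    \<comment> \<open>Since r is at most 2 R, lowering the exponent from the bound N to the actual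
      count n can only increase the power.\<close>
    also have "\<dots> \<le> (2 * R) ^ n * (r / (2 * R)) ^ n"
      using N r R unfolding n_def by (intro mult_left_mono power_decreasing) auto
    also have "\<dots> = (2 * R * (r / (2 * R))) ^ n" by (rule power_mult_distrib[symmetric])
    also have "\<dots> = r ^ n" using R by simp
    finally show False by simp
  qed
  have "dist x x' \<le> 2 * r * card (set_mset M)"
    by (rule connected_subset_balls_dist_le[OF V(1) sub _ r(1) xx]) simp
  also have "card (set_mset M) \<le> N"
  proof -
    have "size M = (\<Sum>u\<in>set_mset M. count M u)" by (rule size_multiset_overloaded_eq)
    moreover have "(\<Sum>u\<in>set_mset M. 1) \<le> (\<Sum>u\<in>set_mset M. count M u)"
      by (intro sum_mono) (auto simp: Suc_le_eq)
    ultimately show ?thesis using N nM by (simp add: n_def)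
  qed
  finally show ?thesis using r by (simp add: mult_left_mono)
qed

text \<open>Write p as a power of the linear factor at q(x) times a cofactor that does not vanish
  there. Composition with q turns the linear factor into q - q(x), which has a simple zero at
  x.\<close>

lemma order_pcompose_regular:
  fixes p q :: "complex poly"
  assumes p: "p \<noteq> 0" and q: "degree q \<ge> 1" and reg: "poly (pderiv q) x \<noteq> 0"
  shows "order x (p \<circ>\<^sub>p q) = order (poly q x) p"
proof -
  define a where "a = poly q x"
  obtain R where R: "p = [:-a,1:] ^ order a p * R" "\<not> [:-a,1:] dvd R"
    using order_decomp[OF p] by blast
  have Ra: "poly R a \<noteq> 0" using R(2) by (simp add: poly_eq_0_iff_dvd)
  have lin: "[:-a,1:] \<circ>\<^sub>p q = q - [:a:]" by (simp add: pcompose_pCons)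
  have pow: "([:-a,1:] ^ k) \<circ>\<^sub>p q = (q - [:a:]) ^ k" for k
    by (induction k) (simp_all add: pcompose_1 pcompose_mult lin del: mult_pCons_left)
  have qa: "q - [:a:] \<noteq> 0" using minus_const_nonzero[OF q] .
  have ordpow: "order x ((q - [:a:]) ^ k) = k" for k
  proof (induction k)
    case (Suc k)
    have "order x ((q - [:a:]) ^ Suc k) = order x (q - [:a:]) + order x ((q - [:a:]) ^ k)"
      unfolding power_Suc by (rule order_mult) (use qa in auto)
    then show ?case using Suc order_minus_const_simple[OF q _ reg, of a] by (simp add: a_def)
  qed simp
  have "p \<circ>\<^sub>p q = (q - [:a:]) ^ order a p * (R \<circ>\<^sub>p q)"
    using R(1) pow by (metis pcompose_mult)
  moreover have "poly (R \<circ>\<^sub>p q) x \<noteq> 0" using Ra by (simp add: poly_pcompose a_def)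
  ultimately have "order x (p \<circ>\<^sub>p q) = order x ((q - [:a:]) ^ order a p) + order x (R \<circ>\<^sub>p q)"
    using qa by (metis mult_eq_0_iff order_mult poly_0 power_not_zero)
  also have "order x (R \<circ>\<^sub>p q) = 0" using \<open>poly (R \<circ>\<^sub>p q) x \<noteq> 0\<close> by (rule order_0I)
  finally show ?thesis using ordpow by (simp add: a_def)
qed

text \<open>A right factor that is univalent on V preserves multiplicities and maps the solutions
  injectively. This is how a bound for an iterate of \<open>h\<close> passes to longer words ending
  in univalent factors.\<close>

lemma root_count_pcompose_le:
  fixes p q :: "complex poly"
  assumes p: "degree p \<ge> 1" and q: "degree q \<ge> 1" and inj: "inj_on (poly q) V"
    and reg: "\<And>x. x \<in> V \<Longrightarrow> poly (pderiv q) x \<noteq> 0" and V': "poly q ` V \<subseteq> V'"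
  shows "root_count (p \<circ>\<^sub>p q) V w \<le> root_count p V' w"
proof -
  have pq: "degree (p \<circ>\<^sub>p q) \<ge> 1" using p q by (simp add: degree_pcompose)
  have eq: "p \<circ>\<^sub>p q - [:w:] = (p - [:w:]) \<circ>\<^sub>p q" by (simp add: pcompose_diff)
  define A where "A = {x. x \<in> V \<and> poly (p \<circ>\<^sub>p q) x = w}"
  have "root_count (p \<circ>\<^sub>p q) V w = (\<Sum>x\<in>A. order (poly q x) (p - [:w:]))"
    unfolding root_count_eq_sum[OF pq] A_def eq
    by (intro sum.cong refl order_pcompose_regular minus_const_nonzero p q) (use reg in auto)
  also have "\<dots> = (\<Sum>u\<in>poly q ` A. order u (p - [:w:]))"
    by (rule sum.reindex_cong[symmetric, OF _ refl refl]) (rule inj_on_subset[OF inj], auto simp: A_def)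
  also have "\<dots> \<le> (\<Sum>u | u \<in> V' \<and> poly p u = w. order u (p - [:w:]))"
  proof (rule sum_mono2)
    show "finite {u. u \<in> V' \<and> poly p u = w}"
      by (rule finite_subset[OF _ finite_level_set[OF p, of w]]) auto
  qed (use V' in \<open>auto simp: A_def poly_pcompose\<close>)
  also have "\<dots> = root_count p V' w" by (rule root_count_eq_sum[OF p, symmetric])
  finally show ?thesis .
qed

text \<open>Finite critical values only: infinity is a critical value of every polynomial of degree
  at least 2 and is dealt with separately, by normality near infinity.\<close>

definition plane_critical_values :: "complex poly \<Rightarrow> complex set" where
  "plane_critical_values p = poly p ` {z. poly (pderiv p) z = 0}"

lemma plane_critical_values_pcompose:
  "plane_critical_values (p \<circ>\<^sub>p q) \<subseteq> plane_critical_values p \<union> poly p ` plane_critical_values q"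
proof
  fix v assume "v \<in> plane_critical_values (p \<circ>\<^sub>p q)"
  then obtain z where z: "v = poly p (poly q z)" "poly (pderiv p) (poly q z) = 0 \<or> poly (pderiv q) z = 0"
    by (auto simp: plane_critical_values_def pderiv_pcompose poly_pcompose)
  from z(2) show "v \<in> plane_critical_values p \<union> poly p ` plane_critical_values q"
    unfolding z(1) plane_critical_values_def by blast
qed

lemma root_count_inj_le_1:
  fixes p :: "complex poly"
  assumes p: "degree p \<ge> 1" and inj: "inj_on (poly p) V"
    and reg: "\<And>x. x \<in> V \<Longrightarrow> poly (pderiv p) x \<noteq> 0"
  shows "root_count p V w \<le> 1"
proof -
  have "root_count p V w = (\<Sum>x | x \<in> V \<and> poly p x = w. 1)"
    unfolding root_count_eq_sum[OF p]
    by (intro sum.cong refl order_minus_const_simple p) (use reg in auto)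
  also have "\<dots> = card {x \<in> V. poly p x = w}" by simp
  also have "\<dots> \<le> 1"
  proof -
    have "finite {x \<in> V. poly p x = w}"
      by (rule finite_subset[OF _ finite_level_set[OF p, of w]]) auto
    moreover have "\<forall>x\<in>{x \<in> V. poly p x = w}. \<forall>y\<in>{x \<in> V. poly p x = w}. x = y"
      using inj by (auto simp: inj_on_def)
    ultimately show ?thesis unfolding One_nat_def by (simp only: card_le_Suc0_iff_eq)
  qed
  finally show ?thesis .
qed

lemma connected_subset_component:
  assumes "connected T" "T \<subseteq> X" "x \<in> T"
  obtains C where "C \<in> components X" "T \<subseteq> C"
proof
  show "connected_component_set X x \<in> components X" using assms by (intro componentsI) auto
  show "T \<subseteq> connected_component_set X x" by (rule connected_component_maximal[OF assms(3,1,2)])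
qed

text \<open>V is only assumed connected, not a full component, because it will arise as a piece of
  the preimage under a longer word; it sits in a component to which
  \<open>inj_on_component_noncritical\<close> applies.\<close>

lemma noncritical_vimage_component:
  assumes p: "degree p \<ge> 1" and B: "plane_critical_values p \<inter> ball y r = {}"
    and V: "connected V" "poly p ` V \<subseteq> ball y r"
  shows "inj_on (poly p) V" "\<And>x. x \<in> V \<Longrightarrow> poly (pderiv p) x \<noteq> 0"
proof -
  have nc: "poly (pderiv p) x \<noteq> 0" if "poly p x \<in> ball y r" for x
    using that B by (auto simp: plane_critical_values_def)
  then show "\<And>x. x \<in> V \<Longrightarrow> poly (pderiv p) x \<noteq> 0" using V(2) by auto
  show "inj_on (poly p) V"
  proof (cases "V = {}")
    case False
    then obtain x where "x \<in> V" by auto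
    moreover have "V \<subseteq> poly p -` ball y r" using V(2) by (simp only: image_subset_iff_subset_vimage)
    ultimately obtain C where C: "C \<in> components (poly p -` ball y r)" "V \<subseteq> C"
      using connected_subset_component[OF V(1)] by metis
    have "inj_on (poly p) C"
      by (rule inj_on_component_noncritical[OF p open_ball convex_ball nc C(1)])
    then show ?thesis using C(2) by (rule inj_on_subset)
  qed simp
qed

section \<open>The sphere and its planar chart\<close>

text \<open>The subtracted term is half the squared chordal distance. With it the angle metric on
  finite points reduces to planar inequalities.\<close>

lemma inner_stereo_Fin:
  "stereo (Fin z) \<bullet> stereo (Fin w) = 1 - 2 * (cmod (z - w))\<^sup>2 / ((1 + (cmod z)\<^sup>2) * (1 + (cmod w)\<^sup>2))"
proof -
  define s t where "s = (cmod z)\<^sup>2" and "t = (cmod w)\<^sup>2"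
  have pos: "1 + s > 0" "1 + t > 0" by (auto simp: s_def t_def add_pos_nonneg)
  have nm: "(cmod (z - w))\<^sup>2 = s + t - 2 * (z \<bullet> w)"
    by (simp add: s_def t_def power2_norm_eq_inner inner_diff inner_commute)
  have 1: "(complex_of_real a * z) \<bullet> (complex_of_real b * w) = a * b * (z \<bullet> w)" for a b
    by (metis inner_scaleR_left inner_scaleR_right mult.assoc scaleR_conv_of_real)
  have "stereo (Fin z) \<bullet> stereo (Fin w)
      = 2 / (1 + s) * (2 / (1 + t)) * (z \<bullet> w) + (s - 1) / (s + 1) * ((t - 1) / (t + 1))"
    unfolding stereo.simps inner_Pair 1 s_def[symmetric] t_def[symmetric] by simp
  also have "\<dots> = (4 * (z \<bullet> w) + (s - 1) * (t - 1)) / ((1 + s) * (1 + t))"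
    by (simp add: add_divide_distrib add.commute[of s 1] add.commute[of t 1])
  also have "4 * (z \<bullet> w) + (s - 1) * (t - 1) = (1 + s) * (1 + t) - 2 * (s + t - 2 * (z \<bullet> w))"
    by (simp add: algebra_simps)
  also have "\<dots> / ((1 + s) * (1 + t)) = 1 - 2 * (s + t - 2 * (z \<bullet> w)) / ((1 + s) * (1 + t))"
    using pos by (simp add: diff_divide_distrib)
  finally show ?thesis unfolding nm s_def t_def .
qed

lemma inner_stereo_bounds: "-1 \<le> stereo x \<bullet> stereo y" "stereo x \<bullet> stereo y \<le> 1"
  using Cauchy_Schwarz_ineq2[of "stereo x" "stereo y"] by (auto simp: norm_stereo abs_le_iff)

lemma dist_rsphere_less_iff:
  assumes "0 \<le> \<delta>" "\<delta> \<le> pi"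
  shows "dist x y < \<delta> \<longleftrightarrow> stereo x \<bullet> stereo y > cos \<delta>"
proof -
  have "dist x y < \<delta> \<longleftrightarrow> arccos (stereo x \<bullet> stereo y) < arccos (cos \<delta>)"
    using assms by (simp add: dist_rsphere_def arccos_cos)
  also have "\<dots> \<longleftrightarrow> stereo x \<bullet> stereo y > cos \<delta>"
    by (rule arccos_less_mono) (use inner_stereo_bounds[of x y] in \<open>auto simp: abs_le_iff\<close>)
  finally show ?thesis .
qed

lemma dist_rsphere_less_cases:
  "dist x y < \<delta> \<longleftrightarrow> \<delta> > pi \<or> (0 \<le> \<delta> \<and> \<delta> \<le> pi \<and> stereo x \<bullet> stereo y > cos \<delta>)"
proof -
  have "dist x y \<le> pi" unfolding dist_rsphere_def
    by (intro arccos_ubound inner_stereo_bounds)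
  moreover consider "\<delta> > pi" | "\<delta> < 0" | "0 \<le> \<delta>" "\<delta> \<le> pi" by linarith
  ultimately show ?thesis using dist_rsphere_less_iff[of \<delta> x y] zero_le_dist[of x y] pi_gt_zero
    by (smt (verit))
qed

lemma ball_rsphere_subset_Fin_ball:
  assumes "e > 0" "R \<ge> 0"
  obtains \<delta> where "\<delta> > 0" "\<And>y. cmod y \<le> R \<Longrightarrow> ball (Fin y) \<delta> \<subseteq> Fin ` ball y e"
proof -
  \<comment> \<open>The bound 1/4 lets the term 2 k D be absorbed into D and keeps infinity out of
    the spherical disc; the second bound makes what remains at most the square of e.\<close>
  define k where "k = min (1/4) (e\<^sup>2 / (4 * (1 + 2 * R\<^sup>2)))"
  have R1: "1 + R\<^sup>2 > 0" "1 + 2 * R\<^sup>2 > 0" by (auto simp: add_pos_nonneg)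
  have "k \<le> e\<^sup>2 / (4 * (1 + 2 * R\<^sup>2))" by (simp add: k_def)
  then have "k * (4 * (1 + 2 * R\<^sup>2)) \<le> e\<^sup>2" using R1 by (subst (asm) pos_le_divide_eq) auto
  then have k3: "4 * k * (1 + 2 * R\<^sup>2) \<le> e\<^sup>2" by (simp only: mult_ac)
  have k: "0 < k" "k \<le> 1/4" using assms R1 unfolding k_def by (simp, intro min.cobounded1)
  define c where "c = 1 - 2 * k / (1 + R\<^sup>2)"
  have "2 * k \<le> 1 + R\<^sup>2" using k(2) zero_le_power2[of R] by linarith
  then have "2 * k / (1 + R\<^sup>2) \<le> 1" using R1 by simp
  then have c: "0 \<le> c" "c < 1" using k(1) R1 by (auto simp: c_def)
  define \<delta> where "\<delta> = arccos c"
  have \<delta>: "0 \<le> \<delta>" "\<delta> \<le> pi" "cos \<delta> = c" unfolding \<delta>_def using c by (auto intro: arccos_lbound arccos_ubound cos_arccos)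
  have "\<delta> \<noteq> 0" using \<delta>(3) c(2) by auto
  then have "\<delta> > 0" using \<delta>(1) by simp
  moreover have "ball (Fin y) \<delta> \<subseteq> Fin ` ball y e" if y: "cmod y \<le> R" for y
  proof
    fix x assume "x \<in> ball (Fin y) \<delta>"
    then have gt: "stereo (Fin y) \<bullet> stereo x > c"
      using dist_rsphere_less_iff[OF \<delta>(1,2)] \<delta>(3) by simp
    have yR: "(cmod y)\<^sup>2 \<le> R\<^sup>2" using y by (simp add: power_mono)
    have py: "1 + (cmod y)\<^sup>2 > 0" by (simp add: add_pos_nonneg)
    show "x \<in> Fin ` ball y e"
    proof (cases x)
      case (Fin z)
      have pz: "1 + (cmod z)\<^sup>2 > 0" by (simp add: add_pos_nonneg)
      define D where "D = (cmod (y - z))\<^sup>2"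
      have "2 * D / ((1 + (cmod y)\<^sup>2) * (1 + (cmod z)\<^sup>2)) < 2 * k / (1 + R\<^sup>2)"
        using gt unfolding Fin inner_stereo_Fin c_def D_def by simp
      also have "\<dots> \<le> 2 * k / (1 + (cmod y)\<^sup>2)"
        using yR py k by (intro divide_left_mono) auto
      finally have "2 * D / ((1 + (cmod y)\<^sup>2) * (1 + (cmod z)\<^sup>2)) * ((1 + (cmod y)\<^sup>2) * (1 + (cmod z)\<^sup>2))
          < 2 * k / (1 + (cmod y)\<^sup>2) * ((1 + (cmod y)\<^sup>2) * (1 + (cmod z)\<^sup>2))"
        using py pz by (intro mult_strict_right_mono) auto
      then have D1: "D < k * (1 + (cmod z)\<^sup>2)" using py pz by simp
      have "cmod z \<le> cmod y + cmod (y - z)" by (metis norm_minus_commute norm_triangle_sub)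
      then have "(cmod z)\<^sup>2 \<le> (cmod y + cmod (y - z))\<^sup>2" by (simp add: power_mono)
      also have "\<dots> \<le> 2 * (cmod y)\<^sup>2 + 2 * D"
        using zero_le_power2[of "cmod y - cmod (y - z)"] by (simp add: D_def power2_eq_square algebra_simps)
      finally have "k * (1 + (cmod z)\<^sup>2) \<le> k * (1 + 2 * R\<^sup>2 + 2 * D)"
        using k(1) yR by (intro mult_left_mono) auto
      with D1 have "D < k * (1 + 2 * R\<^sup>2) + 2 * k * D" by (simp add: algebra_simps)
      moreover have "2 * k * D \<le> (1/2) * D"
        using k by (intro mult_right_mono) (auto simp: D_def)
      ultimately have "D < 2 * k * (1 + 2 * R\<^sup>2)" by linarith
      also have "\<dots> \<le> 4 * k * (1 + 2 * R\<^sup>2)" using k R1 by (intro mult_right_mono) auto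
      finally have "D < e\<^sup>2" using k3 by linarith
      then have "cmod (y - z) < e" using assms(1) unfolding D_def by (simp add: power_less_imp_less_base)
      then show ?thesis using Fin by (auto simp: dist_norm)
    next
      case Infty
      have "stereo (Fin y) \<bullet> stereo x = ((cmod y)\<^sup>2 - 1) / ((cmod y)\<^sup>2 + 1)" by (simp add: Infty)
      also have "\<dots> = 1 - 2 / (1 + (cmod y)\<^sup>2)" using py by (simp add: field_simps)
      finally have "2 / (1 + (cmod y)\<^sup>2) < 2 * k / (1 + R\<^sup>2)" using gt by (simp add: c_def)
      also have "\<dots> \<le> 2 * k / (1 + (cmod y)\<^sup>2)"
        using yR py k by (intro divide_left_mono) auto
      finally have "2 < 2 * k" using py by (simp add: divide_less_cancel)
      then show ?thesis using k by simp
    qed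
  qed
  ultimately show thesis using that by blast
qed

lemma open_Fin_image:
  assumes "open U"
  shows "open (Fin ` U)"
proof (subst open_contains_ball, safe)
  fix y assume "y \<in> U"
  then obtain e where e: "e > 0" "ball y e \<subseteq> U" using assms open_contains_ball by blast
  obtain \<delta> where \<delta>: "\<delta> > 0" "\<And>v. cmod v \<le> cmod y \<Longrightarrow> ball (Fin v) \<delta> \<subseteq> Fin ` ball v e"
    using ball_rsphere_subset_Fin_ball[OF e(1) norm_ge_zero[of y]] by blast
  then show "\<exists>\<delta>>0. ball (Fin y) \<delta> \<subseteq> Fin ` U" using e(2) by blast
qed

lemma continuous_on_Fin [continuous_intros]: "continuous_on A Fin"
proof -
  have "isCont Fin z" for z
  proof -
    have cont: "continuous_on UNIV (\<lambda>w. arccos (stereo (Fin w) \<bullet> stereo (Fin z)))"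
    proof (rule continuous_on_arccos)
      show "\<forall>w\<in>UNIV. -1 \<le> stereo (Fin w) \<bullet> stereo (Fin z) \<and> stereo (Fin w) \<bullet> stereo (Fin z) \<le> 1"
        using inner_stereo_bounds by blast
      have nz: "1 + (cmod w)\<^sup>2 \<noteq> 0" for w using zero_le_power2[of "cmod w"] by linarith
      show "continuous_on UNIV (\<lambda>w. stereo (Fin w) \<bullet> stereo (Fin z))"
        unfolding inner_stereo_Fin by (intro continuous_intros) (use nz in auto)
    qed
    then have "((\<lambda>w. arccos (stereo (Fin w) \<bullet> stereo (Fin z))) \<longlongrightarrow> arccos (stereo (Fin z) \<bullet> stereo (Fin z))) (at z)"
      by (simp add: continuous_on_eq_continuous_at isCont_def)
    then have "((\<lambda>w. dist (Fin w) (Fin z)) \<longlongrightarrow> dist (Fin z) (Fin z)) (at z)"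
      unfolding dist_rsphere_def .
    then have "((\<lambda>w. dist (Fin w) (Fin z)) \<longlongrightarrow> 0) (at z)" by simp
    then show ?thesis unfolding isCont_def by (rule tendsto_dist_iff[THEN iffD2])
  qed
  then show ?thesis by (simp add: continuous_at_imp_continuous_on)
qed

lemma inj_Fin: "inj_on Fin A" by (auto simp: inj_on_def)

text \<open>Uniform continuity of \<open>Fin\<close>, taken on the closed neighbourhood S' of S of
  width 1 so that it covers the discs about points of S.\<close>

lemma ball_subset_Fin_vimage_ball:
  assumes "e > 0" "compact S"
  obtains \<delta> where "\<delta> > 0" "\<And>y. y \<in> S \<Longrightarrow> Fin ` ball y \<delta> \<subseteq> ball (Fin y) e"
proof -
  define S' where "S' = {x + y |x y. x \<in> S \<and> y \<in> cball 0 1}"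
  have "compact S'" unfolding S'_def by (rule compact_sums[OF assms(2)]) simp
  then have "uniformly_continuous_on S' Fin"
    by (intro compact_uniformly_continuous continuous_on_Fin)
  then obtain \<delta> where \<delta>: "\<delta> > 0" "\<And>x x'. x \<in> S' \<Longrightarrow> x' \<in> S' \<Longrightarrow> dist x' x < \<delta> \<Longrightarrow> dist (Fin x') (Fin x) < e"
    unfolding uniformly_continuous_on_def using assms(1) by metis
  show thesis
  proof (rule that[of "min \<delta> 1"])
    fix y assume y: "y \<in> S"
    show "Fin ` ball y (min \<delta> 1) \<subseteq> ball (Fin y) e"
    proof safe
      fix z assume z: "z \<in> ball y (min \<delta> 1)"
      have "y = y + 0" "z = y + (z - y)" by simp_all
      moreover have "z - y \<in> cball 0 1" using z by (auto simp: dist_norm norm_minus_commute)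
      moreover have "(0::complex) \<in> cball 0 1" by simp
      ultimately have "y \<in> S'" "z \<in> S'" using y unfolding S'_def by blast+
      then show "Fin z \<in> ball (Fin y) e" using \<delta>(2)[of z y] z by simp
    qed
  qed (use \<delta>(1) in auto)
qed

text \<open>Inverse of the planar chart. The value at infinity is a dummy; continuity is claimed
  only on \<open>range Fin\<close>.\<close>

fun the_Fin :: "rsphere \<Rightarrow> complex" where
  "the_Fin (Fin z) = z"
| "the_Fin Infty = 0"

lemma continuous_on_the_Fin: "continuous_on (range Fin) the_Fin"
proof (rule continuous_on_open_invariant[THEN iffD2], intro allI impI)
  fix B :: "complex set" assume "open B"
  then have "open (Fin ` B)" by (rule open_Fin_image)
  then show "\<exists>A. open A \<and> A \<inter> range Fin = the_Fin -` B \<inter> range Fin"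
    by (intro exI[of _ "Fin ` B"]) auto
qed

lemma compact_Fin_image_iff: "compact (Fin ` A) \<longleftrightarrow> compact A"
proof
  assume "compact (Fin ` A)"
  moreover have "continuous_on (Fin ` A) the_Fin"
    by (rule continuous_on_subset[OF continuous_on_the_Fin]) auto
  ultimately have "compact (the_Fin ` Fin ` A)" by (rule compact_continuous_image[rotated])
  then show "compact A" by (simp add: image_image)
qed (rule compact_continuous_image[OF continuous_on_Fin])

lemma connected_Fin_image_iff: "connected (Fin ` A) \<longleftrightarrow> connected A"
proof
  assume "connected (Fin ` A)"
  moreover have "continuous_on (Fin ` A) the_Fin"
    by (rule continuous_on_subset[OF continuous_on_the_Fin]) auto
  ultimately have "connected (the_Fin ` Fin ` A)" by (rule connected_continuous_image[rotated])
  then show "connected A" by (simp add: image_image)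
qed (rule connected_continuous_image[OF continuous_on_Fin])

lemma components_Fin_image:
  assumes "C \<in> components (Fin ` X)"
  obtains V where "V \<in> components X" "C = Fin ` V"
proof -
  have CX: "C \<subseteq> Fin ` X" using in_components_subset[OF assms] .
  then obtain V where V: "V \<subseteq> X" "C = Fin ` V" by (meson subset_imageE)
  have "V \<in> components X"
    unfolding in_components_maximal
  proof (intro conjI allI impI)
    show "V \<noteq> {}" using in_components_nonempty[OF assms] V(2) by auto
    show "V \<subseteq> X" by fact
    show "connected V" using in_components_connected[OF assms] V(2) connected_Fin_image_iff by simp
    fix D assume D: "D \<noteq> {} \<and> V \<subseteq> D \<and> D \<subseteq> X \<and> connected D"
    then have "Fin ` D = C"
      using assms V(2) connected_Fin_image_iff[of D] unfolding in_components_maximal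
      by (metis image_is_empty image_mono)
    then show "D = V" using V(2) inj_image_eq_iff[OF inj_Fin] by metis
  qed
  then show thesis using that V(2) by blast
qed

text \<open>A spherical disc that misses infinity is star-shaped about its centre in the plane.\<close>

lemma connected_Fin_vimage_ball:
  assumes "Infty \<notin> ball (Fin y) \<delta>" "\<delta> > 0"
  shows "connected (Fin -` ball (Fin y) \<delta>)"
proof -
  have d: "0 \<le> \<delta>" "\<delta> \<le> pi" using assms dist_rsphere_less_cases[of "Fin y" Infty \<delta>] by auto
  define c where "c = cos \<delta>"
  define k where "k = (1 - c) * (1 + (cmod y)\<^sup>2) / 2"
  have py: "1 + (cmod y)\<^sup>2 > 0" for y by (simp add: add_pos_nonneg)
  have "stereo (Fin y) \<bullet> stereo Infty \<le> c"
    using assms(1) dist_rsphere_less_iff[OF d, of "Fin y" Infty] by (auto simp: c_def)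
  moreover have "stereo (Fin y) \<bullet> stereo Infty = 1 - 2 / (1 + (cmod y)\<^sup>2)"
    using py[of y] by (simp add: field_simps)
  ultimately have "1 - c \<le> 2 / (1 + (cmod y)\<^sup>2)" by simp
  \<comment> \<open>The inequality \<open>k \<le> 1\<close> is how missing infinity enters; it
    provides the convexity used below.\<close>
  then have k1: "k \<le> 1" using py[of y] by (simp add: k_def field_simps)
  have "c \<le> 1" by (simp add: c_def)
  then have k0: "0 \<le> k" using py[of y] by (simp add: k_def)
  have mem: "z \<in> Fin -` ball (Fin y) \<delta> \<longleftrightarrow> (cmod (y - z))\<^sup>2 < k * (1 + (cmod z)\<^sup>2)" for z
  proof -
    have "z \<in> Fin -` ball (Fin y) \<delta> \<longleftrightarrow>
        2 * (cmod (y - z))\<^sup>2 / ((1 + (cmod y)\<^sup>2) * (1 + (cmod z)\<^sup>2)) < 1 - c"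
      using dist_rsphere_less_iff[OF d, of "Fin y" "Fin z"] by (auto simp: c_def inner_stereo_Fin simp del: stereo.simps)
    also have "\<dots> \<longleftrightarrow> 2 * (cmod (y - z))\<^sup>2 < (1 - c) * ((1 + (cmod y)\<^sup>2) * (1 + (cmod z)\<^sup>2))"
      using py[of y] py[of z] by (simp add: pos_divide_less_eq)
    also have "\<dots> \<longleftrightarrow> (cmod (y - z))\<^sup>2 < k * (1 + (cmod z)\<^sup>2)"
      unfolding k_def by (auto simp: mult_ac)
    finally show ?thesis .
  qed
  have "starlike (Fin -` ball (Fin y) \<delta>)"
    unfolding starlike_def
  proof (intro bexI[of _ y] ballI subsetI)
    show "y \<in> Fin -` ball (Fin y) \<delta>" using assms(2) by simp
    then have "0 < k * (1 + (cmod y)\<^sup>2)" unfolding mem by simp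
    then have f0: "k * (1 + y \<bullet> y) > 0" by (simp add: power2_norm_eq_inner)
    fix x z assume x: "x \<in> Fin -` ball (Fin y) \<delta>" and "z \<in> closed_segment y x"
    then obtain s where s: "0 \<le> s" "s \<le> 1" "z = (1 - s) *\<^sub>R y + s *\<^sub>R x"
      by (auto simp: in_segment)
    define u where "u = x - y"
    have z: "z = y + s *\<^sub>R u" using s(3) by (simp add: u_def algebra_simps)
    have x': "x = y + u" by (simp add: u_def)
    \<comment> \<open>Along the segment the defect is a quadratic polynomial in s with leading
      coefficient (1 - k) |u|^2, which is nonnegative. It is convex and negative at s = 0 and s = 1,
      hence negative in between.\<close>
    have 1: "(cmod (y - z))\<^sup>2 - k * (1 + (cmod z)\<^sup>2) = s\<^sup>2 * ((1 - k) * (u \<bullet> u)) - 2 * k * s * (y \<bullet> u) - k * (1 + y \<bullet> y)"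
      unfolding z power2_norm_eq_inner
      by (simp add: inner_add inner_commute power2_eq_square algebra_simps)
    have "(cmod (y - x))\<^sup>2 < k * (1 + (cmod x)\<^sup>2)" using x mem by blast
    then have 2: "(1 - k) * (u \<bullet> u) - 2 * k * (y \<bullet> u) - k * (1 + y \<bullet> y) < 0"
      unfolding x' power2_norm_eq_inner
      by (simp add: inner_add inner_commute power2_eq_square algebra_simps)
    have "s\<^sup>2 * ((1 - k) * (u \<bullet> u)) \<le> s * ((1 - k) * (u \<bullet> u))"
      using s k1 by (intro mult_right_mono) (auto simp: power2_eq_square mult_left_le)
    then have "(cmod (y - z))\<^sup>2 - k * (1 + (cmod z)\<^sup>2)
        \<le> s * ((1 - k) * (u \<bullet> u) - 2 * k * (y \<bullet> u) - k * (1 + y \<bullet> y)) + (1 - s) * (- (k * (1 + y \<bullet> y)))"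
      unfolding 1 by (simp add: algebra_simps)
    also have "\<dots> < 0"
    proof (cases "s = 0")
      case False
      then have "s * ((1 - k) * (u \<bullet> u) - 2 * k * (y \<bullet> u) - k * (1 + y \<bullet> y)) < 0"
        using s 2 by (simp add: mult_pos_neg)
      moreover have "(1 - s) * (- (k * (1 + y \<bullet> y))) \<le> 0"
        using s f0 by (simp add: mult_nonneg_nonneg)
      ultimately show ?thesis by linarith
    qed (use f0 in simp)
    finally show "z \<in> Fin -` ball (Fin y) \<delta>" unfolding mem by simp
  qed
  then show ?thesis by (rule starlike_imp_connected)
qed

lemma vimage_sphere_map:
  assumes "degree p \<ge> 1" "Infty \<notin> B"
  shows "sphere_map p -` B = Fin ` (poly p -` (Fin -` B))"
proof safe
  fix x assume "sphere_map p x \<in> B"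
  then show "x \<in> Fin ` (poly p -` (Fin -` B))" using assms by (cases x) auto
qed auto

lemma sum_local_degree_Fin_image:
  assumes "degree p \<ge> 1"
  shows "(\<Sum>x | x \<in> Fin ` V \<and> sphere_map p x = Fin w. local_degree p x) = root_count p V w"
proof -
  have "{x. x \<in> Fin ` V \<and> sphere_map p x = Fin w} = Fin ` {z. z \<in> V \<and> poly p z = w}" by auto
  then have "(\<Sum>x | x \<in> Fin ` V \<and> sphere_map p x = Fin w. local_degree p x)
     = (\<Sum>z | z \<in> V \<and> poly p z = w. local_degree p (Fin z))"
    by (simp add: sum.reindex[OF inj_Fin])
  then show ?thesis unfolding root_count_eq_sum[OF assms] by (auto intro: sum.cong)
qed

lemma has_covering_degree_component:
  assumes p: "degree p \<ge> 1" and W: "open W" "connected W" and V: "V \<in> components (poly p -` W)" and w: "w \<in> W"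
  shows "has_covering_degree p (Fin ` V) (Fin ` W) (root_count p V w)"
proof -
  have "V \<subseteq> poly p -` W" by (rule in_components_subset[OF V])
  moreover have "finite {x \<in> Fin ` V. sphere_map p x = Fin v}" for v
  proof -
    have "{x \<in> Fin ` V. sphere_map p x = Fin v} = Fin ` {z \<in> V. poly p z = v}" by auto
    moreover have "finite {z \<in> V. poly p z = v}"
      by (rule finite_subset[OF _ finite_level_set[OF p, of v]]) auto
    ultimately show ?thesis by simp
  qed
  ultimately show ?thesis
    unfolding has_covering_degree_def
    using root_count_component_constant[OF p W V _ w] sum_local_degree_Fin_image[OF p, of V] by auto
qed

section \<open>Polynomial semigroups and filled Julia sets\<close>

lemma semigroup_generated_mono:
  assumes "H \<subseteq> H'"
  shows "\<langle>H\<rangle> \<subseteq> \<langle>H'\<rangle>"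
proof
  fix g assume "g \<in> \<langle>H\<rangle>"
  then show "g \<in> \<langle>H'\<rangle>"
    by induction (use assms in \<open>auto intro: semigroup_generated.intros\<close>)
qed

lemma semigroup_generated_degree:
  assumes "g \<in> \<langle>H\<rangle>" "\<And>h. h \<in> H \<Longrightarrow> degree h \<ge> 2"
  shows "degree g \<ge> 2"
  using assms(1)
proof induction
  case (compose f g)
  then have "2 * 1 \<le> degree f * degree g" by (intro mult_mono) auto
  then show ?case by (simp add: degree_pcompose)
qed (rule assms(2))

lemma semigroup_generated_invariant:
  assumes "g \<in> \<langle>H\<rangle>" "\<And>h. h \<in> H \<Longrightarrow> poly h ` A \<subseteq> A"
  shows "poly g ` A \<subseteq> A"
  using assms(1)
proof induction
  case (compose f g)
  then show ?case by (fastforce simp: poly_pcompose image_subset_iff)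
qed (rule assms(2))

lemma semigroup_generated_critical_values:
  assumes "g \<in> \<langle>H\<rangle>" and inv: "\<And>h. h \<in> H \<Longrightarrow> poly h ` A \<subseteq> A"
    and cv: "\<And>h. h \<in> H \<Longrightarrow> plane_critical_values h \<subseteq> A"
  shows "plane_critical_values g \<subseteq> A"
  using assms(1)
proof induction
  case (compose f g)
  have "poly f ` A \<subseteq> A" by (rule semigroup_generated_invariant[OF compose(1) inv])
  then show ?case using plane_critical_values_pcompose[of f g] compose by blast
qed (rule cv)

text \<open>Splits off the generator that is applied first; composition trees are reassociated along
  the right branch.\<close>

lemma semigroup_generated_right_factor:
  assumes "g \<in> \<langle>H\<rangle>"
  shows "g \<in> H \<or> (\<exists>g'\<in>\<langle>H\<rangle>. \<exists>h\<in>H. g = g' \<circ>\<^sub>p h)"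
  using assms
proof induction
  case (compose f g)
  show ?case using compose.IH(2)
  proof (elim disjE bexE)
    assume "g \<in> H"
    then show ?thesis using compose.hyps(1) by blast
  next
    fix g' h assume "g' \<in> \<langle>H\<rangle>" "h \<in> H" "g = g' \<circ>\<^sub>p h"
    then have "f \<circ>\<^sub>p g = (f \<circ>\<^sub>p g') \<circ>\<^sub>p h" "f \<circ>\<^sub>p g' \<in> \<langle>H\<rangle>"
      using compose.hyps(1) by (auto simp: pcompose_assoc intro: semigroup_generated.compose)
    then show ?thesis using \<open>h \<in> H\<close> by blast
  qed
qed simp

text \<open>Removing the generator applied first at least halves the degree, so an element of degree
  at most D + 1 comes from one of degree at most D and one of finitely many generators. It supplies
  the constant subsequences in the normality proof near infinity.\<close>

lemma finite_semigroup_bounded_degree: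
  assumes H: "finite H" "\<And>h. h \<in> H \<Longrightarrow> degree h \<ge> 2"
  shows "finite {g \<in> \<langle>H\<rangle>. degree g \<le> D}"
proof (induction D)
  case 0
  have empty: "{g \<in> \<langle>H\<rangle>. degree g \<le> 0} = {}" using semigroup_generated_degree[OF _ H(2)] by force
  show ?case unfolding empty by (rule finite.emptyI)
next
  case (Suc D)
  have "{g \<in> \<langle>H\<rangle>. degree g \<le> Suc D} \<subseteq> H \<union> (\<lambda>(g, h). g \<circ>\<^sub>p h) ` ({g \<in> \<langle>H\<rangle>. degree g \<le> D} \<times> H)"
  proof
    fix g assume g: "g \<in> {g \<in> \<langle>H\<rangle>. degree g \<le> Suc D}"
    then consider "g \<in> H" | g' h where "g' \<in> \<langle>H\<rangle>" "h \<in> H" "g = g' \<circ>\<^sub>p h"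
      using semigroup_generated_right_factor[of g H] by blast
    then show "g \<in> H \<union> (\<lambda>(g, h). g \<circ>\<^sub>p h) ` ({g \<in> \<langle>H\<rangle>. degree g \<le> D} \<times> H)"
    proof cases
      case 2
      have "degree g' \<ge> 2" by (rule semigroup_generated_degree[OF 2(1) H(2)])
      moreover have "degree g' * 2 \<le> degree g' * degree h" using H(2)[OF 2(2)] by simp
      moreover have "degree g' * degree h \<le> Suc D" using g 2(3) by (simp add: degree_pcompose)
      ultimately have "degree g' \<le> D" by linarith
      then show ?thesis using 2 by force
    qed simp
  qed
  then show ?case by (rule finite_subset) (use H(1) Suc in auto)
qed

text \<open>The 0th iterate is the identity, which is not in the semigroup; it is included so that a
  word beginning with a letter other than \<open>h\<close> also has an iterate as its left factor.
  Semigroup elements are the iterates of index \<open>Suc n\<close>.\<close>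

definition poly_iterate :: "complex poly \<Rightarrow> nat \<Rightarrow> complex poly" where
  "poly_iterate h n = ((\<lambda>p. h \<circ>\<^sub>p p) ^^ n) [:0, 1:]"

lemma poly_iterate_0 [simp]: "poly_iterate h 0 = [:0, 1:]"
  and poly_iterate_Suc: "poly_iterate h (Suc n) = h \<circ>\<^sub>p poly_iterate h n"
  by (simp_all add: poly_iterate_def)

lemma poly_iterate_add: "poly_iterate h (m + n) = poly_iterate h m \<circ>\<^sub>p poly_iterate h n"
  by (induction m) (simp_all add: poly_iterate_Suc pcompose_assoc pcompose_pCons)

lemma degree_poly_iterate: "degree (poly_iterate h n) = degree h ^ n"
  by (induction n) (simp_all add: poly_iterate_Suc degree_pcompose)

lemma poly_iterate_Suc_mem: "poly_iterate h (Suc n) \<in> \<langle>{h}\<rangle>"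
proof (induction n)
  case 0
  then show ?case by (simp add: poly_iterate_Suc semigroup_generated.generator)
next
  case (Suc n)
  have "h \<circ>\<^sub>p poly_iterate h (Suc n) \<in> \<langle>{h}\<rangle>"
    by (rule semigroup_generated.compose[OF semigroup_generated.generator Suc]) simp
  then show ?case by (simp add: poly_iterate_Suc[of h "Suc n"])
qed

text \<open>Cuts a word at its leftmost letter q from Q: to the left stands an iterate of h,
  possibly the identity, and the rest f begins with q. That f lies in the semigroup is recorded as
  well, for its degree.\<close>

lemma semigroup_insert_cases:
  assumes "g \<in> \<langle>insert h Q\<rangle>"
  shows "(\<exists>k. g = poly_iterate h (Suc k)) \<or>
    (\<exists>k. \<exists>q\<in>Q. \<exists>f. g = poly_iterate h k \<circ>\<^sub>p f \<and> f \<in> \<langle>insert h Q\<rangle> \<and>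
       (f = q \<or> (\<exists>g'\<in>\<langle>insert h Q\<rangle>. f = q \<circ>\<^sub>p g')))"
  using assms
proof induction
  case (generator g)
  show ?case
  proof (cases "g = h")
    case True
    then have "g = poly_iterate h (Suc 0)" by (simp add: poly_iterate_Suc)
    then show ?thesis by blast
  next
    case False
    then have "g \<in> Q" "g = poly_iterate h 0 \<circ>\<^sub>p g" "g \<in> \<langle>insert h Q\<rangle>"
      using generator by (auto simp: pcompose_pCons intro: semigroup_generated.generator)
    then show ?thesis by blast
  qed
next
  case (compose f g)
  from compose.IH(1) show ?case
  proof (elim disjE exE bexE conjE)
    fix k assume k: "f = poly_iterate h (Suc k)"
    from compose.IH(2) show ?thesis
    proof (elim disjE exE bexE)
      fix l assume "g = poly_iterate h (Suc l)"
      then have "f \<circ>\<^sub>p g = poly_iterate h (Suc (Suc k + l))"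
        unfolding k by (simp only: poly_iterate_add[symmetric] add_Suc_right)
      then show ?thesis by blast
    next
      fix l q f'
      assume q: "q \<in> Q" and f': "g = poly_iterate h l \<circ>\<^sub>p f' \<and> f' \<in> \<langle>insert h Q\<rangle> \<and>
         (f' = q \<or> (\<exists>g'\<in>\<langle>insert h Q\<rangle>. f' = q \<circ>\<^sub>p g'))"
      then have "f \<circ>\<^sub>p g = poly_iterate h (Suc k + l) \<circ>\<^sub>p f'"
        unfolding k by (simp only: poly_iterate_add pcompose_assoc)
      then show ?thesis using q f' by blast
    qed
  next
    fix k q f' assume q: "q \<in> Q" and f: "f = poly_iterate h k \<circ>\<^sub>p f'" "f' \<in> \<langle>insert h Q\<rangle>" "f' = q"
    have "f \<circ>\<^sub>p g = poly_iterate h k \<circ>\<^sub>p (q \<circ>\<^sub>p g)" "q \<circ>\<^sub>p g \<in> \<langle>insert h Q\<rangle>"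
      unfolding f using f compose.hyps by (auto simp: pcompose_assoc intro: semigroup_generated.compose)
    then show ?thesis using q compose.hyps(2) by blast
  next
    fix k q f' g' assume q: "q \<in> Q" and f: "f = poly_iterate h k \<circ>\<^sub>p f'" "f' \<in> \<langle>insert h Q\<rangle>"
      and g': "g' \<in> \<langle>insert h Q\<rangle>" "f' = q \<circ>\<^sub>p g'"
    have "f \<circ>\<^sub>p g = poly_iterate h k \<circ>\<^sub>p (f' \<circ>\<^sub>p g)" "f' \<circ>\<^sub>p g = q \<circ>\<^sub>p (g' \<circ>\<^sub>p g)"
      unfolding f g' by (simp_all add: pcompose_assoc)
    moreover have "f' \<circ>\<^sub>p g \<in> \<langle>insert h Q\<rangle>" "g' \<circ>\<^sub>p g \<in> \<langle>insert h Q\<rangle>"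
      using f(2) g'(1) compose.hyps(2) by (auto intro: semigroup_generated.compose)
    ultimately show ?thesis using q by blast
  qed
qed

lemma semigroup_generated_singleton: "\<langle>{h}\<rangle> = range (\<lambda>n. poly_iterate h (Suc n))"
proof
  show "\<langle>{h}\<rangle> \<subseteq> range (\<lambda>n. poly_iterate h (Suc n))"
    using semigroup_insert_cases[of _ h "{}"] by blast
  show "range (\<lambda>n. poly_iterate h (Suc n)) \<subseteq> \<langle>{h}\<rangle>"
    using poly_iterate_Suc_mem by blast
qed

text \<open>The growth factor is the degree of the generator because degrees multiply under
  composition: every element g then expands by at least \<open>degree g\<close> outside the disc,
  and large degree forces uniform escape.\<close>

definition escape_radius :: "complex poly set \<Rightarrow> real \<Rightarrow> bool" where
  "escape_radius H S \<longleftrightarrow> S \<ge> 1 \<and> (\<forall>h\<in>H. \<forall>z. cmod z \<ge> S \<longrightarrow> cmod (poly h z) \<ge> degree h * cmod z)"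

lemma cmod_poly_superlinear:
  fixes p :: "complex poly"
  assumes "degree p \<ge> 2" "B \<ge> 0"
  shows "\<exists>S\<ge>1. \<forall>z. cmod z \<ge> S \<longrightarrow> cmod (poly p z) \<ge> B * cmod z"
proof -
  obtain a q where p: "p = pCons a q" by (rule pCons_cases)
  have "degree q \<ge> 1" using assms(1) unfolding p by (simp split: if_splits)
  then obtain R where R: "\<And>z. cmod z \<ge> R \<Longrightarrow> cmod (poly q z) > B + 1"
    using cmod_poly_large[of q "B + 1"] by blast
  have "cmod (poly p z) \<ge> B * cmod z" if z: "cmod z \<ge> max 1 (max R (cmod a))" for z
  proof -
    have "cmod z * (B + 1) \<le> cmod z * cmod (poly q z)"
      using R[of z] z by (intro mult_left_mono) auto
    moreover have "cmod (z * poly q z) - cmod a \<le> cmod (poly p z)"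
      using norm_triangle_ineq2[of "z * poly q z" "- a"] by (simp add: p add.commute)
    moreover have "cmod z \<ge> cmod a" using z by simp
    ultimately show ?thesis by (simp add: norm_mult algebra_simps)
  qed
  then show ?thesis by (intro exI[of _ "max 1 (max R (cmod a))"]) simp
qed

lemma escape_radius_exists:
  assumes "finite H" "\<And>h. h \<in> H \<Longrightarrow> degree h \<ge> 2"
  obtains S where "escape_radius H S"
proof -
  have "\<exists>S. escape_radius H S" using assms
  proof (induction H rule: finite_induct)
    case empty
    then show ?case by (auto simp: escape_radius_def)
  next
    case (insert h H)
    then obtain S where S: "escape_radius H S" by auto
    obtain S' where S': "S' \<ge> 1" "\<And>z. cmod z \<ge> S' \<Longrightarrow> cmod (poly h z) \<ge> real (degree h) * cmod z"
      using cmod_poly_superlinear[of h "real (degree h)"] insert.prems by auto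
    have "escape_radius (insert h H) (max S S')"
      using S S' by (auto simp: escape_radius_def)
    then show ?case by blast
  qed
  then show thesis using that by blast
qed

lemma escape_radius_semigroup:
  assumes S: "escape_radius H S" and H: "\<And>h. h \<in> H \<Longrightarrow> degree h \<ge> 2" and g: "g \<in> \<langle>H\<rangle>"
    and z: "cmod z \<ge> S"
  shows "cmod (poly g z) \<ge> degree g * cmod z"
  using g z
proof (induction arbitrary: z)
  case (generator h)
  then show ?case using S by (auto simp: escape_radius_def)
next
  case (compose f g)
  have "degree g \<ge> 2" by (rule semigroup_generated_degree[OF compose.hyps(2) H])
  then have "1 * cmod z \<le> degree g * cmod z" by (intro mult_right_mono) auto
  also have g: "\<dots> \<le> cmod (poly g z)" by (rule compose.IH(2)[OF compose.prems])
  finally have "S \<le> cmod (poly g z)" using compose.prems by simp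
  then have "degree f * cmod (poly g z) \<le> cmod (poly f (poly g z))" by (rule compose.IH(1))
  moreover have "degree f * (degree g * cmod z) \<le> degree f * cmod (poly g z)"
    using g by (intro mult_left_mono) auto
  ultimately show ?case by (simp add: poly_pcompose degree_pcompose mult.assoc)
qed

lemma poly_iterate_escapes:
  assumes h: "degree h \<ge> 2" and S: "escape_radius {h} S" and z: "cmod z \<ge> S"
  shows "cmod (poly (poly_iterate h n) z) \<ge> 2 ^ n * cmod z"
proof (cases n)
  case (Suc k)
  have "real (degree (poly_iterate h n)) * cmod z \<le> cmod (poly (poly_iterate h n) z)"
    unfolding Suc by (rule escape_radius_semigroup[OF S _ poly_iterate_Suc_mem z]) (use h in auto)
  moreover have "(2::real) ^ n \<le> real (degree (poly_iterate h n))"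
    unfolding degree_poly_iterate using h by (simp add: power_mono)
  then have "2 ^ n * cmod z \<le> real (degree (poly_iterate h n)) * cmod z" by (intro mult_right_mono) auto
  ultimately show ?thesis by linarith
qed simp

text \<open>Once an orbit leaves the disc of radius S its modulus grows at least like a power of 2,
  so a bounded orbit never leaves it. Index 0 is included, which places the filled Julia set itself
  inside the disc.\<close>

lemma filled_Julia_iff:
  assumes h: "degree h \<ge> 2" and S: "escape_radius {h} S"
  shows "z \<in> filled_Julia h \<longleftrightarrow> (\<forall>n. cmod (poly (poly_iterate h n) z) \<le> S)"
proof
  have S1: "S \<ge> 1" using S by (simp add: escape_radius_def)
  assume "z \<in> filled_Julia h"
  then obtain B where B: "\<And>n. cmod (poly (poly_iterate h (Suc n)) z) \<le> B"
    by (auto simp: filled_Julia_def K_hat_def semigroup_generated_singleton bounded_iff)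
  show "\<forall>n. cmod (poly (poly_iterate h n) z) \<le> S"
  proof (rule allI, rule ccontr)
    fix n assume "\<not> cmod (poly (poly_iterate h n) z) \<le> S"
    then have gt: "cmod (poly (poly_iterate h n) z) \<ge> S" by simp
    obtain k where k: "B < 2 ^ k" using real_arch_pow[of 2 B] by auto
    have "2 ^ Suc k * cmod (poly (poly_iterate h n) z) \<le> cmod (poly (poly_iterate h (Suc k)) (poly (poly_iterate h n) z))"
      by (rule poly_iterate_escapes[OF h S gt])
    also have "\<dots> = cmod (poly (poly_iterate h (Suc (k + n))) z)"
      using poly_iterate_add[of h "Suc k" n] by (simp add: poly_pcompose)
    also have "\<dots> \<le> B" by (rule B)
    finally have "2 ^ Suc k * cmod (poly (poly_iterate h n) z) \<le> B" .
    moreover have "(2::real) ^ Suc k * 1 \<le> 2 ^ Suc k * cmod (poly (poly_iterate h n) z)"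
      using gt S1 by (intro mult_left_mono) auto
    ultimately have "(2::real) ^ Suc k \<le> B" by linarith
    moreover have "(2::real) ^ k \<le> 2 ^ Suc k" by simp
    ultimately show False using k by linarith
  qed
next
  assume "\<forall>n. cmod (poly (poly_iterate h n) z) \<le> S"
  then show "z \<in> filled_Julia h"
    by (auto simp: filled_Julia_def K_hat_def semigroup_generated_singleton bounded_iff)
qed

lemma poly_open_map:
  fixes p :: "complex poly"
  assumes "degree p \<ge> 1" "open U"
  shows "open (poly p ` U)"
proof (rule open_mapping_thm[of "poly p" UNIV])
  show "\<not> poly p constant_on UNIV"
  proof
    assume "poly p constant_on UNIV"
    then obtain c where "\<And>z. poly p z = c" by (auto simp: constant_on_def)
    then have "{z. poly p z = c} = UNIV" by auto
    then show False using finite_level_set[OF assms(1), of c] infinite_UNIV_char_0 by metis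
  qed
qed (use assms in \<open>auto intro: holomorphic_intros\<close>)

section \<open>Dynamics of a single polynomial\<close>

locale poly_dynamics =
  fixes h :: "complex poly"
  assumes degree_h: "degree h \<ge> 2"
begin

abbreviation "K \<equiv> filled_Julia h"

definition "S = (SOME S. escape_radius {h} S)"

lemma S: "escape_radius {h} S"
proof -
  have "\<exists>S. escape_radius {h} S" using escape_radius_exists[of "{h}"] degree_h by auto
  then show ?thesis unfolding S_def by (rule someI_ex)
qed

lemma S_ge_1: "S \<ge> 1" using S by (simp add: escape_radius_def)

lemmas K_iff = filled_Julia_iff[OF degree_h S]

lemma degree_iterate_pos: "degree (poly_iterate h n) \<ge> 1"
  unfolding degree_poly_iterate using degree_h by (simp add: Suc_le_eq)

lemma K_subset: "K \<subseteq> cball 0 S"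
proof
  fix z assume "z \<in> K"
  then have "cmod (poly (poly_iterate h 0) z) \<le> S" unfolding K_iff by (rule spec)
  then show "z \<in> cball 0 S" by simp
qed

lemma closed_K: "closed K"
proof -
  have "K = (\<Inter>n. poly (poly_iterate h n) -` cball 0 S)" using K_iff by auto
  moreover have "closed (poly (poly_iterate h n) -` cball 0 S)" for n
    by (intro closed_vimage continuous_intros) auto
  ultimately show ?thesis by auto
qed

lemma compact_K: "compact K"
  unfolding compact_eq_bounded_closed
  using closed_K bounded_subset[OF bounded_cball K_subset] by blast

text \<open>The two orbits differ by a finite initial segment, which has no influence on
  boundedness.\<close>

lemma iterate_mem_K_iff: "poly (poly_iterate h n) z \<in> K \<longleftrightarrow> z \<in> K"
proof
  assume z: "z \<in> K"
  show "poly (poly_iterate h n) z \<in> K" unfolding K_iff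
  proof
    fix m
    have "cmod (poly (poly_iterate h (m + n)) z) \<le> S" using z unfolding K_iff by (rule spec)
    then show "cmod (poly (poly_iterate h m) (poly (poly_iterate h n) z)) \<le> S"
      unfolding poly_iterate_add by (simp only: poly_pcompose)
  qed
next
  assume *: "poly (poly_iterate h n) z \<in> K"
  show "z \<in> K"
  proof -
    have "bounded (\<Union>k. {poly (poly_iterate h (Suc k)) z})"
    proof (rule bounded_subset)
      show "bounded ((\<lambda>k. poly (poly_iterate h k) z) ` {..n} \<union> cball 0 S)"
        using finite_imp_bounded[of "(\<lambda>k. poly (poly_iterate h k) z) ` {..n}"] by simp
      show "(\<Union>k. {poly (poly_iterate h (Suc k)) z}) \<subseteq> (\<lambda>k. poly (poly_iterate h k) z) ` {..n} \<union> cball 0 S"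
      proof safe
        fix k assume nc: "poly (poly_iterate h (Suc k)) z \<notin> cball 0 S"
        have "Suc k \<le> n"
        proof (rule ccontr)
          assume "\<not> Suc k \<le> n"
          then obtain l where l: "Suc k = l + n" by (metis add.commute le_add_diff_inverse nat_le_linear)
          have "cmod (poly (poly_iterate h l) (poly (poly_iterate h n) z)) \<le> S"
            using * unfolding K_iff by blast
          then show False using nc unfolding l poly_iterate_add by (simp add: poly_pcompose)
        qed
        then show "poly (poly_iterate h (Suc k)) z \<in> (\<lambda>k. poly (poly_iterate h k) z) ` {..n}" by blast
      qed
    qed
    then show ?thesis unfolding filled_Julia_def K_hat_def semigroup_generated_singleton by simp
  qed
qed

lemma iterate_interior_K: "z \<in> interior K \<Longrightarrow> poly (poly_iterate h n) z \<in> interior K"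
proof -
  assume z: "z \<in> interior K"
  have "open (poly (poly_iterate h n) ` interior K)"
    by (rule poly_open_map[OF degree_iterate_pos]) simp
  moreover have "poly (poly_iterate h n) ` interior K \<subseteq> K"
    using iterate_mem_K_iff interior_subset by blast
  ultimately show ?thesis using z interior_maximal by blast
qed

lemma frontier_K_eq: "frontier K = K - interior K"
  using closed_K by (simp add: frontier_def)

text \<open>K is completely invariant and its interior is forward invariant by the open mapping
  theorem. Hence preimages of boundary points are boundary points, which anchors small preimage
  components at the boundary.\<close>

lemma iterate_frontier_KD: "poly (poly_iterate h n) z \<in> frontier K \<Longrightarrow> z \<in> frontier K"
  unfolding frontier_K_eq using iterate_mem_K_iff iterate_interior_K by blast

lemma frontier_K_nonempty: "K \<noteq> {} \<Longrightarrow> frontier K \<noteq> {}"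
proof -
  assume "K \<noteq> {}"
  moreover have "K \<noteq> UNIV" using compact_K not_compact_UNIV by metis
  ultimately show ?thesis using frontier_eq_empty by blast
qed

lemma iterate_mem_K: "z \<in> K \<Longrightarrow> poly h z \<in> K"
  using iterate_mem_K_iff[of 1 z] by (simp add: poly_iterate_Suc)

end

section \<open>Normality\<close>

lemma normal_family_on_subset: "normal_family_on U F \<Longrightarrow> F' \<subseteq> F \<Longrightarrow> normal_family_on U F'"
  unfolding normal_family_on_def by (meson order_trans)

lemma Fatou_antimono: "G \<subseteq> G' \<Longrightarrow> Fatou G' \<subseteq> Fatou G"
  unfolding Fatou_def using normal_family_on_subset[OF _ image_mono] by blast

lemma Julia_mono: "G \<subseteq> G' \<Longrightarrow> Julia G \<subseteq> Julia G'"
  unfolding Julia_def using Fatou_antimono by blast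

text \<open>Montel's theorem in the planar chart. Locally uniform convergence carries over to the
  spherical metric because the limit function has compact image on each compact set.\<close>

lemma Fatou_bounded_images:
  assumes U: "open U" and B: "\<And>g z. g \<in> G \<Longrightarrow> z \<in> U \<Longrightarrow> cmod (poly g z) \<le> B"
  shows "Fin ` U \<subseteq> Fatou G"
proof -
  have "normal_family_on (Fin ` U) (sphere_map ` G)"
    unfolding normal_family_on_def
  proof (intro allI impI)
    fix f :: "nat \<Rightarrow> rsphere \<Rightarrow> rsphere" assume "range f \<subseteq> sphere_map ` G"
    then have "\<forall>n. \<exists>p\<in>G. f n = sphere_map p" by blast
    then obtain p where p: "\<And>n. p n \<in> G" "\<And>n. f n = sphere_map (p n)" by metis
    obtain g r where gr: "g holomorphic_on U" "strict_mono (r :: nat \<Rightarrow> nat)"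
        "\<And>K. compact K \<Longrightarrow> K \<subseteq> U \<Longrightarrow> uniform_limit K ((\<lambda>n. poly (p n)) \<circ> r) g sequentially"
    proof (rule Montel[of U "poly ` G" "\<lambda>n. poly (p n)"])
      show "\<And>h. h \<in> poly ` G \<Longrightarrow> h holomorphic_on U" by (auto intro: holomorphic_intros)
      show "\<exists>B. \<forall>h\<in>poly ` G. \<forall>z\<in>K. norm (h z) \<le> B" if "K \<subseteq> U" for K
        using B that by blast
      show "range (\<lambda>n. poly (p n)) \<subseteq> poly ` G" using p(1) by blast
    qed (use U in auto)
    have "uniform_limit C (\<lambda>n. f (r n)) (\<lambda>x. Fin (g (the_Fin x))) sequentially"
      if C: "compact C" "C \<subseteq> Fin ` U" for C
    proof -
      obtain A where A: "A \<subseteq> U" "C = Fin ` A" using C(2) by (meson subset_imageE)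
      have cA: "compact A" using C(1) unfolding A(2) compact_Fin_image_iff .
      have "compact (g ` A)"
        by (intro compact_continuous_image holomorphic_on_imp_continuous_on cA
              holomorphic_on_subset[OF gr(1)] A(1))
      show ?thesis unfolding uniform_limit_iff
      proof (intro allI impI)
        fix e :: real assume "e > 0"
        obtain \<delta> where \<delta>: "\<delta> > 0" "\<And>y. y \<in> g ` A \<Longrightarrow> Fin ` ball y \<delta> \<subseteq> ball (Fin y) e"
          using ball_subset_Fin_vimage_ball[OF \<open>e > 0\<close> \<open>compact (g ` A)\<close>] by blast
        have "\<forall>\<^sub>F n in sequentially. \<forall>x\<in>A. dist (poly (p (r n)) x) (g x) < \<delta>"
          using uniform_limitD[OF gr(3)[OF cA A(1)] \<delta>(1)] by simp
        then show "\<forall>\<^sub>F n in sequentially. \<forall>x\<in>C. dist (f (r n) x) (Fin (g (the_Fin x))) < e"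
        proof eventually_elim
          case (elim n)
          show ?case
          proof
            fix x assume "x \<in> C"
            then obtain z where z: "z \<in> A" "x = Fin z" using A(2) by blast
            have "poly (p (r n)) z \<in> ball (g z) \<delta>" using elim z(1) by (simp add: dist_commute)
            moreover have "Fin ` ball (g z) \<delta> \<subseteq> ball (Fin (g z)) e" using \<delta>(2) z(1) by blast
            ultimately have "Fin (poly (p (r n)) z) \<in> ball (Fin (g z)) e" by blast
            then show "dist (f (r n) x) (Fin (g (the_Fin x))) < e"
              using z(2) p(2) by (simp add: dist_commute)
          qed
        qed
      qed
    qed
    then show "\<exists>r g. strict_mono r \<and> (\<forall>C. compact C \<and> C \<subseteq> Fin ` U \<longrightarrow> uniform_limit C (\<lambda>n. f (r n)) g sequentially)"
      using gr(2) by blast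
  qed
  then show ?thesis unfolding Fatou_def using open_Fin_image[OF U] by blast
qed

lemma dist_Fin_Infty_small:
  assumes "e > 0"
  obtains R where "\<And>w. cmod w > R \<Longrightarrow> dist (Fin w) Infty < e"
proof -
  define \<delta> where "\<delta> = min e pi"
  have \<delta>: "0 < \<delta>" "\<delta> \<le> pi" "\<delta> \<le> e" using assms by (auto simp: \<delta>_def)
  have c: "cos \<delta> < 1" using cos_monotone_0_pi[of 0 \<delta>] \<delta> by simp
  define R where "R = max 1 (2 / (1 - cos \<delta>))"
  have "dist (Fin w) Infty < e" if w: "cmod w > R" for w
  proof -
    have pos: "1 + (cmod w)\<^sup>2 > 0" by (simp add: add_pos_nonneg)
    have "cmod w > 1" using w by (simp add: R_def)
    then have "cmod w * 1 \<le> cmod w * cmod w" by (intro mult_left_mono) auto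
    then have "cmod w \<le> (cmod w)\<^sup>2" by (simp add: power2_eq_square)
    then have "2 / (1 - cos \<delta>) < 1 + (cmod w)\<^sup>2" using w by (simp add: R_def)
    then have "2 / (1 + (cmod w)\<^sup>2) < 1 - cos \<delta>"
      using c pos by (simp add: divide_less_eq mult.commute)
    moreover have "stereo (Fin w) \<bullet> stereo Infty = 1 - 2 / (1 + (cmod w)\<^sup>2)"
      using pos by (simp add: field_simps)
    ultimately have "dist (Fin w) Infty < \<delta>"
      using dist_rsphere_less_iff[of \<delta> "Fin w" Infty] \<delta> by simp
    then show ?thesis using \<delta>(3) by simp
  qed
  then show thesis using that by blast
qed

lemma constant_subsequence_limit:
  assumes "infinite {n::nat. f n = F}"
  shows "\<exists>r g. strict_mono r \<and> (\<forall>C. compact C \<and> C \<subseteq> U \<longrightarrow> uniform_limit C (\<lambda>n. f (r n)) g sequentially)"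
proof -
  obtain r :: "nat \<Rightarrow> nat" where r: "strict_mono r" "\<And>n. r n \<in> {n. f n = F}"
    using infinite_enumerate[OF assms] by blast
  then have "f (r n) = F" for n by blast
  then show ?thesis using r(1) by (intro exI[of _ r] exI[of _ F]) (simp add: uniform_limit_const)
qed

text \<open>Along a sequence of elements either infinitely many degrees stay below some bound, and
  then one of finitely many polynomials recurs, or the degrees tend to infinity, and then the
  expansion by the degree makes the whole sequence converge to infinity uniformly on U, which
  contains the point at infinity.\<close>

lemma Fatou_escaping:
  assumes H: "finite H" "\<And>h. h \<in> H \<Longrightarrow> degree h \<ge> 2" and S: "escape_radius H S"
  shows "- Fin ` cball 0 S \<subseteq> Fatou \<langle>H\<rangle>"
proof -
  define U where "U = - Fin ` cball 0 S"
  have "compact (Fin ` cball 0 S)" by (simp add: compact_Fin_image_iff)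
  then have oU: "open U" unfolding U_def by (intro open_Compl compact_imp_closed)
  have S1: "S \<ge> 1" using S by (simp add: escape_radius_def)
  have "normal_family_on U (sphere_map ` \<langle>H\<rangle>)"
    unfolding normal_family_on_def
  proof (intro allI impI)
    fix f :: "nat \<Rightarrow> rsphere \<Rightarrow> rsphere" assume "range f \<subseteq> sphere_map ` \<langle>H\<rangle>"
    then have "\<forall>n. \<exists>p\<in>\<langle>H\<rangle>. f n = sphere_map p" by blast
    then obtain p where p: "\<And>n. p n \<in> \<langle>H\<rangle>" "\<And>n. f n = sphere_map (p n)" by metis
    show "\<exists>r g. strict_mono r \<and> (\<forall>C. compact C \<and> C \<subseteq> U \<longrightarrow> uniform_limit C (\<lambda>n. f (r n)) g sequentially)"
    proof (cases "\<exists>D. infinite {n. degree (p n) \<le> D}")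
      case True
      then obtain D where D: "infinite {n. degree (p n) \<le> D}" by blast
      have "p ` {n. degree (p n) \<le> D} \<subseteq> {g \<in> \<langle>H\<rangle>. degree g \<le> D}" using p(1) by auto
      then have "finite (p ` {n. degree (p n) \<le> D})"
        using finite_semigroup_bounded_degree[OF H] finite_subset by blast
      then obtain n0 where "infinite {n \<in> {n. degree (p n) \<le> D}. p n = p n0}"
        using pigeonhole_infinite[OF D] by blast
      then have "infinite {n. f n = f n0}"
        by (rule infinite_super[rotated]) (use p(2) in auto)
      then show ?thesis by (rule constant_subsequence_limit)
    next
      case False
      then have fin: "finite {n. degree (p n) \<le> D}" for D by blast
      have "uniform_limit C (\<lambda>n. f (id n)) (\<lambda>x. Infty) sequentially" if C: "C \<subseteq> U" for C
        unfolding uniform_limit_iff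
      proof (intro allI impI)
        fix e :: real assume e: "e > 0"
        obtain R where R: "\<And>w. cmod w > R \<Longrightarrow> dist (Fin w) Infty < e" using dist_Fin_Infty_small[OF e] by blast
        obtain D where D: "R < real D" using reals_Archimedean2 by blast
        have "\<forall>\<^sub>F n in cofinite. degree (p n) > D"
          unfolding eventually_cofinite not_less by (rule fin)
        then have "\<forall>\<^sub>F n in sequentially. degree (p n) > D"
          unfolding cofinite_eq_sequentially .
        then show "\<forall>\<^sub>F n in sequentially. \<forall>x\<in>C. dist (f (id n) x) Infty < e"
        proof eventually_elim
          case (elim n)
          show ?case
          proof
            fix x assume x: "x \<in> C"
            show "dist (f (id n) x) Infty < e"
            proof (cases x)
              case (Fin z)
              then have "Fin z \<notin> Fin ` cball 0 S" using x C unfolding U_def by blast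
              then have "z \<notin> cball 0 S" by blast
              then have z: "cmod z > S" by simp
              have "real D * 1 \<le> real (degree (p n)) * cmod z"
                using elim z S1 by (intro mult_mono) auto
              also have "\<dots> \<le> cmod (poly (p n) z)"
                by (rule escape_radius_semigroup[OF S H(2) p(1)]) (use z in auto)
              finally show ?thesis using R[of "poly (p n) z"] D Fin p(2) by simp
            next
              case Infty
              then show ?thesis using elim e p(2) by simp
            qed
          qed
        qed
      qed
      moreover have "strict_mono (id :: nat \<Rightarrow> nat)" by (simp add: strict_mono_def)
      ultimately show ?thesis by blast
    qed
  qed
  then show ?thesis unfolding Fatou_def U_def[symmetric] using oU by blast
qed

text \<open>Points of the frontier are limits of points escaping to infinity, so a locally uniform limit
  of iterates would take the value infinity there.\<close>

lemma (in poly_dynamics) frontier_K_subset_Julia: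
  assumes "z0 \<in> frontier K"
  shows "Fin z0 \<in> Julia \<langle>{h}\<rangle>"
proof (rule ccontr)
  assume "Fin z0 \<notin> Julia \<langle>{h}\<rangle>"
  then obtain U where U: "open U" "Fin z0 \<in> U" "normal_family_on U (sphere_map ` \<langle>{h}\<rangle>)"
    by (auto simp: Julia_def Fatou_def)
  define f where "f n = sphere_map (poly_iterate h (Suc n))" for n
  have "range f \<subseteq> sphere_map ` \<langle>{h}\<rangle>" using poly_iterate_Suc_mem by (auto simp: f_def)
  then obtain r g where r: "strict_mono r"
    and g: "\<And>C. compact C \<Longrightarrow> C \<subseteq> U \<Longrightarrow> uniform_limit C (\<lambda>n. f (r n)) g sequentially"
    using U(3) unfolding normal_family_on_def by meson
  have "open (Fin -` U)" by (rule open_vimage[OF U(1) continuous_on_Fin])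
  then obtain e where e: "e > 0" "cball z0 e \<subseteq> Fin -` U" using U(2) open_contains_cball by blast
  define C where "C = Fin ` cball z0 e"
  have C: "compact C" "C \<subseteq> U" using e by (auto simp: C_def compact_Fin_image_iff)
  have lim: "(\<lambda>n. Fin (poly (poly_iterate h (Suc (r n))) z)) \<longlonglongrightarrow> g (Fin z)" if "z \<in> cball z0 e" for z
    using tendsto_uniform_limitI[OF g[OF C], of "Fin z"] that by (simp add: C_def f_def)
  have cont: "continuous_on (cball z0 e) (\<lambda>z. g (Fin z))"
  proof (rule continuous_on_compose2[of C g _ Fin])
    have "\<forall>\<^sub>F n in sequentially. continuous_on C (f (r n))"
    proof (intro always_eventually allI)
      fix n
      have "continuous_on C the_Fin"
        by (rule continuous_on_subset[OF continuous_on_the_Fin]) (auto simp: C_def)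
      then have "continuous_on C (\<lambda>x. poly (poly_iterate h (Suc (r n))) (the_Fin x))"
        by (rule continuous_on_poly)
      then have "continuous_on C (\<lambda>x. Fin (poly (poly_iterate h (Suc (r n))) (the_Fin x)))"
        by (rule continuous_on_compose2[OF continuous_on_Fin _ subset_UNIV])
      then show "continuous_on C (f (r n))"
        by (rule continuous_on_eq) (auto simp: C_def f_def)
    qed
    then show "continuous_on C g" by (rule uniform_limit_theorem[OF _ g[OF C]]) simp
  qed (auto simp: C_def intro: continuous_on_Fin)
  have esc: "g (Fin z) = Infty" if z: "z \<in> cball z0 e" "z \<notin> K" for z
  proof (rule LIMSEQ_unique[OF lim[OF z(1)]])
    obtain m where m: "cmod (poly (poly_iterate h m) z) > S" using z(2) unfolding K_iff by (auto simp: not_le)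
    show "(\<lambda>n. Fin (poly (poly_iterate h (Suc (r n))) z)) \<longlonglongrightarrow> Infty"
    proof (rule metric_LIMSEQ_I)
      fix e' :: real assume e': "e' > 0"
      obtain R where R: "\<And>w. cmod w > R \<Longrightarrow> dist (Fin w) Infty < e'" using dist_Fin_Infty_small[OF e'] by blast
      obtain k where k: "R < 2 ^ k" using real_arch_pow[of 2 R] by auto
      show "\<exists>no. \<forall>n\<ge>no. dist (Fin (poly (poly_iterate h (Suc (r n))) z)) Infty < e'"
      proof (intro exI[of _ "k + m"] allI impI)
        fix n assume "k + m \<le> n"
        then have "k + m \<le> Suc (r n)" using seq_suble[OF r, of n] by simp
        then obtain l where l: "Suc (r n) = l + m" "k \<le> l" by (metis add.assoc add.commute le_Suc_ex le_add1)
        have "(2::real) ^ k * 1 \<le> 2 ^ l * cmod (poly (poly_iterate h m) z)"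
          using m S_ge_1 l(2) by (intro mult_mono power_increasing) auto
        also have "\<dots> \<le> cmod (poly (poly_iterate h l) (poly (poly_iterate h m) z))"
          by (rule poly_iterate_escapes[OF degree_h S]) (use m in simp)
        also have "\<dots> = cmod (poly (poly_iterate h (Suc (r n))) z)"
          unfolding l(1) poly_iterate_add by (simp add: poly_pcompose)
        finally show "dist (Fin (poly (poly_iterate h (Suc (r n))) z)) Infty < e'" using R k by simp
      qed
    qed
  qed
  have "g (Fin z0) = Infty"
  proof -
    \<comment> \<open>The escaping points approaching z0 are taken inside the disc where the limit g
      is known to be continuous.\<close>
    have "z0 \<in> closure (- K)" using assms by (simp add: frontier_closures)
    then have "z0 \<in> closure (ball z0 e \<inter> - K)"
      using open_Int_closure_subset[of "ball z0 e" "- K"] e(1) by auto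
    moreover have "closure (ball z0 e \<inter> - K) \<subseteq> closure (- K \<inter> cball z0 e)"
      by (rule closure_mono) auto
    ultimately have "z0 \<in> closure (- K \<inter> cball z0 e)" by blast
    then obtain x where x: "\<And>n. x n \<in> - K \<inter> cball z0 e" "x \<longlonglongrightarrow> z0" unfolding closure_sequential by blast
    have "z0 \<in> cball z0 e" using e(1) by simp
    then have "(\<lambda>n. g (Fin (x n))) \<longlonglongrightarrow> g (Fin z0)"
      by (rule continuous_on_tendsto_compose[OF cont x(2)]) (use x(1) in auto)
    moreover have "g (Fin (x n)) = Infty" for n using esc x(1) by blast
    ultimately show ?thesis by (simp add: LIMSEQ_const_iff)
  qed
  \<comment> \<open>The orbit of z0 itself stays in a compact planar disc, so the same limit must be
    finite.\<close>
  moreover have "g (Fin z0) \<in> Fin ` cball 0 S"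
  proof (rule closed_sequentially)
    show "closed (Fin ` cball 0 S)" by (rule compact_imp_closed) (simp add: compact_Fin_image_iff)
    show "(\<lambda>n. Fin (poly (poly_iterate h (Suc (r n))) z0)) \<longlonglongrightarrow> g (Fin z0)"
      by (rule lim) (use e(1) in simp)
    have "z0 \<in> K" using assms by (simp add: frontier_K_eq)
    then show "Fin (poly (poly_iterate h (Suc (r n))) z0) \<in> Fin ` cball 0 S" for n
      unfolding K_iff by auto
  qed
  ultimately show False by auto
qed

text \<open>There are finitely many generators, so infinitely many terms of a sequence share the
  generator h0 applied first. Either h0 itself recurs, or the remaining left factors form a sequence
  in the semigroup that has a convergent subsequence near h0(z); precomposing with h0
  finishes.\<close>

lemma Fatou_backward:
  assumes H: "finite H" "\<And>h. h \<in> H \<Longrightarrow> degree h \<ge> 1"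
    and z: "\<And>h. h \<in> H \<Longrightarrow> Fin (poly h z) \<in> Fatou \<langle>H\<rangle>"
  shows "Fin z \<in> Fatou \<langle>H\<rangle>"
proof -
  have "\<forall>h\<in>H. \<exists>U. open U \<and> Fin (poly h z) \<in> U \<and> normal_family_on U (sphere_map ` \<langle>H\<rangle>)"
    using z by (auto simp: Fatou_def)
  then obtain U where U: "\<And>h. h \<in> H \<Longrightarrow> open (U h)" "\<And>h. h \<in> H \<Longrightarrow> Fin (poly h z) \<in> U h"
    "\<And>h. h \<in> H \<Longrightarrow> normal_family_on (U h) (sphere_map ` \<langle>H\<rangle>)" by metis
  define A where "A = (\<Inter>h\<in>H. poly h -` (Fin -` U h))"
  have "open (poly h -` (Fin -` U h))" if "h \<in> H" for h
    by (intro open_poly_vimage open_vimage U(1) that continuous_on_Fin)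
  then have oA: "open A" unfolding A_def using H(1) by (intro open_INT) auto
  have zA: "z \<in> A" using U(2) by (simp add: A_def)
  have "normal_family_on (Fin ` A) (sphere_map ` \<langle>H\<rangle>)"
    unfolding normal_family_on_def
  proof (intro allI impI)
    fix f :: "nat \<Rightarrow> rsphere \<Rightarrow> rsphere" assume "range f \<subseteq> sphere_map ` \<langle>H\<rangle>"
    then have "\<forall>n. \<exists>p\<in>\<langle>H\<rangle>. f n = sphere_map p" by blast
    then obtain p where p: "\<And>n. p n \<in> \<langle>H\<rangle>" "\<And>n. f n = sphere_map (p n)" by metis
    have "\<exists>h\<in>H. p n = h \<or> (\<exists>q\<in>\<langle>H\<rangle>. p n = q \<circ>\<^sub>p h)" for n
      using semigroup_generated_right_factor[OF p(1)] by blast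
    then obtain k where k: "\<And>n. k n \<in> H" "\<And>n. p n = k n \<or> (\<exists>q\<in>\<langle>H\<rangle>. p n = q \<circ>\<^sub>p k n)" by metis
    have "finite (range k)" by (rule finite_subset[OF _ H(1)]) (use k(1) in auto)
    then obtain n0 where n0: "infinite {n. k n = k n0}"
      using pigeonhole_infinite[of UNIV k] infinite_UNIV_nat by auto
    define h0 where "h0 = k n0"
    have h0: "h0 \<in> H" using k(1) by (simp add: h0_def)
    have split: "{n. k n = k n0} = {n. k n = h0 \<and> p n = h0} \<union> {n. k n = h0 \<and> p n \<noteq> h0}"
      by (auto simp: h0_def)
    show "\<exists>r g. strict_mono r \<and> (\<forall>C. compact C \<and> C \<subseteq> Fin ` A \<longrightarrow> uniform_limit C (\<lambda>n. f (r n)) g sequentially)"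
    proof (cases "infinite {n. k n = h0 \<and> p n = h0}")
      case True
      then have "infinite {n. f n = sphere_map h0}"
        by (rule infinite_super[rotated]) (use p(2) in auto)
      then show ?thesis by (rule constant_subsequence_limit)
    next
      case False
      then have "infinite {n. k n = h0 \<and> p n \<noteq> h0}" using n0 unfolding split by simp
      then obtain s :: "nat \<Rightarrow> nat" where s: "strict_mono s" "\<And>n. s n \<in> {n. k n = h0 \<and> p n \<noteq> h0}"
        using infinite_enumerate by blast
      have "\<forall>n. \<exists>q\<in>\<langle>H\<rangle>. p (s n) = q \<circ>\<^sub>p h0" using k(2) s(2) by fastforce
      then obtain q where q: "\<And>n. q n \<in> \<langle>H\<rangle>" "\<And>n. p (s n) = q n \<circ>\<^sub>p h0" by metis
      have "range (\<lambda>n. sphere_map (q n)) \<subseteq> sphere_map ` \<langle>H\<rangle>" using q(1) by blast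
      then obtain r g where r: "strict_mono r"
        and g: "\<And>C. compact C \<Longrightarrow> C \<subseteq> U h0 \<Longrightarrow> uniform_limit C (\<lambda>n. sphere_map (q (r n))) g sequentially"
        using U(3)[OF h0] unfolding normal_family_on_def by meson
      have "uniform_limit C (\<lambda>n. f ((s \<circ> r) n)) (\<lambda>x. g (sphere_map h0 x)) sequentially"
        if C: "compact C" "C \<subseteq> Fin ` A" for C
      proof -
        obtain D where D: "D \<subseteq> A" "C = Fin ` D" using C(2) by (meson subset_imageE)
        have "compact D" using C(1) unfolding D(2) compact_Fin_image_iff .
        then have "compact (Fin ` poly h0 ` D)"
          unfolding compact_Fin_image_iff by (intro compact_continuous_image continuous_intros)
        moreover have "Fin ` poly h0 ` D \<subseteq> U h0" using D(1) h0 by (auto simp: A_def)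
        ultimately have lim: "uniform_limit (Fin ` poly h0 ` D) (\<lambda>n. sphere_map (q (r n))) g sequentially" by (rule g)
        show ?thesis unfolding uniform_limit_iff
        proof (intro allI impI)
          fix e :: real assume "e > 0"
          from uniform_limitD[OF lim this]
          show "\<forall>\<^sub>F n in sequentially. \<forall>x\<in>C. dist (f ((s \<circ> r) n) x) (g (sphere_map h0 x)) < e"
            by eventually_elim (auto simp: D(2) p(2) q(2) poly_pcompose)
        qed
      qed
      then show ?thesis using strict_mono_o[OF s(1) r] by blast
    qed
  qed
  then show ?thesis unfolding Fatou_def using open_Fin_image[OF oA] zA by blast
qed

section \<open>Adjoining generators that contract the filled Julia set\<close>

lemma plane_critical_values_pcompose_superset:
  "poly p ` plane_critical_values q \<subseteq> plane_critical_values (p \<circ>\<^sub>p q)"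
proof
  fix v assume "v \<in> poly p ` plane_critical_values q"
  then obtain z where "v = poly (p \<circ>\<^sub>p q) z" "poly (pderiv (p \<circ>\<^sub>p q)) z = 0"
    by (auto simp: plane_critical_values_def pderiv_pcompose poly_pcompose)
  then show "v \<in> plane_critical_values (p \<circ>\<^sub>p q)" by (auto simp: plane_critical_values_def)
qed

lemma critical_values_subset: "critical_values p \<subseteq> insert Infty (Fin ` plane_critical_values p)"
  by (auto simp: critical_values_def critical_points_def plane_critical_values_def)

lemma Fin_plane_critical_values_subset: "Fin ` plane_critical_values p \<subseteq> critical_values p"
  by (force simp: critical_values_def critical_points_def plane_critical_values_def image_image)

lemma plane_critical_values_subset_postcritical:
  assumes "g \<in> G"
  shows "plane_critical_values g \<subseteq> planar_postcritical G"
proof -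
  have "Fin ` plane_critical_values g \<subseteq> (\<Union>g\<in>G. critical_values g)"
    using assms Fin_plane_critical_values_subset by blast
  then show ?thesis unfolding planar_postcritical_def postcritical_def
    using closure_subset by fastforce
qed

lemma closed_planar_postcritical: "closed (planar_postcritical G)"
  unfolding planar_postcritical_def postcritical_def vimage_def[symmetric, of Fin]
  by (intro closed_vimage continuous_on_Fin closed_closure)

lemma postcritical_subset:
  assumes A: "compact A" and cv: "\<And>g. g \<in> G \<Longrightarrow> plane_critical_values g \<subseteq> A"
  shows "postcritical G \<subseteq> insert Infty (Fin ` A)"
  unfolding postcritical_def
proof (rule closure_minimal)
  show "(\<Union>g\<in>G. critical_values g) \<subseteq> insert Infty (Fin ` A)"
    using cv critical_values_subset by blast
  show "closed (insert Infty (Fin ` A))"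
    using A by (intro closed_insert compact_imp_closed) (simp add: compact_Fin_image_iff)
qed

lemma connected_image_component:
  fixes p f :: "complex poly"
  assumes V: "connected V" "V \<noteq> {}" "poly f ` V \<subseteq> poly p -` W"
  obtains C where "C \<in> components (poly p -` W)" "poly f ` V \<subseteq> C"
proof -
  have "connected (poly f ` V)" by (intro connected_continuous_image continuous_intros V(1))
  then show thesis
    using that V connected_subset_component[of "poly f ` V" "poly p -` W"] by blast
qed

section \<open>Bounded branching over the boundary of the filled Julia set\<close>

context poly_dynamics
begin

text \<open>The common planar consequence of hyperbolicity and semi-hyperbolicity; in the hyperbolic
  case N = 1 works. Counting over the centre y alone is enough, as the count is constant over the
  disc.\<close>

definition bounded_branching :: "real \<Rightarrow> nat \<Rightarrow> bool" where
  "bounded_branching \<delta> N \<longleftrightarrow> \<delta> > 0 \<and>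
     (\<forall>y\<in>frontier K. \<forall>n. \<forall>W\<in>components (poly (poly_iterate h n) -` ball y \<delta>).
        root_count (poly_iterate h n) W y \<le> N)"

lemma compact_frontier_K: "compact (frontier K)"
  using compact_K by (rule compact_frontier)

text \<open>Boundary points of K lie in the Julia set, and a Euclidean disc of uniform radius fits
  into each spherical one. A component over the smaller disc lies in one over the larger disc, whose
  covering degree bounds the count. The maximum with 1 accounts for the 0th iterate.\<close>

lemma semi_hyperbolic_imp_bounded_branching:
  assumes "semi_hyperbolic \<langle>{h}\<rangle>"
  obtains \<delta> N where "bounded_branching \<delta> N"
proof -
  obtain \<delta> N where \<delta>: "\<delta> > 0" and N: "\<And>y g V. y \<in> Julia \<langle>{h}\<rangle> \<Longrightarrow> g \<in> \<langle>{h}\<rangle> \<Longrightarrow>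
      V \<in> components (sphere_map g -` ball y \<delta>) \<Longrightarrow> \<exists>n\<le>N. has_covering_degree g V (ball y \<delta>) n"
    using assms unfolding semi_hyperbolic_def by blast
  obtain \<delta>' where \<delta>': "\<delta>' > 0" "\<And>y. y \<in> frontier K \<Longrightarrow> Fin ` ball y \<delta>' \<subseteq> ball (Fin y) \<delta>"
    using ball_subset_Fin_vimage_ball[OF \<delta> compact_frontier_K] by blast
  have "root_count (poly_iterate h n) W y \<le> max N 1"
    if y: "y \<in> frontier K" and W: "W \<in> components (poly (poly_iterate h n) -` ball y \<delta>')" for y n W
  proof (cases n)
    case 0
    then have "degree (poly_iterate h n) = 1" by simp
    then show ?thesis using root_count_le_degree[of "poly_iterate h n" W y] by simp
  next
    case (Suc k)
    define g where "g = poly_iterate h n"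
    have g: "g \<in> \<langle>{h}\<rangle>" unfolding g_def Suc by (rule poly_iterate_Suc_mem)
    have dg: "degree g \<ge> 1" unfolding g_def by (rule degree_iterate_pos)
    have yJ: "Fin y \<in> Julia \<langle>{h}\<rangle>" by (rule frontier_K_subset_Julia[OF y])
    have Wsub: "W \<subseteq> poly g -` ball y \<delta>'" using in_components_subset[OF W] by (simp add: g_def)
    obtain x where x: "x \<in> W" using in_components_nonempty[OF W] by blast
    have "connected (Fin ` W)" using in_components_connected[OF W] by (simp add: connected_Fin_image_iff)
    moreover have "Fin ` W \<subseteq> sphere_map g -` ball (Fin y) \<delta>" using Wsub \<delta>'(2)[OF y] by fastforce
    ultimately obtain V where V: "V \<in> components (sphere_map g -` ball (Fin y) \<delta>)" "Fin ` W \<subseteq> V"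
      using connected_subset_component x by blast
    obtain l where l: "l \<le> N" "has_covering_degree g V (ball (Fin y) \<delta>) l" using N[OF yJ g V(1)] by blast
    have "Fin y \<in> ball (Fin y) \<delta>" using \<delta> by simp
    then have fin: "finite {x\<in>V. sphere_map g x = Fin y}"
      and sum: "(\<Sum>x | x \<in> V \<and> sphere_map g x = Fin y. local_degree g x) = l"
      using l(2) unfolding has_covering_degree_def by blast+
    have "root_count g W y = (\<Sum>x | x \<in> Fin ` W \<and> sphere_map g x = Fin y. local_degree g x)"
      by (rule sum_local_degree_Fin_image[OF dg, symmetric])
    also have "\<dots> \<le> (\<Sum>x | x \<in> V \<and> sphere_map g x = Fin y. local_degree g x)"
      by (rule sum_mono2[OF fin]) (use V(2) in auto)
    finally show ?thesis using sum l(1) by (simp add: g_def)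
  qed
  then have "bounded_branching \<delta>' (max N 1)" unfolding bounded_branching_def using \<delta>'(1) by blast
  then show thesis by (rule that)
qed

lemma hyperbolic_postcritical_distance:
  assumes "hyperbolic \<langle>{h}\<rangle>"
  obtains \<delta> where "\<delta> > 0" "\<And>x y. x \<in> planar_postcritical \<langle>{h}\<rangle> \<Longrightarrow> y \<in> frontier K \<Longrightarrow> \<delta> \<le> dist y x"
proof -
  have "frontier K \<inter> planar_postcritical \<langle>{h}\<rangle> = {}"
    using assms frontier_K_subset_Julia
    unfolding hyperbolic_def planar_postcritical_def Julia_def by blast
  then obtain \<delta> where "\<delta> > 0" "\<forall>y\<in>frontier K. \<forall>x\<in>planar_postcritical \<langle>{h}\<rangle>. \<delta> \<le> dist y x"
    using separate_compact_closed[OF compact_frontier_K closed_planar_postcritical] by metis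
  then show thesis using that by blast
qed

lemma hyperbolic_imp_bounded_branching:
  assumes "hyperbolic \<langle>{h}\<rangle>"
  obtains \<delta> N where "bounded_branching \<delta> N"
proof -
  obtain \<delta> where \<delta>: "\<delta> > 0" "\<And>x y. x \<in> planar_postcritical \<langle>{h}\<rangle> \<Longrightarrow> y \<in> frontier K \<Longrightarrow> \<delta> \<le> dist y x"
    using hyperbolic_postcritical_distance[OF assms] by metis
  have "root_count (poly_iterate h n) W y \<le> 1"
    if y: "y \<in> frontier K" and W: "W \<in> components (poly (poly_iterate h n) -` ball y \<delta>)" for y n W
  proof (cases n)
    case 0
    then have "degree (poly_iterate h n) = 1" by simp
    then show ?thesis using root_count_le_degree[of "poly_iterate h n" W y] by simp
  next
    case (Suc k)
    have "plane_critical_values (poly_iterate h n) \<subseteq> planar_postcritical \<langle>{h}\<rangle>"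
      unfolding Suc by (rule plane_critical_values_subset_postcritical[OF poly_iterate_Suc_mem])
    then have nc: "plane_critical_values (poly_iterate h n) \<inter> ball y \<delta> = {}"
      using \<delta>(2)[OF _ y] by force
    have sub: "poly (poly_iterate h n) ` W \<subseteq> ball y \<delta>" using in_components_subset[OF W] by blast
    note * = noncritical_vimage_component[OF degree_iterate_pos nc in_components_connected[OF W] sub]
    show ?thesis by (rule root_count_inj_le_1[OF degree_iterate_pos *])
  qed
  then have "bounded_branching \<delta> 1" unfolding bounded_branching_def using \<delta>(1) by blast
  then show thesis by (rule that)
qed

text \<open>The gain is uniformity in n: every component over the disc of radius \<delta> lies in
  the disc of radius R, and its root count is at most N, so \<open>small_component_diameter\<close>
  yields one \<epsilon> for all iterates.\<close>

lemma small_preimages: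
  assumes bb: "bounded_branching \<delta> N" and \<eta>: "\<eta> > 0"
  obtains \<epsilon> where "0 < \<epsilon>" "\<epsilon> \<le> \<delta>"
    "\<And>y n V. y \<in> frontier K \<Longrightarrow> V \<in> components (poly (poly_iterate h n) -` ball y \<epsilon>) \<Longrightarrow>
       \<exists>x\<in>frontier K. x \<in> V \<and> V \<subseteq> ball x \<eta>"
proof -
  have \<delta>: "\<delta> > 0" using bb by (simp add: bounded_branching_def)
  \<comment> \<open>Points outside the disc of radius S are moved outwards, so no preimage of a disc
    of radius \<delta> about a point of K leaves the disc of radius S + \<delta>.\<close>
  define R where "R = S + \<delta>"
  have R: "R > 0" using S_ge_1 \<delta> by (simp add: R_def)
  \<comment> \<open>Dividing by \<open>2 * real N + 1\<close> makes the diameter bound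
    \<open>2 * r * N\<close> strictly smaller than \<eta>, also for N = 0; the minimum keeps
    \<open>r / (2 * R)\<close> at most 1.\<close>
  define r where "r = min (2 * R) (\<eta> / (2 * real N + 1))"
  have r: "0 < r" "r \<le> 2 * R" using R \<eta> by (auto simp: r_def)
  have "r \<le> \<eta> / (2 * real N + 1)" by (simp add: r_def)
  then have "r * (2 * real N + 1) \<le> \<eta>" by (simp add: pos_le_divide_eq)
  then have r\<eta>: "2 * r * real N < \<eta>" using r(1) by (simp add: algebra_simps)
  define \<epsilon> where "\<epsilon> = \<delta> * (r / (2 * R)) ^ N"
  have \<epsilon>0: "0 < \<epsilon>" using \<delta> r R by (simp add: \<epsilon>_def)
  have "(r / (2 * R)) ^ N \<le> 1" using r R by (intro power_le_one) auto
  then have \<epsilon>\<delta>: "\<epsilon> \<le> \<delta>" using \<delta> by (simp add: \<epsilon>_def mult_left_le)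
  have "\<exists>x\<in>frontier K. x \<in> V \<and> V \<subseteq> ball x \<eta>"
    if y: "y \<in> frontier K" and V: "V \<in> components (poly (poly_iterate h n) -` ball y \<epsilon>)" for y n V
  proof -
    define g where "g = poly_iterate h n"
    have dg: "degree g \<ge> 1" unfolding g_def by (rule degree_iterate_pos)
    note V = V[folded g_def]
    have Vsub: "V \<subseteq> poly g -` ball y \<epsilon>" by (rule in_components_subset[OF V])
    obtain v where v: "v \<in> V" using in_components_nonempty[OF V] by blast
    have "V \<subseteq> poly g -` ball y \<delta>" using Vsub \<epsilon>\<delta> by auto
    then obtain W where W: "W \<in> components (poly g -` ball y \<delta>)" "V \<subseteq> W"
      using connected_subset_component[OF in_components_connected[OF V] _ v] by blast
    have WR: "W \<subseteq> cball 0 R"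
    proof
      fix z assume "z \<in> W"
      then have zb: "dist y (poly g z) < \<delta>" using in_components_subset[OF W(1)] by auto
      have "y \<in> K" using y by (simp add: frontier_K_eq)
      then have "cmod y \<le> S" using K_subset by auto
      then have gz: "cmod (poly g z) < R"
        using zb norm_triangle_ineq2[of "poly g z" y] by (simp add: R_def dist_norm norm_minus_commute)
      show "z \<in> cball 0 R"
      proof (rule ccontr)
        assume "z \<notin> cball 0 R"
        then have z: "cmod z > R" by simp
        then have "2 ^ n * cmod z \<le> cmod (poly g z)"
          unfolding g_def by (intro poly_iterate_escapes[OF degree_h S]) (use \<delta> R_def in simp)
        moreover have "1 * cmod z \<le> 2 ^ n * cmod z" by (intro mult_right_mono) auto
        ultimately show False using gz z by simp
      qed
    qed
    have N: "root_count g W y \<le> N" using bb y W(1) unfolding bounded_branching_def g_def by blast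
    have "poly g v \<in> ball y \<epsilon>" using v Vsub by blast
    \<comment> \<open>V has a preimage of the point \<open>poly g v\<close>, hence by constancy of
      the count also one of the centre y; that preimage is the required boundary point.\<close>
    then have "root_count g V y = root_count g V (poly g v)"
      by (intro root_count_component_constant[OF dg _ _ V]) (use \<epsilon>0 in auto)
    moreover have "root_count g V (poly g v) > 0" unfolding root_count_pos_iff[OF dg] using v by blast
    ultimately have "root_count g V y > 0" by simp
    then obtain x where x: "x \<in> V" "poly g x = y" unfolding root_count_pos_iff[OF dg] by blast
    have xf: "x \<in> frontier K" using iterate_frontier_KD[of n x] y x(2) by (simp add: g_def)
    have "dist x x' < \<eta>" if "x' \<in> V" for x'
    proof -
      have "dist x x' \<le> 2 * r * N"
      proof (rule small_component_diameter[OF dg W(1) \<delta> WR N r in_components_connected[OF V] W(2) _ x(1) that])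
        fix z assume "z \<in> V"
        then show "dist y (poly g z) < \<delta> * (r / (2 * R)) ^ N" using Vsub by (auto simp: \<epsilon>_def)
      qed
      then show ?thesis using r\<eta> by simp
    qed
    then show ?thesis using xf x(1) by auto
  qed
  then show thesis using that[OF \<epsilon>0 \<epsilon>\<delta>] by blast
qed

text \<open>If an iterate brought z within \<epsilon> of a boundary point, the component containing
  z would lie within \<eta> of another boundary point, where \<eta> is a lower bound for the
  distance from B to the boundary.\<close>

lemma interior_orbits_avoid_frontier:
  assumes bb: "bounded_branching \<delta> N" and B: "compact B" "B \<subseteq> interior K"
  obtains \<epsilon> where "\<epsilon> > 0" "\<And>n z y. z \<in> B \<Longrightarrow> y \<in> frontier K \<Longrightarrow> \<epsilon> \<le> dist y (poly (poly_iterate h n) z)"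
proof -
  have "frontier K \<inter> B = {}" using B(2) by (auto simp: frontier_K_eq)
  then obtain \<eta> where \<eta>: "\<eta> > 0" "\<And>x z. x \<in> frontier K \<Longrightarrow> z \<in> B \<Longrightarrow> \<eta> \<le> dist x z"
    using separate_compact_closed[OF compact_frontier_K compact_imp_closed[OF B(1)]] by metis
  obtain \<epsilon> where \<epsilon>: "0 < \<epsilon>" and small: "\<And>y n V. y \<in> frontier K \<Longrightarrow>
      V \<in> components (poly (poly_iterate h n) -` ball y \<epsilon>) \<Longrightarrow> \<exists>x\<in>frontier K. x \<in> V \<and> V \<subseteq> ball x \<eta>"
    using small_preimages[OF bb \<eta>(1)] by metis
  have "\<epsilon> \<le> dist y (poly (poly_iterate h n) z)" if z: "z \<in> B" and y: "y \<in> frontier K" for n z y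
  proof (rule ccontr)
    assume "\<not> ?thesis"
    then have mem: "z \<in> poly (poly_iterate h n) -` ball y \<epsilon>" by simp
    then have "connected_component_set (poly (poly_iterate h n) -` ball y \<epsilon>) z
        \<in> components (poly (poly_iterate h n) -` ball y \<epsilon>)" by (rule componentsI)
    from small[OF y this] obtain x where "x \<in> frontier K"
      "connected_component_set (poly (poly_iterate h n) -` ball y \<epsilon>) z \<subseteq> ball x \<eta>" by blast
    moreover have "z \<in> connected_component_set (poly (poly_iterate h n) -` ball y \<epsilon>) z" using mem by simp
    ultimately have "z \<in> ball x \<eta>" "x \<in> frontier K" by blast+
    then show False using \<eta>(2)[OF _ z, of x] by simp
  qed
  then show thesis using that[OF \<epsilon>] by blast
qed

lemma iterate_critical_value:
  assumes "v \<in> plane_critical_values h"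
  shows "poly (poly_iterate h n) v \<in> planar_postcritical \<langle>{h}\<rangle>"
proof -
  have "poly (poly_iterate h n) v \<in> plane_critical_values (poly_iterate h n \<circ>\<^sub>p h)"
    using plane_critical_values_pcompose_superset assms by blast
  also have "poly_iterate h n \<circ>\<^sub>p h = poly_iterate h (Suc n)"
    using poly_iterate_add[of h n 1] by (simp add: poly_iterate_Suc)
  finally show ?thesis
    using plane_critical_values_subset_postcritical[OF poly_iterate_Suc_mem] by blast
qed

text \<open>The orbit of a critical value of h consists of critical values of higher iterates, so it
  stays in the bounded postcritical set.\<close>

lemma critical_values_subset_K:
  assumes "bounded (planar_postcritical \<langle>{h}\<rangle>)"
  shows "plane_critical_values h \<subseteq> K"
proof
  fix v assume v: "v \<in> plane_critical_values h"
  have "poly (poly_iterate h n) v \<in> planar_postcritical \<langle>{h}\<rangle>" for n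
    using iterate_critical_value[OF v] .
  then have "(\<Union>n. {poly (poly_iterate h (Suc n)) v}) \<subseteq> planar_postcritical \<langle>{h}\<rangle>" by blast
  then have "bounded (\<Union>n. {poly (poly_iterate h (Suc n)) v})" using assms bounded_subset by blast
  then show "v \<in> K" by (simp add: filled_Julia_def K_hat_def semigroup_generated_singleton)
qed

end

text \<open>Records what the choice of small coefficients achieves, independently of the shape of
  the generators: each letter of Q sends K into the trap B, and its finite critical values lie there
  too.\<close>

locale extended_dynamics = poly_dynamics +
  fixes Q :: "complex poly set" and B :: "complex set"
  assumes finite_Q: "finite Q" and degree_Q: "\<And>q. q \<in> Q \<Longrightarrow> degree q \<ge> 2"
    and compact_B: "compact B" and B_interior: "B \<subseteq> interior K"
    and critical_values_Q: "\<And>q. q \<in> Q \<Longrightarrow> plane_critical_values q \<subseteq> B"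
    and Q_image: "\<And>q. q \<in> Q \<Longrightarrow> poly q ` K \<subseteq> B"
    and bounded_postcritical_h: "bounded (planar_postcritical \<langle>{h}\<rangle>)"
begin

abbreviation "G \<equiv> \<langle>insert h Q\<rangle>"

lemma degree_generator: "f \<in> insert h Q \<Longrightarrow> degree f \<ge> 2"
  using degree_h degree_Q by auto

lemma degree_G: "g \<in> G \<Longrightarrow> degree g \<ge> 2"
  using semigroup_generated_degree degree_generator by blast

lemma degree_G_pos: "g \<in> G \<Longrightarrow> degree g \<ge> 1"
  using degree_G by fastforce

lemma B_subset_K: "B \<subseteq> K"
  using B_interior interior_subset by blast

lemma generator_K: "f \<in> insert h Q \<Longrightarrow> poly f ` K \<subseteq> K"
  using iterate_mem_K Q_image B_subset_K by blast

lemma G_K: "g \<in> G \<Longrightarrow> poly g ` K \<subseteq> K"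
  using semigroup_generated_invariant generator_K by blast

lemma critical_values_G: "g \<in> G \<Longrightarrow> plane_critical_values g \<subseteq> K"
  by (rule semigroup_generated_critical_values[OF _ generator_K])
    (use critical_values_subset_K[OF bounded_postcritical_h] critical_values_Q B_subset_K in blast)+

lemma K_hat_G: "K_hat G = K"
proof
  have "\<langle>{h}\<rangle> \<subseteq> G" by (rule semigroup_generated_mono) simp
  then show "K_hat G \<subseteq> K"
    unfolding filled_Julia_def K_hat_def by (auto elim!: bounded_subset)
  show "K \<subseteq> K_hat G"
  proof
    fix z assume "z \<in> K"
    then have "(\<Union>g\<in>G. {poly g z}) \<subseteq> K" using G_K by blast
    then show "z \<in> K_hat G" unfolding K_hat_def using bounded_subset[OF compact_imp_bounded[OF compact_K]] by blast
  qed
qed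

lemma G_mem_calG: "G \<in> \<G>"
proof -
  have "polynomial_semigroup G"
    unfolding polynomial_semigroup_def
    using degree_generator by (intro exI[of _ "insert h Q"]) fastforce
  moreover have "planar_postcritical G \<subseteq> K"
    using postcritical_subset[OF compact_K, of G] critical_values_G by (auto simp: planar_postcritical_def)
  ultimately show ?thesis
    unfolding calG_def using degree_G bounded_subset[OF compact_imp_bounded[OF compact_K]] by blast
qed

lemma interior_K_subset_Fatou: "Fin ` interior K \<subseteq> Fatou G"
proof (rule Fatou_bounded_images)
  fix g z assume "g \<in> G" "z \<in> interior K"
  then have "poly g z \<in> K" using G_K interior_subset by blast
  then show "cmod (poly g z) \<le> S" using K_subset by auto
qed simp

lemma Fatou_near_infinity:
  obtains R where "- Fin ` cball 0 R \<subseteq> Fatou G"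
proof -
  obtain R where "escape_radius (insert h Q) R"
    using escape_radius_exists[of "insert h Q"] finite_Q degree_generator by auto
  then show thesis using that Fatou_escaping[of "insert h Q" R] finite_Q degree_generator by auto
qed

lemma Infty_in_Fatou: "Infty \<in> Fatou G"
  using Fatou_near_infinity by auto

theorem hyperbolic_G:
  assumes hyp: "hyperbolic \<langle>{h}\<rangle>"
  shows "hyperbolic G"
proof -
  obtain \<delta> N where bb: "bounded_branching \<delta> N" using hyperbolic_imp_bounded_branching[OF hyp] by blast
  obtain \<epsilon> where \<epsilon>: "\<epsilon> > 0" "\<And>n z y. z \<in> B \<Longrightarrow> y \<in> frontier K \<Longrightarrow> \<epsilon> \<le> dist y (poly (poly_iterate h n) z)"
    using interior_orbits_avoid_frontier[OF bb compact_B B_interior] by metis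
  obtain \<epsilon>' where \<epsilon>': "\<epsilon>' > 0" "\<And>x y. x \<in> planar_postcritical \<langle>{h}\<rangle> \<Longrightarrow> y \<in> frontier K \<Longrightarrow> \<epsilon>' \<le> dist y x"
    using hyperbolic_postcritical_distance[OF hyp] by metis
  \<comment> \<open>The forward orbits under h of the trap and of the critical values of h. A letter
    of Q sends P, as a subset of K, back into B, so P is invariant under all generators.\<close>
  define P where "P = {poly (poly_iterate h n) z |n z. z \<in> B \<union> plane_critical_values h}"
  \<comment> \<open>P need not be closed, whereas the postcritical set is a closure; A is a compact
    set containing P and still inside the interior of K.\<close>
  define A where "A = {z \<in> K. \<forall>y\<in>frontier K. min \<epsilon> \<epsilon>' \<le> dist y z}"
  have BP: "B \<subseteq> P" "plane_critical_values h \<subseteq> P"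
  proof -
    have "z \<in> P" if "z \<in> B \<union> plane_critical_values h" for z
      unfolding P_def using that by (intro CollectI exI[of _ 0] exI[of _ z]) simp
    then show "B \<subseteq> P" "plane_critical_values h \<subseteq> P" by blast+
  qed
  have PA: "P \<subseteq> A"
  proof
    fix x assume "x \<in> P"
    then obtain n z where x: "x = poly (poly_iterate h n) z" and z: "z \<in> B \<union> plane_critical_values h"
      by (auto simp: P_def)
    have "x \<in> K" unfolding x iterate_mem_K_iff
      using z B_subset_K critical_values_subset_K[OF bounded_postcritical_h] by blast
    moreover have "min \<epsilon> \<epsilon>' \<le> dist y x" if y: "y \<in> frontier K" for y
      using z
    proof
      assume "z \<in> B"
      then show ?thesis using \<epsilon>(2)[OF _ y, of z n] x by simp
    next
      assume "z \<in> plane_critical_values h"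
      then have "x \<in> planar_postcritical \<langle>{h}\<rangle>" unfolding x by (rule iterate_critical_value)
      then show ?thesis using \<epsilon>'(2)[OF _ y, of x] by simp
    qed
    ultimately show "x \<in> A" by (simp add: A_def)
  qed
  have A_eq: "A = K \<inter> (\<Inter>y\<in>frontier K. {z. min \<epsilon> \<epsilon>' \<le> dist y z})" by (auto simp: A_def)
  have "closed (\<Inter>y\<in>frontier K. {z. min \<epsilon> \<epsilon>' \<le> dist y z})"
    by (intro closed_INT ballI closed_Collect_le continuous_intros)
  then have cA: "compact A" unfolding A_eq by (rule compact_Int_closed[OF compact_K])
  have Aint: "A \<subseteq> interior K"
  proof
    fix z assume z: "z \<in> A"
    have "z \<notin> frontier K"
    proof
      assume "z \<in> frontier K"
      then have "min \<epsilon> \<epsilon>' \<le> dist z z" using z unfolding A_def by blast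
      then show False using \<epsilon>(1) \<epsilon>'(1) by simp
    qed
    then show "z \<in> interior K" using z by (auto simp: A_def frontier_K_eq)
  qed
  have inv: "poly f ` P \<subseteq> P" if f: "f \<in> insert h Q" for f
  proof (cases "f = h")
    case True
    show ?thesis
    proof
      fix v assume "v \<in> poly f ` P"
      then obtain n z where "z \<in> B \<union> plane_critical_values h" "v = poly h (poly (poly_iterate h n) z)"
        using True by (auto simp: P_def)
      then have "v = poly (poly_iterate h (Suc n)) z" "z \<in> B \<union> plane_critical_values h"
        by (auto simp: poly_iterate_Suc poly_pcompose)
      then show "v \<in> P" unfolding P_def by blast
    qed
  next
    case False
    then have "poly f ` K \<subseteq> B" using f Q_image by blast
    moreover have "P \<subseteq> K" using PA by (auto simp: A_def)
    ultimately show ?thesis using BP(1) by blast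
  qed
  have cv: "plane_critical_values f \<subseteq> P" if "f \<in> insert h Q" for f
    using that critical_values_Q BP by blast
  have "postcritical G \<subseteq> insert Infty (Fin ` A)"
    by (rule postcritical_subset[OF cA order_trans[OF semigroup_generated_critical_values[OF _ inv cv] PA]])
  also have "\<dots> \<subseteq> Fatou G"
    using Aint interior_K_subset_Fatou Infty_in_Fatou by blast
  finally show ?thesis unfolding hyperbolic_def .
qed

text \<open>The bound is the maximum with 1 because two regimes meet: discs away from the boundary
  of K give univalent branches, discs near it inherit the bound N of the iterates of h.\<close>

lemma root_count_bound:
  assumes bb: "bounded_branching \<delta> N"
  obtains \<epsilon> where "\<epsilon> > 0" "\<And>y g V. y \<notin> interior K \<Longrightarrow> g \<in> G \<Longrightarrow> connected V \<Longrightarrow> V \<noteq> {} \<Longrightarrow>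
    poly g ` V \<subseteq> ball y \<epsilon> \<Longrightarrow> root_count g V y \<le> max N 1"
proof -
  have "frontier K \<inter> B = {}" using B_interior by (auto simp: frontier_K_eq)
  then obtain \<eta> where \<eta>: "\<eta> > 0" "\<And>x z. x \<in> frontier K \<Longrightarrow> z \<in> B \<Longrightarrow> \<eta> \<le> dist x z"
    using separate_compact_closed[OF compact_frontier_K compact_imp_closed[OF compact_B]] by metis
  obtain \<epsilon> where \<epsilon>: "0 < \<epsilon>" "\<epsilon> \<le> \<delta>" and small: "\<And>y n V. y \<in> frontier K \<Longrightarrow>
      V \<in> components (poly (poly_iterate h n) -` ball y \<epsilon>) \<Longrightarrow> \<exists>x\<in>frontier K. x \<in> V \<and> V \<subseteq> ball x \<eta>"
    using small_preimages[OF bb \<eta>(1)] by metis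
  \<comment> \<open>The radius is halved so that a disc whose centre is close to the boundary fits
    into the disc of radius \<epsilon> about a boundary point y'.\<close>
  have "root_count g V y \<le> max N 1"
    if y: "y \<notin> interior K" and g: "g \<in> G" and V: "connected V" "V \<noteq> {}" "poly g ` V \<subseteq> ball y (\<epsilon> / 2)" for y g V
  proof (cases "\<exists>y'\<in>frontier K. dist y y' < \<epsilon> / 2")
    case False
    then have "ball y (\<epsilon> / 2) \<inter> frontier K = {}" by auto
    moreover have "y \<notin> K"
    proof
      assume "y \<in> K"
      then have "y \<in> frontier K" using y by (simp add: frontier_K_eq)
      then show False using False \<epsilon>(1) by (metis dist_self half_gt_zero)
    qed
    moreover have "y \<in> ball y (\<epsilon> / 2)" using \<epsilon>(1) by simp
    \<comment> \<open>The disc avoids the boundary and its centre is outside K, so it misses K and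
      with it every finite critical value of the semigroup.\<close>
    ultimately have "ball y (\<epsilon> / 2) \<inter> K = {}"
      using connected_Int_frontier[OF connected_ball, of y "\<epsilon> / 2" K] by blast
    then have nc: "plane_critical_values g \<inter> ball y (\<epsilon> / 2) = {}" using critical_values_G[OF g] by blast
    note * = noncritical_vimage_component[OF degree_G_pos[OF g] nc V(1,3)]
    have "root_count g V y \<le> 1" by (rule root_count_inj_le_1[OF degree_G_pos[OF g] *])
    then show ?thesis by simp
  next
    case True
    then obtain y' where y': "y' \<in> frontier K" "dist y y' < \<epsilon> / 2" by blast
    have sub: "ball y (\<epsilon> / 2) \<subseteq> ball y' \<epsilon>"
    proof
      fix z assume "z \<in> ball y (\<epsilon> / 2)"
      then show "z \<in> ball y' \<epsilon>" using y'(2) dist_triangle[of y' z y] by (simp add: dist_commute)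
    qed
    have y\<epsilon>: "y \<in> ball y' \<epsilon>" using y'(2) \<epsilon>(1) by (simp add: dist_commute)
    \<comment> \<open>The bound is given over the centre y' and transferred to y, which lies in the
      same disc.\<close>
    have iterate_bound: "root_count (poly_iterate h k) W y \<le> N"
      if "W \<in> components (poly (poly_iterate h k) -` ball y' \<delta>)" for k W
    proof -
      have "root_count (poly_iterate h k) W y = root_count (poly_iterate h k) W y'"
        by (rule root_count_component_constant[OF degree_iterate_pos _ _ that])
          (use y\<epsilon> \<epsilon> in auto)
      then show ?thesis using bb y'(1) that unfolding bounded_branching_def by simp
    qed
    consider (iterate) k where "g = poly_iterate h (Suc k)"
      | (mixed) k q f where "q \<in> Q" "g = poly_iterate h k \<circ>\<^sub>p f" "f \<in> G"
          "f = q \<or> (\<exists>g'\<in>G. f = q \<circ>\<^sub>p g')"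
      using semigroup_insert_cases[OF g] by blast
    then show ?thesis
    proof cases
      case (iterate k)
      note k = iterate
      have "V \<subseteq> poly (poly_iterate h (Suc k)) -` ball y' \<delta>" using V(3) sub \<epsilon>(2) k by fastforce
      then obtain W where W: "W \<in> components (poly (poly_iterate h (Suc k)) -` ball y' \<delta>)" "V \<subseteq> W"
        using connected_subset_component[OF V(1)] V(2) by blast
      have "root_count g V y \<le> root_count g W y" by (rule root_count_mono[OF W(2)])
      then show ?thesis using iterate_bound[OF W(1)] by (simp add: k)
    next
      case (mixed k q f)
      note q = mixed(1) and gf = mixed(2) and f = mixed(3) and fq = mixed(4)
      \<comment> \<open>The leftmost letter q of f sends all critical values of the inner word,
        which lie in K, into B; its own are there already.\<close>
      have cvf: "plane_critical_values f \<subseteq> B" using fq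
      proof
        assume "f = q"
        then show ?thesis using critical_values_Q[OF q] by simp
      next
        assume "\<exists>g'\<in>G. f = q \<circ>\<^sub>p g'"
        then obtain g' where g': "g' \<in> G" "f = q \<circ>\<^sub>p g'" by blast
        have "poly q ` plane_critical_values g' \<subseteq> B"
          using critical_values_G[OF g'(1)] Q_image[OF q] by blast
        then show ?thesis
          using plane_critical_values_pcompose[of q g'] critical_values_Q[OF q] g'(2) by blast
      qed
      have fV: "poly f ` V \<subseteq> poly (poly_iterate h k) -` ball y' \<epsilon>"
        using V(3) sub unfolding gf by (auto simp: poly_pcompose)
      obtain C where C: "C \<in> components (poly (poly_iterate h k) -` ball y' \<epsilon>)" "poly f ` V \<subseteq> C"
        using connected_image_component[OF V(1,2) fV] by metis
      obtain x where x: "x \<in> frontier K" "C \<subseteq> ball x \<eta>" using small[OF y'(1) C(1)] by blast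
      have "plane_critical_values f \<inter> ball x \<eta> = {}" using cvf \<eta>(2)[OF x(1)] by force
      note * = noncritical_vimage_component[OF degree_G_pos[OF f] this V(1) order_trans[OF C(2) x(2)]]
      \<comment> \<open>Two radii are in play: the component over the disc of radius \<epsilon> is
        small and makes f univalent on V, while the count of the iterate is bounded over the disc of
        radius \<delta>.\<close>
      have fV': "poly f ` V \<subseteq> poly (poly_iterate h k) -` ball y' \<delta>" using fV \<epsilon>(2) by auto
      obtain W where W: "W \<in> components (poly (poly_iterate h k) -` ball y' \<delta>)" "poly f ` V \<subseteq> W"
        using connected_image_component[OF V(1,2) fV'] by metis
      have "root_count g V y \<le> root_count (poly_iterate h k) W y"
        unfolding gf by (rule root_count_pcompose_le[OF degree_iterate_pos degree_G_pos[OF f] * W(2)])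
      then show ?thesis using iterate_bound[OF W(1)] by simp
    qed
  qed
  then show thesis using that[of "\<epsilon> / 2"] \<epsilon>(1) by auto
qed

text \<open>The Julia set of G lies in a bounded part of the plane and avoids the interior of K, so
  one spherical radius fits into planar discs of radius \<epsilon> about all its points. The planar
  trace W of a spherical ball is generally not a disc centred at y, but it is open and connected, as
  constancy of counts demands.\<close>

theorem semi_hyperbolic_G:
  assumes "semi_hyperbolic \<langle>{h}\<rangle>"
  shows "semi_hyperbolic G"
proof -
  obtain \<delta> N where bb: "bounded_branching \<delta> N" using semi_hyperbolic_imp_bounded_branching[OF assms] by blast
  obtain \<epsilon> where \<epsilon>: "\<epsilon> > 0" and bound: "\<And>y g V. y \<notin> interior K \<Longrightarrow> g \<in> G \<Longrightarrow> connected V \<Longrightarrow> V \<noteq> {} \<Longrightarrow>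
    poly g ` V \<subseteq> ball y \<epsilon> \<Longrightarrow> root_count g V y \<le> max N 1"
    using root_count_bound[OF bb] by metis
  obtain R where R: "- Fin ` cball 0 R \<subseteq> Fatou G" using Fatou_near_infinity by blast
  obtain \<sigma> where \<sigma>: "\<sigma> > 0" "\<And>y. cmod y \<le> max 0 R \<Longrightarrow> ball (Fin y) \<sigma> \<subseteq> Fin ` ball y \<epsilon>"
    using ball_rsphere_subset_Fin_ball[OF \<epsilon>, of "max 0 R"] by auto
  have "\<exists>n\<le>max N 1. has_covering_degree g V (ball x \<sigma>) n"
    if x: "x \<in> Julia G" and g: "g \<in> G" and V: "V \<in> components (sphere_map g -` ball x \<sigma>)"
    for x g V
  proof -
    have "x \<in> Fin ` cball 0 R" using x R by (auto simp: Julia_def)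
    then obtain y where y: "x = Fin y" "cmod y \<le> R" by auto
    have yint: "y \<notin> interior K" using x interior_K_subset_Fatou y(1) by (auto simp: Julia_def)
    define W where "W = Fin -` ball x \<sigma>"
    have b: "ball x \<sigma> \<subseteq> Fin ` ball y \<epsilon>" using \<sigma>(2)[of y] y by simp
    then have ninf: "Infty \<notin> ball x \<sigma>" by auto
    have bW: "ball x \<sigma> = Fin ` W" unfolding W_def using b by auto
    have Wsub: "W \<subseteq> ball y \<epsilon>" using b unfolding bW by (auto dest: inj_onD[OF inj_Fin[of UNIV]])
    have oW: "open W" unfolding W_def by (intro open_vimage continuous_on_Fin) simp
    have cW: "connected W" unfolding W_def y(1) by (rule connected_Fin_vimage_ball[OF _ \<sigma>(1)]) (use ninf y(1) in simp)
    have yW: "y \<in> W" using \<sigma>(1) by (simp add: W_def y(1))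
    have "sphere_map g -` ball x \<sigma> = Fin ` (poly g -` W)"
      unfolding W_def by (rule vimage_sphere_map[OF degree_G_pos[OF g] ninf])
    then obtain V' where V': "V' \<in> components (poly g -` W)" "V = Fin ` V'"
      using V components_Fin_image by metis
    have "poly g ` V' \<subseteq> ball y \<epsilon>" using in_components_subset[OF V'(1)] Wsub by blast
    then have "root_count g V' y \<le> max N 1"
      by (rule bound[OF yint g in_components_connected[OF V'(1)] in_components_nonempty[OF V'(1)]])
    moreover have "has_covering_degree g V (ball x \<sigma>) (root_count g V' y)"
      unfolding bW V'(2) by (rule has_covering_degree_component[OF degree_G_pos[OF g] oW cW V'(1) yW])
    ultimately show ?thesis by blast
  qed
  then show ?thesis unfolding semi_hyperbolic_def using \<sigma>(1) by blast
qed

end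

section \<open>Disconnected Julia sets\<close>

lemma poly_centered_power: "poly (centered_power a b d) z = a * (z - b) ^ d + b"
  by (simp add: centered_power_def algebra_simps)

lemma degree_centered_power:
  assumes "a \<noteq> 0" "d \<ge> 1"
  shows "degree (centered_power a b d) = d"
proof -
  have "degree (smult a ([:- b, 1:] ^ d)) = d" using assms(1) by (simp add: degree_power_eq)
  then show ?thesis unfolding centered_power_def using assms(2) by (simp add: degree_add_eq_left)
qed

lemma plane_critical_values_centered_power:
  assumes "a \<noteq> 0" "d \<ge> 2"
  shows "plane_critical_values (centered_power a b d) \<subseteq> {b}"
proof -
  obtain n where n: "d = Suc (Suc n)" using assms(2) by (metis add_2_eq_Suc le_Suc_ex)
  have "poly (pderiv (centered_power a b d)) z = a * of_nat d * (z - b) ^ Suc n" for z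
    unfolding n centered_power_def
    by (simp only: pderiv_add pderiv_smult pderiv_power_Suc) (simp add: pderiv_pCons algebra_simps)
  then have "poly (pderiv (centered_power a b d)) z = 0 \<longleftrightarrow> z = b" for z
    using assms(1) n by (auto simp del: of_nat_Suc)
  then show ?thesis
    using n by (auto simp: plane_critical_values_def poly_centered_power)
qed

text \<open>Peel off p = a + z q: the factor z supplies one more power, and half of the constant for
  q absorbs a.\<close>

lemma cmod_poly_lower_bound:
  fixes p :: "complex poly"
  assumes "degree p \<ge> n" "p \<noteq> 0"
  shows "\<exists>\<kappa>>0. \<exists>R. \<forall>z. cmod z \<ge> R \<longrightarrow> \<kappa> * cmod z ^ n \<le> cmod (poly p z)"
  using assms
proof (induction n arbitrary: p)
  case 0
  show ?case
  proof (cases "degree p = 0")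
    case True
    then obtain c where "p = [:c:]" by (rule degree_eq_zeroE)
    then show ?thesis using 0 by (intro exI[of _ "cmod c"]) auto
  next
    case False
    then obtain R where "\<And>z. cmod z \<ge> R \<Longrightarrow> cmod (poly p z) > 1" using cmod_poly_large[of p 1] by auto
    then show ?thesis by (intro exI[of _ 1]) (auto intro: less_imp_le)
  qed
next
  case (Suc n)
  obtain a q where p: "p = pCons a q" by (rule pCons_cases)
  have q: "degree q \<ge> n" "q \<noteq> 0" using Suc.prems unfolding p by (auto split: if_splits)
  obtain \<kappa> R where \<kappa>: "\<kappa> > 0" and R: "\<And>z. cmod z \<ge> R \<Longrightarrow> \<kappa> * cmod z ^ n \<le> cmod (poly q z)"
    using Suc.IH[OF q] by blast
  have bound: "\<kappa> / 2 * cmod z ^ Suc n \<le> cmod (poly p z)" if z: "cmod z \<ge> max R (max 1 (2 * cmod a / \<kappa>))" for z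
  proof -
    have z1: "cmod z \<ge> 1" "cmod z \<ge> R" "cmod z \<ge> 2 * cmod a / \<kappa>" using z by auto
    have "cmod a \<le> \<kappa> / 2 * cmod z" using z1(3) \<kappa> by (simp add: field_simps)
    also have "\<dots> \<le> \<kappa> / 2 * cmod z ^ Suc n"
      using z1(1) \<kappa> power_increasing[of 1 "Suc n" "cmod z"] by (intro mult_left_mono) auto
    finally have a: "cmod a \<le> \<kappa> / 2 * cmod z ^ Suc n" .
    have "cmod z * (\<kappa> * cmod z ^ n) \<le> cmod z * cmod (poly q z)"
      by (intro mult_left_mono R z1) auto
    then have "\<kappa> * cmod z ^ Suc n \<le> cmod (z * poly q z)" by (simp add: norm_mult mult_ac)
    moreover have "cmod (z * poly q z) - cmod a \<le> cmod (poly p z)"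
      using norm_triangle_ineq2[of "z * poly q z" "- a"] by (simp add: p add.commute)
    ultimately show ?thesis using a by simp
  qed
  have "\<kappa> / 2 > 0" using \<kappa> by simp
  with bound show ?case by blast
qed

text \<open>Generators of different degrees are compared with one common power, whose exponent is a
  lower bound for all degrees.\<close>

lemma cmod_polys_lower_bound:
  fixes F :: "complex poly set"
  assumes "finite F" "\<And>f. f \<in> F \<Longrightarrow> degree f \<ge> n" "n \<ge> 1"
  obtains \<kappa> R where "\<kappa> > 0" "\<And>f z. f \<in> F \<Longrightarrow> cmod z \<ge> R \<Longrightarrow> \<kappa> * cmod z ^ n \<le> cmod (poly f z)"
proof -
  have "\<exists>\<kappa>>0. \<exists>R. \<forall>f\<in>F. \<forall>z. cmod z \<ge> R \<longrightarrow> \<kappa> * cmod z ^ n \<le> cmod (poly f z)"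
    using assms(1,2)
  proof (induction F rule: finite_induct)
    case empty
    show ?case by (intro exI[of _ 1]) auto
  next
    case (insert f F)
    obtain \<kappa> R where 1: "\<kappa> > 0" "\<forall>f\<in>F. \<forall>z. cmod z \<ge> R \<longrightarrow> \<kappa> * cmod z ^ n \<le> cmod (poly f z)"
      using insert.IH insert.prems by auto
    have "degree f \<ge> n" "f \<noteq> 0" using insert.prems[of f] assms(3) by auto
    then obtain \<kappa>' R' where 2: "\<kappa>' > 0" "\<And>z. cmod z \<ge> R' \<Longrightarrow> \<kappa>' * cmod z ^ n \<le> cmod (poly f z)"
      using cmod_poly_lower_bound by metis
    have bound: "min \<kappa> \<kappa>' * cmod z ^ n \<le> cmod (poly g z)" if "g \<in> insert f F" "cmod z \<ge> max R R'" for g z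
    proof -
      have "min \<kappa> \<kappa>' * cmod z ^ n \<le> \<kappa> * cmod z ^ n" "min \<kappa> \<kappa>' * cmod z ^ n \<le> \<kappa>' * cmod z ^ n"
        by (intro mult_right_mono; simp)+
      then show ?thesis using that 1(2) 2(2)[of z] by (auto intro: order_trans)
    qed
    have "min \<kappa> \<kappa>' > 0" using 1(1) 2(1) by simp
    with bound show ?case by blast
  qed
  then show thesis using that by blast
qed

text \<open>Indexed by an arbitrary set so that the generators can be divided into those with fixed
  and those with shrinking coefficients.\<close>

definition power_generators ::
    "nat set \<Rightarrow> (nat \<Rightarrow> nat) \<Rightarrow> (nat \<Rightarrow> complex) \<Rightarrow> (nat \<Rightarrow> complex) \<Rightarrow> complex poly set" where
  "power_generators J d b a = (\<lambda>j. centered_power (a j) (b j) (d j)) ` J"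

lemma extended_semigroup_eq: "extended_semigroup h m d b a = \<langle>insert h (power_generators {2..m} d b a)\<rangle>"
proof -
  have "{h} \<union> {centered_power (a j) (b j) (d j) | j. j \<in> {2..m}} = insert h (power_generators {2..m} d b a)"
    by (auto simp: power_generators_def)
  then show ?thesis by (simp only: extended_semigroup_def)
qed

context poly_dynamics
begin

text \<open>The trap is a union of closed discs about the points b j, each being the finite critical
  value and a fixed point of its generator. The bound \<open>\<rho> \<le> 1\<close> is exported
  because the disconnected case compares a power of \<rho> with \<rho>.\<close>

lemma extended_dynamics_small_coefficients:
  assumes J: "finite J" "\<And>j. j \<in> J \<Longrightarrow> d j \<ge> 2" "\<And>j. j \<in> J \<Longrightarrow> b j \<in> interior K"
    and bnd: "bounded (planar_postcritical \<langle>{h}\<rangle>)"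
  shows "\<exists>c \<rho>. c > 0 \<and> 0 < \<rho> \<and> \<rho> \<le> 1 \<and> (\<forall>j\<in>J. cball (b j) \<rho> \<subseteq> interior K) \<and>
    (\<forall>a. (\<forall>j\<in>J. 0 < cmod (a j) \<and> cmod (a j) < c) \<longrightarrow>
       extended_dynamics h (power_generators J d b a) (\<Union>j\<in>J. cball (b j) \<rho>))"
proof -
  have "\<exists>\<rho>. 0 < \<rho> \<and> \<rho> \<le> 1 \<and> (\<forall>j\<in>J. cball (b j) \<rho> \<subseteq> interior K)"
    using J(1,3)
  proof (induction J rule: finite_induct)
    case empty
    show ?case by (intro exI[of _ 1]) auto
  next
    case (insert j J)
    then obtain \<rho> where \<rho>: "0 < \<rho>" "\<rho> \<le> 1" "\<forall>j\<in>J. cball (b j) \<rho> \<subseteq> interior K" by auto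
    obtain \<rho>' where \<rho>': "\<rho>' > 0" "cball (b j) \<rho>' \<subseteq> interior K"
      using insert.prems[of j] open_interior open_contains_cball by blast
    have "cball (b i) (min \<rho> \<rho>') \<subseteq> interior K" if "i \<in> insert j J" for i
      using that \<rho>(3) \<rho>'(2) by fastforce
    then show ?case using \<rho>(1,2) \<rho>'(1) by (intro exI[of _ "min \<rho> \<rho>'"]) auto
  qed
  then obtain \<rho> where \<rho>: "0 < \<rho>" "\<rho> \<le> 1" "\<And>j. j \<in> J \<Longrightarrow> cball (b j) \<rho> \<subseteq> interior K" by blast
  \<comment> \<open>M dominates the d j-th power of |z - b j| on K for all j at once, so
    coefficients below \<rho>/M send K into the discs of radius \<rho>.\<close>
  define M where "M = 1 + (\<Sum>j\<in>J. (S + cmod (b j)) ^ d j)"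
  have nn: "0 \<le> (S + cmod (b j)) ^ d j" for j using S_ge_1 by simp
  have M: "M \<ge> 1" "(S + cmod (b j)) ^ d j \<le> M" if "j \<in> J" for j
  proof -
    show "M \<ge> 1" unfolding M_def using nn by (simp add: sum_nonneg)
    have "(S + cmod (b j)) ^ d j \<le> (\<Sum>j\<in>J. (S + cmod (b j)) ^ d j)"
      by (rule member_le_sum[OF that]) (use nn J(1) in auto)
    then show "(S + cmod (b j)) ^ d j \<le> M" by (simp add: M_def)
  qed
  have M0: "M > 0" unfolding M_def using nn by (simp add: add_pos_nonneg sum_nonneg)
  have ext: "extended_dynamics h (power_generators J d b a) (\<Union>j\<in>J. cball (b j) \<rho>)"
    if a: "\<forall>j\<in>J. 0 < cmod (a j) \<and> cmod (a j) < \<rho> / M" for a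
  proof
    show "finite (power_generators J d b a)" using J(1) by (simp add: power_generators_def)
    show "compact (\<Union>j\<in>J. cball (b j) \<rho>)" using J(1) by (intro compact_UN) auto
    show "(\<Union>j\<in>J. cball (b j) \<rho>) \<subseteq> interior K" using \<rho>(3) by blast
    show "bounded (planar_postcritical \<langle>{h}\<rangle>)" by (rule bnd)
    fix q assume "q \<in> power_generators J d b a"
    then obtain j where j: "j \<in> J" and q: "q = centered_power (a j) (b j) (d j)" by (auto simp: power_generators_def)
    have a0: "a j \<noteq> 0" using bspec[OF a j] by auto
    show "degree q \<ge> 2" using J(2)[OF j] a0 by (simp add: q degree_centered_power)
    have "plane_critical_values q \<subseteq> {b j}"
      unfolding q by (rule plane_critical_values_centered_power[OF a0 J(2)[OF j]])
    moreover have "b j \<in> cball (b j) \<rho>" using \<rho>(1) by simp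
    ultimately show "plane_critical_values q \<subseteq> (\<Union>j\<in>J. cball (b j) \<rho>)" using j by blast
    show "poly q ` K \<subseteq> (\<Union>j\<in>J. cball (b j) \<rho>)"
    proof
      fix w assume "w \<in> poly q ` K"
      then obtain z where z: "z \<in> K" "w = poly q z" by blast
      have "cmod z \<le> S" using z(1) K_subset by auto
      then have "cmod (z - b j) \<le> S + cmod (b j)" using norm_triangle_ineq4[of z "b j"] by linarith
      then have "cmod (z - b j) ^ d j \<le> (S + cmod (b j)) ^ d j" by (simp add: power_mono)
      also have "\<dots> \<le> M" by (rule M(2)[OF j])
      finally have "cmod (a j) * cmod (z - b j) ^ d j \<le> (\<rho> / M) * M"
        using bspec[OF a j] M0 \<rho>(1) by (intro mult_mono) auto
      then have "dist (b j) w \<le> \<rho>"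
        using M0 by (simp add: z(2) q poly_centered_power dist_norm norm_mult norm_power norm_minus_commute)
      then show "w \<in> (\<Union>j\<in>J. cball (b j) \<rho>)" using j by auto
    qed
  qed
  have "\<rho> / M > 0" using \<rho>(1) M0 by simp
  then show ?thesis
    using \<rho> ext by (intro exI[of _ "\<rho> / M"] exI[of _ \<rho>] conjI allI impI ballI) auto
qed

end

text \<open>In coordinates centred at b the map is w to a w^d, so the disc of radius r is invariant
  under the stated condition. In the application equality holds and the disc reaches out to the
  Julia circle.\<close>

lemma ball_subset_filled_Julia_centered_power:
  assumes "cmod a * r ^ (d - 1) \<le> 1" "d \<ge> 1" "r \<ge> 0"
  shows "cball b r \<subseteq> filled_Julia (centered_power a b d)"
proof
  fix z assume z: "z \<in> cball b r"
  have inv: "poly (centered_power a b d) ` cball b r \<subseteq> cball b r"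
  proof
    fix w assume "w \<in> poly (centered_power a b d) ` cball b r"
    then obtain x where "x \<in> cball b r" "w = poly (centered_power a b d) x" by blast
    then have x: "cmod (x - b) \<le> r" "w = a * (x - b) ^ d + b"
      by (simp_all add: poly_centered_power dist_norm norm_minus_commute)
    have "dist b w = cmod a * cmod (x - b) ^ d"
      by (simp add: x(2) dist_norm norm_minus_commute norm_mult norm_power)
    also have "\<dots> \<le> cmod a * r ^ d" using x(1) by (intro mult_left_mono power_mono) auto
    also have "\<dots> = (cmod a * r ^ (d - 1)) * r"
      using assms(2) by (metis mult.assoc mult.commute power_minus_mult zero_less_one less_le_trans)
    also have "\<dots> \<le> 1 * r" by (intro mult_right_mono assms)
    finally show "w \<in> cball b r" by simp
  qed
  have "poly g z \<in> cball b r" if "g \<in> \<langle>{centered_power a b d}\<rangle>" for g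
  proof -
    have "poly g ` cball b r \<subseteq> cball b r" by (rule semigroup_generated_invariant[OF that]) (use inv in simp)
    then show ?thesis using z by blast
  qed
  then have "(\<Union>g\<in>\<langle>{centered_power a b d}\<rangle>. {poly g z}) \<subseteq> cball b r" by blast
  then show "z \<in> filled_Julia (centered_power a b d)"
    unfolding filled_Julia_def K_hat_def using bounded_subset[OF bounded_cball] by blast
qed

section \<open>Separation of the Julia set by an annulus\<close>

context extended_dynamics
begin

text \<open>The annulus \<open>s < |z| < s'\<close> separates: each generator maps it into the basin of infinity or
  into the interior of \<open>K\<close>.\<close>

lemma Julia_G_disconnected:
  assumes T: "escape_radius (insert h Q) T"
    and s: "S \<le> s" "s < s'" and K: "K \<noteq> {}"
    and annulus: "\<And>f z. f \<in> insert h Q \<Longrightarrow> s < cmod z \<Longrightarrow> cmod z < s' \<Longrightarrow>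
        cmod (poly f z) > T \<or> poly f z \<in> interior K"
    and outer: "q \<in> Q" "cball v r \<subseteq> filled_Julia q" "r \<ge> 0" "r > s + cmod v"
  shows "\<not> connected (Julia G)"
proof
  assume conn: "connected (Julia G)"
  have Fatou_T: "- Fin ` cball 0 T \<subseteq> Fatou G"
    using Fatou_escaping[OF _ _ T] finite_Q degree_generator by blast
  define C1 where "C1 = Fin ` cball 0 s"
  define C2 where "C2 = - Fin ` ball 0 s'"
  have c1: "closed C1" unfolding C1_def by (rule compact_imp_closed) (simp add: compact_Fin_image_iff)
  have c2: "closed C2" unfolding C2_def by (intro closed_Compl open_Fin_image) simp
  have dis: "C1 \<inter> C2 = {}" using s by (auto simp: C1_def C2_def)
  have cover: "Julia G \<subseteq> C1 \<union> C2"
  proof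
    fix x assume x: "x \<in> Julia G"
    show "x \<in> C1 \<union> C2"
    proof (cases x)
      case (Fin z)
      have "\<not> (s < cmod z \<and> cmod z < s')"
      proof
        assume z: "s < cmod z \<and> cmod z < s'"
        have "Fin z \<in> Fatou G"
        proof (rule Fatou_backward)
          fix f assume f: "f \<in> insert h Q"
          then show "degree f \<ge> 1" using degree_generator by fastforce
          from annulus[OF f] z have "cmod (poly f z) > T \<or> poly f z \<in> interior K" by blast
          then show "Fin (poly f z) \<in> Fatou G"
          proof
            assume "cmod (poly f z) > T"
            then have "Fin (poly f z) \<notin> Fin ` cball 0 T" by auto
            then show ?thesis using Fatou_T by blast
          qed (use interior_K_subset_Fatou in blast)
        qed (use finite_Q in simp)
        then show False using x Fin by (simp add: Julia_def)
      qed
      then show ?thesis using Fin by (auto simp: C1_def C2_def)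
    qed (auto simp: C2_def)
  qed
  \<comment> \<open>The boundary of K supplies a Julia point inside the annulus.\<close>
  obtain x where x: "x \<in> frontier K" using frontier_K_nonempty[OF K] by blast
  have "\<langle>{h}\<rangle> \<subseteq> G" by (rule semigroup_generated_mono) simp
  then have "Fin x \<in> Julia G" using frontier_K_subset_Julia[OF x] Julia_mono by blast
  moreover have "x \<in> K" using x by (simp add: frontier_K_eq)
  then have "Fin x \<in> C1" using K_subset s(1) by (auto simp: C1_def)
  ultimately have ne1: "C1 \<inter> Julia G \<noteq> {}" by blast
  \<comment> \<open>The boundary of the filled Julia set of the single generator q supplies a Julia
    point outside the annulus, since that filled set contains the disc about v of radius r.\<close>
  interpret q: poly_dynamics q by unfold_locales (rule degree_Q[OF outer(1)])
  have "v \<in> filled_Julia q" using outer(2,3) by auto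
  then obtain y where y: "y \<in> frontier (filled_Julia q)" using q.frontier_K_nonempty by blast
  have "\<langle>{q}\<rangle> \<subseteq> G" using outer(1) by (intro semigroup_generated_mono) simp
  then have yJ: "Fin y \<in> Julia G" using q.frontier_K_subset_Julia[OF y] Julia_mono by blast
  have "ball v r \<subseteq> interior (filled_Julia q)"
    using outer(2) ball_subset_cball by (intro interior_maximal) blast+
  then have "y \<notin> ball v r" using y by (auto simp: q.frontier_K_eq)
  then have "r \<le> cmod (y - v)" by (simp add: dist_norm norm_minus_commute)
  also have "\<dots> \<le> cmod y + cmod v" by (rule norm_triangle_ineq4)
  finally have "cmod y > s" using outer(4) by linarith
  then have "Fin y \<notin> C1" by (auto simp: C1_def)
  then have ne2: "C2 \<inter> Julia G \<noteq> {}" using cover yJ by blast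
  show False
    using conn c1 c2 cover dis ne1 ne2 unfolding connected_closed by blast
qed

end

section \<open>Choice of coefficients with disconnected Julia set\<close>

context poly_dynamics
begin

text \<open>The coefficients \<open>u ^ (- 6 (d j - 1))\<close> put the Julia sets of the generators in \<open>J'\<close> at radius
  \<open>u ^ 6\<close>. The remaining generators send the circle of radius about \<open>u ^ \<alpha>\<close> beyond that radius,
  whereas the generators in \<open>J'\<close> contract the disc of radius about \<open>u ^ (\<alpha> + 1)\<close> into \<open>K\<close>.\<close>

lemma disconnecting_coefficients:
  assumes J: "finite J" "\<And>j. j \<in> J \<Longrightarrow> d j \<ge> 2" "\<And>j. j \<in> J \<Longrightarrow> b j \<in> interior K"
    and bnd: "bounded (planar_postcritical \<langle>{h}\<rangle>)"
    and J': "J' \<subseteq> J" "j0 \<in> J'"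
    and e: "e * \<alpha> = (6::nat)" "degree h \<ge> e" "\<And>j. j \<in> J - J' \<Longrightarrow> d j \<ge> e"
    and \<alpha>: "\<And>j. j \<in> J' \<Longrightarrow> (\<alpha> + 1) * d j \<le> 6 * (d j - 1)"
  shows "\<exists>(a :: nat \<Rightarrow> real) B. (\<forall>j\<in>J. a j > 0) \<and>
    extended_dynamics h (power_generators J d b (\<lambda>j. of_real (a j))) B \<and>
    \<not> connected (Julia \<langle>insert h (power_generators J d b (\<lambda>j. of_real (a j)))\<rangle>)"
proof -
  obtain c \<rho> where c: "c > 0" and \<rho>: "0 < \<rho>" "\<rho> \<le> 1" "\<And>j. j \<in> J \<Longrightarrow> cball (b j) \<rho> \<subseteq> interior K"
    and ext: "\<And>a. \<forall>j\<in>J. 0 < cmod (a j) \<and> cmod (a j) < c \<Longrightarrow>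
       extended_dynamics h (power_generators J d b a) (\<Union>j\<in>J. cball (b j) \<rho>)"
    using extended_dynamics_small_coefficients[of J d b, OF J bnd] by blast
  have e1: "e \<ge> 1" "\<alpha> \<ge> 1" using e(1) by (auto simp: Suc_le_eq intro!: Nat.gr0I)
  \<comment> \<open>The generators that do not depend on u: their growth constants can be fixed
    before u is chosen.\<close>
  define F where "F = insert h (power_generators (J - J') d b (\<lambda>j. of_real (c / 2)))"
  have fF: "finite F" using J(1) by (simp add: F_def power_generators_def)
  have degF: "degree f \<ge> 2 \<and> degree f \<ge> e" if "f \<in> F" for f
    using that J(2) e(2,3) c degree_h
    by (fastforce simp: F_def power_generators_def degree_centered_power)
  obtain \<kappa> R1 where \<kappa>: "\<kappa> > 0" "\<And>f z. f \<in> F \<Longrightarrow> cmod z \<ge> R1 \<Longrightarrow> \<kappa> * cmod z ^ e \<le> cmod (poly f z)"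
    using cmod_polys_lower_bound[OF fF, of e] degF e1 by metis
  obtain R0 where R0: "escape_radius F R0" using escape_radius_exists[OF fF] degF by metis
  define D where "D = (\<Sum>j\<in>J. real (d j))"
  have D: "real (d j) \<le> D" if "j \<in> J" for j
    unfolding D_def by (rule member_le_sum[OF that]) (use J(1) in auto)
  have D0: "D \<ge> 0" by (simp add: D_def sum_nonneg)
  define \<beta> where "\<beta> = 1 + (\<Sum>j\<in>J. cmod (b j))"
  have \<beta>: "cmod (b j) \<le> \<beta>" if "j \<in> J" for j
    using member_le_sum[OF that, of "\<lambda>j. cmod (b j)"] J(1) by (simp add: \<beta>_def)
  have \<beta>1: "\<beta> \<ge> 1" by (simp add: \<beta>_def sum_nonneg)
  \<comment> \<open>Outside radius T = C u^6 the quotient |z|/(2 u^6) is at least 2 (D + 1). One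
    factor 2 pays for |z - b j| being only at least |z|/2, and the 1 beside D pays for adding b j;
    what remains is growth by at least the degree.\<close>
  define C where "C = 4 * (D + 1)"
  have C: "C \<ge> 4" using D0 by (simp add: C_def)
  \<comment> \<open>Chosen so that at radius c1 u^\<alpha> the lower growth bound \<kappa> |z|^e is
    at least (C + 1) u^6, which exceeds T.\<close>
  define c1 where "c1 = max 1 ((C + 1) / \<kappa>)"
  have c1: "c1 \<ge> 1" "C + 1 \<le> \<kappa> * c1 ^ e"
  proof -
    show "c1 \<ge> 1" by (simp add: c1_def)
    then have "c1 \<le> c1 ^ e" using e1 power_increasing[of 1 e c1] by simp
    moreover have "(C + 1) / \<kappa> \<le> c1" by (simp add: c1_def)
    ultimately have "(C + 1) / \<kappa> \<le> c1 ^ e" by linarith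
    then show "C + 1 \<le> \<kappa> * c1 ^ e" using \<kappa>(1) by (simp add: divide_le_eq mult.commute)
  qed
  \<comment> \<open>Each summand secures one requirement: coefficients below c, the growth estimates
    of F at the radii in question, |b j| at most u/2, radii beyond S, and a nonempty
    annulus.\<close>
  define u where "u = 1 + 1 / c + \<bar>R0\<bar> + 2 * \<beta> + \<bar>R1\<bar> + S + 2 * c1 / \<rho>"
  have upos: "1 / c > 0" "2 * c1 / \<rho> > 0" using c c1 \<rho> by auto
  have u: "u \<ge> 1" "u > 1 / c" "u \<ge> R0" "u \<ge> 2 * \<beta>" "u \<ge> R1" "u \<ge> S" "u > 2 * c1 / \<rho>"
    using upos S_ge_1 \<beta>1 unfolding u_def by linarith+
  have u_pow: "u \<le> u ^ n" if "n \<ge> 1" for n using power_increasing[of 1 n u] u(1) that by simp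
  define a where "a j = (if j \<in> J' then 1 / u ^ (6 * (d j - 1)) else c / 2)" for j
  have apos: "a j > 0" for j using u(1) c by (auto simp: a_def)
  have ac: "a j < c" if "j \<in> J" for j
  proof (cases "j \<in> J'")
    case True
    have "u \<le> u ^ (6 * (d j - 1))" by (rule u_pow) (use J(2)[OF that] in simp)
    then have "1 / u ^ (6 * (d j - 1)) \<le> 1 / u" using u(1) by (intro divide_left_mono) auto
    also have "\<dots> < c" using u(1,2) c by (simp add: field_simps)
    finally show ?thesis using True by (simp add: a_def)
  qed (use c in \<open>simp add: a_def\<close>)
  define Q where "Q = power_generators J d b (\<lambda>j. of_real (a j))"
  have "\<forall>j\<in>J. 0 < cmod (complex_of_real (a j)) \<and> cmod (complex_of_real (a j)) < c"
  proof
    fix j assume "j \<in> J"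
    then show "0 < cmod (complex_of_real (a j)) \<and> cmod (complex_of_real (a j)) < c"
      using apos[of j] ac[of j] by simp
  qed
  then have extQ: "extended_dynamics h Q (\<Union>j\<in>J. cball (b j) \<rho>)" unfolding Q_def by (rule ext)
  interpret ext: extended_dynamics h Q "\<Union>j\<in>J. cball (b j) \<rho>" by (rule extQ)
  have gen: "f \<in> F \<or> (\<exists>j\<in>J'. f = centered_power (of_real (a j)) (b j) (d j))" if f: "f \<in> insert h Q" for f
  proof (cases "f = h")
    case False
    then obtain j where j: "j \<in> J" "f = centered_power (of_real (a j)) (b j) (d j)"
      using f by (auto simp: Q_def power_generators_def)
    show ?thesis
    proof (cases "j \<in> J'")
      case False
      then have "f = centered_power (of_real (c / 2)) (b j) (d j)" "j \<in> J - J'"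
        using j by (simp_all add: a_def)
      then show ?thesis unfolding F_def power_generators_def by blast
    qed (use j in blast)
  qed (simp add: F_def)
  define T where "T = C * u ^ 6"
  have u6: "u \<le> u ^ 6" by (rule u_pow) simp
  have "1 * u ^ 6 \<le> T" unfolding T_def using C u(1) by (intro mult_right_mono) auto
  then have Tu: "u ^ 6 \<le> T" by simp
  have T: "escape_radius (insert h Q) T"
    unfolding escape_radius_def
  proof (intro conjI ballI allI impI)
    show "1 \<le> T" using Tu u6 u(1) by linarith
    fix f z assume f: "f \<in> insert h Q" and z: "T \<le> cmod z"
    from gen[OF f] show "real (degree f) * cmod z \<le> cmod (poly f z)"
    proof (elim disjE bexE)
      assume "f \<in> F"
      then show ?thesis using R0 z Tu u6 u(3) by (auto simp: escape_radius_def)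
    next
      fix j assume j: "j \<in> J'" and fj: "f = centered_power (of_real (a j)) (b j) (d j)"
      have jJ: "j \<in> J" using j J' by blast
      obtain n where n: "d j = Suc (Suc n)" using J(2)[OF jJ] by (metis add_2_eq_Suc le_Suc_ex)
      have up: "u ^ 6 > 0" using u(1) by simp
      have b: "2 * cmod (b j) \<le> cmod z" using \<beta>[OF jJ] u(4) u6 Tu z by linarith
      then have "cmod z / 2 \<le> cmod (z - b j)" using norm_triangle_ineq2[of z "b j"] by linarith
      then have "(cmod z / 2) ^ d j \<le> cmod (z - b j) ^ d j" by (intro power_mono) auto
      then have 1: "a j * (cmod z / 2) ^ d j \<le> a j * cmod (z - b j) ^ d j"
        using apos[of j] by (intro mult_left_mono) auto
      have aj: "a j = 1 / (u ^ 6) ^ Suc n" using j n by (simp add: a_def power_mult[symmetric] power_add)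
      have "a j * (cmod z / 2) ^ d j = cmod z / 2 * (cmod z / (2 * u ^ 6)) ^ Suc n"
        using up unfolding aj n by (simp add: power_divide power_mult_distrib field_simps)
      moreover have "2 * (D + 1) \<le> (cmod z / (2 * u ^ 6)) ^ Suc n"
      proof -
        have ge: "2 * (D + 1) \<le> cmod z / (2 * u ^ 6)" using z up by (simp add: T_def C_def field_simps)
        have "1 \<le> 2 * (D + 1)" using D0 by simp
        from order_trans[OF this ge] have "cmod z / (2 * u ^ 6) \<le> (cmod z / (2 * u ^ 6)) ^ Suc n"
          using power_increasing[of 1 "Suc n" "cmod z / (2 * u ^ 6)"] by simp
        with ge show ?thesis by (rule order_trans)
      qed
      then have "cmod z / 2 * (2 * (D + 1)) \<le> cmod z / 2 * (cmod z / (2 * u ^ 6)) ^ Suc n"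
        by (intro mult_left_mono) auto
      ultimately have "cmod z / 2 * (2 * (D + 1)) \<le> a j * cmod (z - b j) ^ d j" using 1 by linarith
      moreover have "cmod z / 2 * (2 * (D + 1)) = cmod z * (D + 1)" by simp
      ultimately have 2: "cmod z * (D + 1) \<le> a j * cmod (z - b j) ^ d j" by linarith
      have "poly f z - b j = of_real (a j) * (z - b j) ^ d j" by (simp add: fj poly_centered_power)
      then have "cmod (poly f z - b j) = a j * cmod (z - b j) ^ d j"
        using apos[of j] by (simp add: norm_mult norm_power)
      then have "cmod z * (D + 1) - cmod (b j) \<le> cmod (poly f z)"
        using 2 norm_triangle_ineq4[of "poly f z" "b j"] by linarith
      moreover have "cmod z * real (d j) \<le> cmod z * D" using D[OF jJ] by (intro mult_left_mono) auto
      moreover have "degree f = d j" using apos[of j] n by (simp add: fj degree_centered_power)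
      moreover have "cmod (b j) \<le> cmod z" using b norm_ge_zero[of "b j"] by linarith
      ultimately show ?thesis by (simp add: algebra_simps)
    qed
  qed
  \<comment> \<open>The inner radius is where the generators in F begin to reach beyond T. The half
    in s' leaves room for the shift by b j when the generators in J' are estimated.\<close>
  define s where "s = c1 * u ^ \<alpha>"
  define s' where "s' = \<rho> / 2 * u ^ (\<alpha> + 1)"
  have us: "u \<le> s"
  proof -
    have "1 * u \<le> c1 * u ^ \<alpha>" using c1 u_pow[OF e1(2)] u(1) by (intro mult_mono) auto
    then show ?thesis by (simp add: s_def)
  qed
  have "c1 < \<rho> / 2 * u" using u(7) \<rho>(1) by (simp add: field_simps)
  then have "c1 * u ^ \<alpha> < \<rho> / 2 * u * u ^ \<alpha>" using u(1) by (intro mult_strict_right_mono) auto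
  then have ss': "s < s'" by (simp add: s_def s'_def mult_ac)
  \<comment> \<open>The annulus must lie inside the Julia circle of the generator with index j0; the
    exponent condition on \<alpha> forces \<open>\<alpha> + 1 \<le> 6\<close>.\<close>
  have jD: "u ^ (\<alpha> + 1) \<le> u ^ 6"
  proof -
    have "(\<alpha> + 1) * d j0 \<le> 6 * (d j0 - 1)" by (rule \<alpha>[OF J'(2)])
    also have "\<dots> \<le> 6 * d j0" by simp
    finally have "\<alpha> + 1 \<le> 6" using J(2)[of j0] J' by auto
    then show ?thesis using u(1) by (intro power_increasing) auto
  qed
  have j0: "j0 \<in> J" using J' by blast
  have "\<not> connected (Julia \<langle>insert h Q\<rangle>)"
  proof (rule ext.Julia_G_disconnected[OF T _ ss'])
    show "S \<le> s" using us u(6) by linarith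
    show "K \<noteq> {}" using J(3)[OF j0] interior_subset by blast
    show "centered_power (of_real (a j0)) (b j0) (d j0) \<in> Q" using j0 by (auto simp: Q_def power_generators_def)
    show "cball (b j0) (u ^ 6) \<subseteq> filled_Julia (centered_power (of_real (a j0)) (b j0) (d j0))"
    proof (rule ball_subset_filled_Julia_centered_power)
      show "cmod (complex_of_real (a j0)) * (u ^ 6) ^ (d j0 - 1) \<le> 1"
        using J'(2) u(1) by (simp add: a_def power_mult[symmetric] norm_divide norm_power)
    qed (use J(2)[OF j0] u(1) in auto)
    show "0 \<le> u ^ 6" using u(1) by simp
    have "2 * s' \<le> u ^ (\<alpha> + 1)"
      using \<rho>(2) u(1) by (simp add: s'_def mult_left_le_one_le)
    then show "s + cmod (b j0) < u ^ 6"
      using ss' jD \<beta>[OF j0] \<beta>1 us u(4) by linarith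
  next
    fix f z assume f: "f \<in> insert h Q" and z: "s < cmod z" "cmod z < s'"
    from gen[OF f] show "T < cmod (poly f z) \<or> poly f z \<in> interior K"
    proof (elim disjE bexE)
      assume fF: "f \<in> F"
      \<comment> \<open>The relation e \<alpha> = 6 turns the power of the inner radius into the
        scale u^6 of T.\<close>
      have "s ^ e = c1 ^ e * u ^ 6"
        using e(1) by (simp add: s_def power_mult_distrib power_mult[symmetric] mult.commute)
      then have "(C + 1) * u ^ 6 \<le> \<kappa> * s ^ e"
        using c1(2) u(1) by (simp add: mult.assoc[symmetric] mult_right_mono)
      also have "\<dots> \<le> \<kappa> * cmod z ^ e" using z(1) us u(1) \<kappa>(1) by (intro mult_left_mono power_mono) auto
      also have "\<dots> \<le> cmod (poly f z)" by (rule \<kappa>(2)[OF fF]) (use z(1) us u(5) in linarith)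
      finally have "(C + 1) * u ^ 6 \<le> cmod (poly f z)" .
      moreover have "T < (C + 1) * u ^ 6" using u(1) by (simp add: T_def distrib_right)
      ultimately have "T < cmod (poly f z)" by linarith
      then show ?thesis ..
    next
      fix j assume j: "j \<in> J'" and fj: "f = centered_power (of_real (a j)) (b j) (d j)"
      have jJ: "j \<in> J" using j J' by blast
      have "cmod (z - b j) \<le> cmod z + cmod (b j)" by (rule norm_triangle_ineq4)
      also have "\<dots> \<le> \<rho> * u ^ (\<alpha> + 1)"
        using z \<beta>[OF jJ] us u(4) \<beta>1 unfolding s'_def by linarith
      finally have "cmod (z - b j) ^ d j \<le> (\<rho> * u ^ (\<alpha> + 1)) ^ d j" by (intro power_mono) auto
      also have "\<dots> = \<rho> ^ d j * u ^ ((\<alpha> + 1) * d j)" by (simp only: power_mult_distrib power_mult)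
      also have "\<dots> \<le> \<rho> * u ^ (6 * (d j - 1))"
      proof (rule mult_mono)
        show "u ^ ((\<alpha> + 1) * d j) \<le> u ^ (6 * (d j - 1))"
          by (rule power_increasing[OF \<alpha>[OF j] u(1)])
        show "\<rho> ^ d j \<le> \<rho>" using \<rho> J(2)[OF jJ] power_decreasing[of 1 "d j" \<rho>] by simp
      qed (use u(1) \<rho> in auto)
      finally have le: "cmod (z - b j) ^ d j \<le> \<rho> * u ^ (6 * (d j - 1))" .
      have "a j * cmod (z - b j) ^ d j \<le> a j * (\<rho> * u ^ (6 * (d j - 1)))"
        using apos[of j] le by (intro mult_left_mono) auto
      also have "\<dots> = \<rho>" using j u(1) by (simp add: a_def)
      finally have "dist (b j) (poly f z) \<le> \<rho>"
        using apos[of j] by (simp add: fj poly_centered_power dist_norm norm_minus_commute norm_mult norm_power)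
      then show ?thesis using \<rho>(3)[OF jJ] by auto
    qed
  qed
  then show ?thesis using apos extQ unfolding Q_def by blast
qed

end

theorem theorem2p61:
  fixes m :: nat and d :: "nat \<Rightarrow> nat" and h1 :: "complex poly" and b :: "nat \<Rightarrow> complex"
  assumes "m \<ge> 2"
    and "\<forall>j\<in>{2..m}. d j \<ge> 2"
    and "degree h1 \<ge> 2"
    and "interior (filled_Julia h1) \<noteq> {}"
    and "\<langle>{h1}\<rangle> \<in> \<G>"
    and "\<forall>j\<in>{2..m}. b j \<in> interior (filled_Julia h1)"
  shows
    "(semi_hyperbolic \<langle>{h1}\<rangle> \<longrightarrow>
       (\<exists>c>0. \<forall>a::nat \<Rightarrow> complex. (\<forall>j\<in>{2..m}. 0 < cmod (a j) \<and> cmod (a j) < c) \<longrightarrow>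
          (let G = extended_semigroup h1 m d b a
           in G \<in> \<G> \<and> K_hat G = filled_Julia h1 \<and> semi_hyperbolic G)))
   \<and> (hyperbolic \<langle>{h1}\<rangle> \<longrightarrow>
       (\<exists>c>0. \<forall>a::nat \<Rightarrow> complex. (\<forall>j\<in>{2..m}. 0 < cmod (a j) \<and> cmod (a j) < c) \<longrightarrow>
          (let G = extended_semigroup h1 m d b a
           in G \<in> \<G> \<and> K_hat G = filled_Julia h1 \<and> hyperbolic G)))
   \<and> ((\<exists>j\<in>{2..m}. d j \<ge> 3) \<or> (degree h1 = 3 \<and> (\<forall>i\<in>{2..m}. \<forall>j\<in>{2..m}. b i = b j)) \<longrightarrow>
       (semi_hyperbolic \<langle>{h1}\<rangle> \<longrightarrow>
         (\<exists>a::nat \<Rightarrow> real. (\<forall>j\<in>{2..m}. a j > 0) \<and>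
            (let G = extended_semigroup h1 m d b (\<lambda>j. complex_of_real (a j))
             in G \<in> \<G>\<^sub>d\<^sub>i\<^sub>s \<and> K_hat G = filled_Julia h1 \<and> semi_hyperbolic G)))
     \<and> (hyperbolic \<langle>{h1}\<rangle> \<longrightarrow>
         (\<exists>a::nat \<Rightarrow> real. (\<forall>j\<in>{2..m}. a j > 0) \<and>
            (let G = extended_semigroup h1 m d b (\<lambda>j. complex_of_real (a j))
             in G \<in> \<G>\<^sub>d\<^sub>i\<^sub>s \<and> K_hat G = filled_Julia h1 \<and> hyperbolic G))))"
proof -
  interpret poly_dynamics h1 by unfold_locales (rule assms(3))
  have J: "finite {2..m}" "\<And>j. j \<in> {2..m} \<Longrightarrow> d j \<ge> 2" "\<And>j. j \<in> {2..m} \<Longrightarrow> b j \<in> interior K"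
    using assms(2,6) by auto
  have bnd: "bounded (planar_postcritical \<langle>{h1}\<rangle>)" using assms(5) by (simp add: calG_def)
  have ext: "\<langle>insert h1 Q\<rangle> \<in> \<G> \<and> K_hat \<langle>insert h1 Q\<rangle> = K
      \<and> (semi_hyperbolic \<langle>{h1}\<rangle> \<longrightarrow> semi_hyperbolic \<langle>insert h1 Q\<rangle>)
      \<and> (hyperbolic \<langle>{h1}\<rangle> \<longrightarrow> hyperbolic \<langle>insert h1 Q\<rangle>)"
    if "extended_dynamics h1 Q B" for Q B
  proof -
    interpret extended_dynamics h1 Q B by (rule that)
    show ?thesis using G_mem_calG K_hat_G semi_hyperbolic_G hyperbolic_G by blast
  qed
  obtain c where c: "c > 0"
    and small: "\<And>a. \<forall>j\<in>{2..m}. 0 < cmod (a j) \<and> cmod (a j) < c \<Longrightarrow>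
       \<exists>B. extended_dynamics h1 (power_generators {2..m} d b a) B"
    using extended_dynamics_small_coefficients[of "{2..m}" d b, OF J bnd] by blast
  \<comment> \<open>The coefficients do not depend on which of the two properties is asked for, so
    both are carried along as implications and separated at the end.\<close>
  have part1: "\<exists>c>0. \<forall>a::nat \<Rightarrow> complex. (\<forall>j\<in>{2..m}. 0 < cmod (a j) \<and> cmod (a j) < c) \<longrightarrow>
          (let G = extended_semigroup h1 m d b a
           in G \<in> \<G> \<and> K_hat G = K \<and> (semi_hyperbolic \<langle>{h1}\<rangle> \<longrightarrow> semi_hyperbolic G) \<and> (hyperbolic \<langle>{h1}\<rangle> \<longrightarrow> hyperbolic G))"
    unfolding Let_def extended_semigroup_eq using c small ext by meson
  have part2: "\<exists>a::nat \<Rightarrow> real. (\<forall>j\<in>{2..m}. a j > 0) \<and>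
            (let G = extended_semigroup h1 m d b (\<lambda>j. complex_of_real (a j))
             in G \<in> \<G>\<^sub>d\<^sub>i\<^sub>s \<and> K_hat G = K \<and> (semi_hyperbolic \<langle>{h1}\<rangle> \<longrightarrow> semi_hyperbolic G) \<and> (hyperbolic \<langle>{h1}\<rangle> \<longrightarrow> hyperbolic G))"
    if cases: "(\<exists>j\<in>{2..m}. d j \<ge> 3) \<or> (degree h1 = 3 \<and> (\<forall>i\<in>{2..m}. \<forall>j\<in>{2..m}. b i = b j))"
  proof -
    have "\<exists>a::nat \<Rightarrow> real. \<exists>B. (\<forall>j\<in>{2..m}. a j > 0) \<and>
        extended_dynamics h1 (power_generators {2..m} d b (\<lambda>j. of_real (a j))) B \<and>
        \<not> connected (Julia \<langle>insert h1 (power_generators {2..m} d b (\<lambda>j. of_real (a j)))\<rangle>)"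
    proof (cases "\<exists>j\<in>{2..m}. d j \<ge> 3")
      case True
      then obtain j0 where j0: "j0 \<in> {2..m}" "d j0 \<ge> 3" by blast
      \<comment> \<open>Here e = 2 and \<alpha> = 3: the condition 4 d <= 6 (d - 1) on the shrinking
        generators says precisely d >= 3, and all other degrees are at least 2.\<close>
      show ?thesis
        using j0 J(2) assms(3)
        by (intro disconnecting_coefficients[of "{2..m}" d b "{j \<in> {2..m}. d j \<ge> 3}" j0 2 3, OF J bnd]) force+
    next
      case False
      then have deg: "degree h1 = 3" using cases by blast
      have "(2 + 1) * d j \<le> 6 * (d j - 1)" if "j \<in> {2..m}" for j using J(2)[OF that] by arith
      \<comment> \<open>Every added generator shrinks and only h1 stays fixed, with e = 3 and
        \<alpha> = 2; the condition becomes 3 d <= 6 (d - 1), that is d >= 2. The first 2 in the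
        instantiation is the index j0, available since m >= 2.\<close>
      then show ?thesis
        by (intro disconnecting_coefficients[of "{2..m}" d b "{2..m}" 2 3 2, OF J bnd])
          (use deg assms(1) in auto)
    qed
    then show ?thesis
      unfolding Let_def extended_semigroup_eq calG_dis_def using ext by blast
  qed
  show ?thesis using part1 part2 unfolding Let_def by blast
qed

end
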